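(* Let $\mathbf{x}=x_1,\ldots,x_s$ be a mixed multiplicity system of $M$ of the type $\mathbf{k}\in\mathbb{N}^d$. For each $1\le i\le s$, denote by $\mathbf{h}_i=(h_{i1},\ldots,h_{id})$ the type of the subsequence $x_1,\ldots,x_i$ of $\mathbf{x}$. Then for all large $\mathbf{n}$, $$e(M;\mathbf{k})=\ell_A\big[(M/\mathbf{x}M)_{\mathbf{n}}\big]-\sum_{i=1}^s e\left(\frac{(x_1,\ldots,x_{i-1})M:x_i}{(x_1,\ldots,x_{i-1})M};\ \mathbf{k}-\mathbf{h}_i\right).$$
   Context: $\mathbb{N}$ denotes the nonnegative integers and $d\ge 1$ is an integer. $(A,\mathfrak{m})$ is an Artinian local ring with infinite residue field; $S=\bigoplus_{\mathbf{n}\in\mathbb{N}^d}S_{\mathbf{n}}$ is a finitely generated standard $\mathbb{N}^d$-graded (commutative) algebra over $A$, i.e. $S$ is generated over $A$ by elements of total degree $1$; $M=\bigoplus_{\mathbf{n}\in\mathbb{N}^d}M_{\mathbf{n}}$ is a finitely generated $\mathbb{N}^d$-graded $S$-module. On $\mathbb{N}^d$, $\le$ is componentwise, and $\mathbf{h}>\mathbf{k}$ means $\mathbf{h}\ge\mathbf{k}$ and $\mathbf{h}\ne\mathbf{k}$. "For all large $\mathbf{n}$" means for all $\mathbf{n}$ with every component sufficiently large. Let $\mathbf{e}_i$ be the $i$-th unit vector of $\mathbb{N}^d$, $S_i=S_{\mathbf{e}_i}$, and $S_{++}=\bigoplus_{\mathbf{n}\ge(1,\ldots,1)}S_{\mathbf{n}}$.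 $\mathrm{Proj}\,S$ is the set of homogeneous prime ideals of $S$ not containing $S_{++}$; $\mathrm{Supp}_{++}M=\{P\in\mathrm{Proj}\,S: M_P\ne0\}$; its dimension is the supremum of lengths of chains of primes in it, with $\dim\emptyset=-\infty$. Mixed multiplicities: $\ell_A$ denotes length. For every finitely generated $\mathbb{N}^d$-graded $S$-module $M$ and all large $\mathbf{n}$, $\ell_A[M_{\mathbf{n}}]$ equals a polynomial $P_M(\mathbf{n})$ (the Hilbert polynomial), written uniquely as $P_M(\mathbf{n})=\sum_{\mathbf{k}\in\mathbb{N}^d}e(M;\mathbf{k})\binom{\mathbf{n}+\mathbf{k}}{\mathbf{k}}$ with $e(M;\mathbf{k})\in\mathbb{Z}$, where $\binom{\mathbf{n}+\mathbf{k}}{\mathbf{k}}=\prod_{i=1}^d\binom{n_i+k_i}{k_i}$. The mixed multiplicity (of maximal degree) of $M$ of the type $\mathbf{k}$ is defined if $e(M;\mathbf{h})=0$ for all $\mathbf{h}>\mathbf{k}$, and is then the number $e(M;\mathbf{k})$. A sequence of elements of $\bigcup_{j=1}^dS_j$ consisting of $k_1$ elements of $S_1$, ..., $k_d$ elements of $S_d$ (in any order) is said to be of the type $\mathbf{k}=(k_1,\ldots,k_d)$. A sequence $\mathbf{x}$ of the type $\mathbf{k}$ is a mixed multiplicity system of $M$ of the type $\mathbf{k}$ if $\dim\mathrm{Supp}_{++}(M/\mathbf{x}M)\le0$. For a submodule $L\subseteq M$ and $x\in S$, $L:x=\{m\in M: xm\in L\}$. *)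

theory Defs
  imports "HOL-Algebra.QuotRing" "HOL-Algebra.Module" "HOL-Algebra.Generated_Rings"
    "HOL-Analysis.Finite_Cartesian_Product" "HOL-Library.Extended_Nat" "HOL-Library.Extended_Real"
begin

text \<open>Multidegrees are vectors of type \<open>nat ^ 'd\<close> with a finite (nonempty) index type \<open>'d\<close>, so
  \<open>d = CARD('d) \<ge> 1\<close> is arbitrary.  Their order is the componentwise one; \<open>k < h\<close> means
  \<open>k \<le> h\<close> and \<open>k \<noteq> h\<close>.  The unit vector with index \<open>i\<close> is \<open>axis i 1\<close>.\<close>

definition for_all_large :: "(nat ^ 'd \<Rightarrow> bool) \<Rightarrow> bool" where
  "for_all_large Q \<longleftrightarrow> (\<exists>b. \<forall>n. (\<forall>i. b \<le> n $ i) \<longrightarrow> Q n)"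


section \<open>Rings and modules\<close>

locale artinian_local_ring = cring A + maximalideal \<mm> A for A (structure) and \<mm> +
  assumes unique_maximal: "\<And>\<nn>. maximalideal \<nn> A \<Longrightarrow> \<nn> = \<mm>"
    and descending_chain:
      "\<And>I :: nat \<Rightarrow> _ set. \<lbrakk>\<And>n. ideal (I n) A; \<And>n. I (Suc n) \<subseteq> I n\<rbrakk>
        \<Longrightarrow> \<exists>N. \<forall>n\<ge>N. I n = I N"

definition module_span ::
  "('a, 'r) ring_scheme \<Rightarrow> ('a, 'm, 'z) module_scheme \<Rightarrow> 'm set \<Rightarrow> 'm set" where
  "module_span R M X = \<Inter>{N. submodule N R M \<and> X \<subseteq> N}"

definition fin_gen_module ::
  "('a, 'r) ring_scheme \<Rightarrow> ('a, 'm, 'z) module_scheme \<Rightarrow> bool" where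
  "fin_gen_module R M \<longleftrightarrow>
    Module.module R M \<and> (\<exists>F\<subseteq>carrier M. finite F \<and> carrier M = module_span R M F)"

text \<open>The fields \<open>mult\<close> and \<open>one\<close>, which module records inherit from ring records, have no meaning
  for a module.\<close>

definition quotient_module :: "('a, 'm, 'z) module_scheme \<Rightarrow> 'm set \<Rightarrow> ('a, 'm set) module" where
  "quotient_module M L =
    \<lparr>carrier = a_rcosets\<^bsub>M\<^esub> L, mult = undefined, one = undefined, zero = L, add = set_add M,
     smult = (\<lambda>a X. \<Union>x\<in>X. L +>\<^bsub>M\<^esub> (a \<odot>\<^bsub>M\<^esub> x))\<rparr>"

definition seq_submodule ::
  "('a, 'r) ring_scheme \<Rightarrow> ('a, 'm, 'z) module_scheme \<Rightarrow> 'a list \<Rightarrow> 'm set" where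
  "seq_submodule R M xs = module_span R M {x \<odot>\<^bsub>M\<^esub> m | x m. x \<in> set xs \<and> m \<in> carrier M}"

definition colon :: "('a, 'm, 'z) module_scheme \<Rightarrow> 'm set \<Rightarrow> 'a \<Rightarrow> 'm set" where
  "colon M L x = {m \<in> carrier M. x \<odot>\<^bsub>M\<^esub> m \<in> L}"

definition module_length ::
  "('a, 'r) ring_scheme \<Rightarrow> ('a, 'm, 'z) module_scheme \<Rightarrow> enat" where
  "module_length R M = Sup {enat n | n. \<exists>C :: nat \<Rightarrow> 'm set.
      C 0 = {\<zero>\<^bsub>M\<^esub>} \<and> C n = carrier M \<and>
      (\<forall>i\<le>n. submodule (C i) R M) \<and> (\<forall>i<n. C i \<subset> C (Suc i))}"

text \<open>The localization of \<open>M\<close> at a prime ideal \<open>P\<close> consists of the classes of fractions \<open>m / s\<close> with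
  \<open>s\<close> outside \<open>P\<close>; it is regarded here as a module over the original ring.\<close>

definition fraction_rel ::
  "('a, 'r) ring_scheme \<Rightarrow> ('a, 'm, 'z) module_scheme \<Rightarrow> 'a set \<Rightarrow> (('m \<times> 'a) \<times> 'm \<times> 'a) set" where
  "fraction_rel R M P = {((m, s), (m', s')).
      m \<in> carrier M \<and> s \<in> carrier R - P \<and> m' \<in> carrier M \<and> s' \<in> carrier R - P \<and>
      (\<exists>u\<in>carrier R - P. u \<odot>\<^bsub>M\<^esub> (s' \<odot>\<^bsub>M\<^esub> m) = u \<odot>\<^bsub>M\<^esub> (s \<odot>\<^bsub>M\<^esub> m'))}"

definition localization ::
  "('a, 'r) ring_scheme \<Rightarrow> ('a, 'm, 'z) module_scheme \<Rightarrow> 'a set \<Rightarrow> ('a, ('m \<times> 'a) set) module" where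
  "localization R M P = (let rel = fraction_rel R M P in
    \<lparr>carrier = (carrier M \<times> (carrier R - P)) // rel, mult = undefined, one = undefined,
     zero = rel `` {(\<zero>\<^bsub>M\<^esub>, \<one>\<^bsub>R\<^esub>)},
     add = (\<lambda>X Y. \<Union>(m, s)\<in>X. \<Union>(m', s')\<in>Y.
              rel `` {(s' \<odot>\<^bsub>M\<^esub> m \<oplus>\<^bsub>M\<^esub> s \<odot>\<^bsub>M\<^esub> m', s \<otimes>\<^bsub>R\<^esub> s')}),
     smult = (\<lambda>a X. \<Union>(m, s)\<in>X. rel `` {(a \<odot>\<^bsub>M\<^esub> m, s)})\<rparr>)"


section \<open>Gradings\<close>

definition internal_direct_sum :: "('g, 'z) ring_scheme \<Rightarrow> ('i \<Rightarrow> 'g set) \<Rightarrow> bool" where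
  "internal_direct_sum G gr \<longleftrightarrow>
    (\<forall>n. subgroup (gr n) (add_monoid G)) \<and>
    (\<forall>x\<in>carrier G. \<exists>!f. (\<forall>n. f n \<in> gr n) \<and> finite {n. f n \<noteq> \<zero>\<^bsub>G\<^esub>} \<and>
       x = (\<Oplus>\<^bsub>G\<^esub>n\<in>{n. f n \<noteq> \<zero>\<^bsub>G\<^esub>}. f n))"

definition graded_algebra ::
  "('a, 'r) ring_scheme \<Rightarrow> ('a, 's, 'z) module_scheme \<Rightarrow> (nat ^ 'd \<Rightarrow> 's set) \<Rightarrow> bool" where
  "graded_algebra A S gr \<longleftrightarrow>
    algebra A S \<and> internal_direct_sum S gr \<and> (\<forall>n. submodule (gr n) A S) \<and> \<one>\<^bsub>S\<^esub> \<in> gr 0 \<and>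
    (\<forall>m n. \<forall>x\<in>gr m. \<forall>y\<in>gr n. x \<otimes>\<^bsub>S\<^esub> y \<in> gr (m + n))"

definition subalgebra_span ::
  "('a, 'r) ring_scheme \<Rightarrow> ('a, 's, 'z) module_scheme \<Rightarrow> 's set \<Rightarrow> 's set" where
  "subalgebra_span A S X = generate_ring S ((\<lambda>a. a \<odot>\<^bsub>S\<^esub> \<one>\<^bsub>S\<^esub>) ` carrier A \<union> X)"

definition fg_standard_graded_algebra ::
  "('a, 'r) ring_scheme \<Rightarrow> ('a, 's, 'z) module_scheme \<Rightarrow> (nat ^ 'd \<Rightarrow> 's set) \<Rightarrow> bool" where
  "fg_standard_graded_algebra A S gr \<longleftrightarrow>
    graded_algebra A S gr \<and>
    (\<exists>F\<subseteq>carrier S. finite F \<and> carrier S = subalgebra_span A S F) \<and>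
    carrier S = subalgebra_span A S (\<Union>i. gr (axis i 1))"

definition graded_module ::
  "('s, 'r) ring_scheme \<Rightarrow> (nat ^ 'd \<Rightarrow> 's set) \<Rightarrow> ('s, 'm, 'z) module_scheme \<Rightarrow>
   (nat ^ 'd \<Rightarrow> 'm set) \<Rightarrow> bool" where
  "graded_module S grS M grM \<longleftrightarrow>
    Module.module S M \<and> internal_direct_sum M grM \<and>
    (\<forall>m n. \<forall>x\<in>grS m. \<forall>y\<in>grM n. x \<odot>\<^bsub>M\<^esub> y \<in> grM (m + n))"

definition quotient_grading ::
  "('s, 'm, 'z) module_scheme \<Rightarrow> 'm set \<Rightarrow> (nat ^ 'd \<Rightarrow> 'm set) \<Rightarrow> nat ^ 'd \<Rightarrow> 'm set set" where
  "quotient_grading M L gr n = (\<lambda>m. L +>\<^bsub>M\<^esub> m) ` gr n"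

text \<open>The graded module \<open>(L : x) / L\<close>.\<close>

definition colon_quotient ::
  "('s, 'm, 'z) module_scheme \<Rightarrow> 'm set \<Rightarrow> 's \<Rightarrow> ('s, 'm set) module" where
  "colon_quotient M L x = quotient_module (M\<lparr>carrier := colon M L x\<rparr>) L"

definition colon_quotient_grading ::
  "('s, 'm, 'z) module_scheme \<Rightarrow> 'm set \<Rightarrow> 's \<Rightarrow> (nat ^ 'd \<Rightarrow> 'm set) \<Rightarrow>
   nat ^ 'd \<Rightarrow> 'm set set" where
  "colon_quotient_grading M L x gr =
    quotient_grading (M\<lparr>carrier := colon M L x\<rparr>) L (\<lambda>n. gr n \<inter> colon M L x)"


section \<open>Proj and supports\<close>

definition homogeneous_ideal :: "('s, 'r) ring_scheme \<Rightarrow> (nat ^ 'd \<Rightarrow> 's set) \<Rightarrow> 's set \<Rightarrow> bool" where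
  "homogeneous_ideal S gr I \<longleftrightarrow> ideal I S \<and> I = Idl\<^bsub>S\<^esub> (\<Union>n. I \<inter> gr n)"

definition irrelevant_ideal :: "('s, 'r) ring_scheme \<Rightarrow> (nat ^ 'd \<Rightarrow> 's set) \<Rightarrow> 's set" where
  "irrelevant_ideal S gr = generate (add_monoid S) (\<Union>n\<in>{n. \<forall>i. 1 \<le> n $ i}. gr n)"

definition Proj :: "('s, 'r) ring_scheme \<Rightarrow> (nat ^ 'd \<Rightarrow> 's set) \<Rightarrow> 's set set" where
  "Proj S gr =
    {P. primeideal P S \<and> homogeneous_ideal S gr P \<and> \<not> irrelevant_ideal S gr \<subseteq> P}"

definition Supp_pp ::
  "('s, 'r) ring_scheme \<Rightarrow> (nat ^ 'd \<Rightarrow> 's set) \<Rightarrow> ('s, 'm, 'z) module_scheme \<Rightarrow> 's set set" where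
  "Supp_pp S gr M =
    {P \<in> Proj S gr. carrier (localization S M P) \<noteq> {\<zero>\<^bsub>localization S M P\<^esub>}}"

text \<open>In the extended reals the supremum of the empty set is \<open>-\<infinity>\<close>, as required.\<close>

definition chain_dim :: "'s set set \<Rightarrow> ereal" where
  "chain_dim X = Sup {ereal (real n) | n. \<exists>C :: nat \<Rightarrow> 's set.
      (\<forall>i\<le>n. C i \<in> X) \<and> (\<forall>i<n. C i \<subset> C (Suc i))}"


section \<open>Mixed multiplicities\<close>

definition restrict_scalars ::
  "('a, 's, 'y) module_scheme \<Rightarrow> ('s, 'm, 'z) module_scheme \<Rightarrow> ('a, 'm) module" where
  "restrict_scalars S M =
    \<lparr>carrier = carrier M, mult = mult M, one = one M, zero = zero M, add = add M,
     smult = (\<lambda>a m. (a \<odot>\<^bsub>S\<^esub> \<one>\<^bsub>S\<^esub>) \<odot>\<^bsub>M\<^esub> m)\<rparr>"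

definition component_length ::
  "('a, 'r) ring_scheme \<Rightarrow> ('a, 's, 'y) module_scheme \<Rightarrow> ('s, 'm, 'z) module_scheme \<Rightarrow>
   (nat ^ 'd \<Rightarrow> 'm set) \<Rightarrow> nat ^ 'd \<Rightarrow> enat" where
  "component_length A S M gr n = module_length A ((restrict_scalars S M)\<lparr>carrier := gr n\<rparr>)"

text \<open>\<open>c\<close> is the family of coefficients of the Hilbert polynomial of \<open>M\<close> with respect to the basis
  of products of binomial coefficients.\<close>

definition is_hilbert_coeffs ::
  "('a, 'r) ring_scheme \<Rightarrow> ('a, 's, 'y) module_scheme \<Rightarrow> ('s, 'm, 'z) module_scheme \<Rightarrow>
   (nat ^ 'd \<Rightarrow> 'm set) \<Rightarrow> (nat ^ 'd \<Rightarrow> int) \<Rightarrow> bool" where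
  "is_hilbert_coeffs A S M gr c \<longleftrightarrow>
    finite {k. c k \<noteq> 0} \<and>
    for_all_large (\<lambda>n. component_length A S M gr n \<noteq> \<infinity> \<and>
      int (the_enat (component_length A S M gr n)) =
        (\<Sum>k\<in>{k. c k \<noteq> 0}. c k * (\<Prod>i\<in>UNIV. int ((n $ i + k $ i) choose (k $ i)))))"

definition mixed_mult ::
  "('a, 'r) ring_scheme \<Rightarrow> ('a, 's, 'y) module_scheme \<Rightarrow> ('s, 'm, 'z) module_scheme \<Rightarrow>
   (nat ^ 'd \<Rightarrow> 'm set) \<Rightarrow> nat ^ 'd \<Rightarrow> int" where
  "mixed_mult A S M gr = (THE c. is_hilbert_coeffs A S M gr c)"

definition mixed_mult_defined ::
  "('a, 'r) ring_scheme \<Rightarrow> ('a, 's, 'y) module_scheme \<Rightarrow> ('s, 'm, 'z) module_scheme \<Rightarrow>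
   (nat ^ 'd \<Rightarrow> 'm set) \<Rightarrow> nat ^ 'd \<Rightarrow> bool" where
  "mixed_mult_defined A S M gr k \<longleftrightarrow> (\<forall>h>k. mixed_mult A S M gr h = 0)"

text \<open>Since \<open>0\<close> lies in every \<open>S\<^sub>j\<close>, a sequence of elements is accompanied by the list \<open>js\<close> of the
  indices of the components \<open>S\<^sub>j\<close> from which its members are taken; the type is read off \<open>js\<close>.\<close>

definition seq_type :: "'d list \<Rightarrow> nat ^ 'd" where
  "seq_type js = (\<chi> j. count_list js j)"

definition is_degree_one_seq :: "(nat ^ 'd \<Rightarrow> 's set) \<Rightarrow> 'd list \<Rightarrow> 's list \<Rightarrow> bool" where
  "is_degree_one_seq gr js xs \<longleftrightarrow> list_all2 (\<lambda>j x. x \<in> gr (axis j 1)) js xs"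

definition mixed_mult_system ::
  "('s, 'r) ring_scheme \<Rightarrow> (nat ^ 'd \<Rightarrow> 's set) \<Rightarrow> ('s, 'm, 'z) module_scheme \<Rightarrow>
   'd list \<Rightarrow> 's list \<Rightarrow> nat ^ 'd \<Rightarrow> bool" where
  "mixed_mult_system S gr M js xs k \<longleftrightarrow>
    is_degree_one_seq gr js xs \<and> seq_type js = k \<and>
    chain_dim (Supp_pp S gr (quotient_module M (seq_submodule S M xs))) \<le> 0"

end

theory Submission
  imports Defs
begin

text \<open>
  Everything happens inside the lattice of graded submodules of \<open>M\<close>.  For graded submodules
  \<open>L \<subseteq> L'\<close> let \<open>H\<^bsub>L'/L\<^esub>(n)\<close> be the length over \<open>A\<close> of \<open>(L'/L)\<^sub>n\<close>.  The modules
  \<open>M\<close>, \<open>M/\<bold>xM\<close> and \<open>((x\<^sub>1,\<dots>,x\<^sub>i\<^sub>-\<^sub>1)M : x\<^sub>i)/(x\<^sub>1,\<dots>,x\<^sub>i\<^sub>-\<^sub>1)M\<close> are all of the form \<open>L'/L\<close>, and this length is that of an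
  interval of groups between \<open>L\<close> and \<open>L'\<close>, so that quotient modules have to be formed only at the very end.

  For \<open>z \<in> S\<^sub>j\<close> let \<open>K = (L : z) \<inter> L'\<close> and \<open>C = L + zL'\<close>.  Multiplication by \<open>z\<close> identifies \<open>L'/K\<close> with
  \<open>C/L\<close> up to a shift by \<open>\<bold>e\<^sub>j\<close>, whence
  \<open>H\<^bsub>L'/L\<^esub>(n + \<bold>e\<^sub>j) - H\<^bsub>L'/L\<^esub>(n) = H\<^bsub>L'/C\<^esub>(n + \<bold>e\<^sub>j) - H\<^bsub>K/L\<^esub>(n)\<close>.
  In the basis \<open>binom (n + k) k\<close> the backward difference in direction \<open>j\<close> is the index shift
  \<open>k \<mapsto> k + \<bold>e\<^sub>j\<close> on coefficients.  So the displayed equation says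
  \<open>e(L'/L; h + \<bold>e\<^sub>j) = e(L'/C; h) - e(K/L; h) + e(K/L; h + \<bold>e\<^sub>j)\<close> (lemma \<open>hilbert_coeffs_recursion\<close>).
  Applied to \<open>L = (x\<^sub>1,\<dots>,x\<^sub>i\<^sub>-\<^sub>1)M\<close>, \<open>L' = M\<close>, \<open>z = x\<^sub>i\<close> and \<open>h = \<bold>k - \<bold>h\<^sub>i\<close> it
  gives the formula by telescoping, provided that the last coefficient vanishes for each \<open>i\<close> and that the
  Hilbert function of \<open>M/\<bold>xM\<close> is eventually constant, equal to \<open>e(M/\<bold>xM; 0)\<close>.

  Both provisos come from the hypothesis on the dimension.  By Nakayama's lemma the primes of \<open>Proj S\<close> that
  contain \<open>\<bold>x\<close> and the annihilator of \<open>M\<close> belong to the support of \<open>M/\<bold>xM\<close>, so there are no chains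
  among them.  A prime filtration then shows that a subquotient of \<open>M\<close> killed by \<open>\<bold>x\<close> has an eventually constant
  Hilbert function: a factor \<open>S/P\<close> with \<open>P \<in> Proj S\<close> has for each \<open>j\<close> a nonzerodivisor \<open>z \<in> S\<^sub>j\<close>, and
  all homogeneous primes containing \<open>P\<close> and \<open>z\<close> contain \<open>S\<^sub>+\<^sub>+\<close>, so that \<open>S/(P + zS)\<close> vanishes in large degrees and
  \<open>H\<^bsub>S/P\<^esub>\<close> is invariant under the shift by \<open>\<bold>e\<^sub>j\<close> (lemma \<open>hilb_eventually_constant\<close>).  By induction on the
  length of the sequence, the recursion propagates this to the vanishing of the coefficients of index greater than the type of a
  mixed multiplicity system (lemma \<open>hilbert_coeffs_vanish\<close>).  The induction runs over all subquotients at once; its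
  hypothesis is a condition on the primes above an annihilator, which passes to \<open>K/L\<close> and \<open>L'/C\<close> because
  \<open>z\<close> kills both.

  What remains is foundational.  An Artinian local ring has finite length; Hilbert's basis theorem holds in the form that
  adjoining one commuting operator preserves the ascending chain condition; hence \<open>M\<close> and \<open>S\<close> satisfy this condition
  on graded submodules, and the components of \<open>M\<close> have finite length.  Hilbert polynomials exist because a function all of whose
  differences are eventually polynomial is itself eventually polynomial.
\<close>

text \<open>This keeps unit vectors in the form \<open>axis j 1\<close>.\<close>

declare One_nat_def [simp del]

section \<open>Numerical polynomials in several variables\<close>

lemma for_all_large_conj:
  assumes "for_all_large P" "for_all_large Q"
  shows "for_all_large (\<lambda>n. P n \<and> Q n)"
proof -
  obtain a b where "\<forall>n. (\<forall>i. a \<le> n $ i) \<longrightarrow> P n" "\<forall>n. (\<forall>i. b \<le> n $ i) \<longrightarrow> Q n"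
    using assms unfolding for_all_large_def by blast
  then show ?thesis unfolding for_all_large_def
    by (intro exI[of _ "max a b"]) auto
qed

lemma for_all_large_mono:
  "for_all_large P \<Longrightarrow> (\<And>n. P n \<Longrightarrow> Q n) \<Longrightarrow> for_all_large Q"
  unfolding for_all_large_def by blast

lemma for_all_large_all:
  fixes P :: "'d::finite \<Rightarrow> nat ^ 'd \<Rightarrow> bool"
  assumes "\<And>j. for_all_large (P j)"
  shows "for_all_large (\<lambda>n. \<forall>j. P j n)"
proof -
  obtain b where b: "\<And>j n. (\<forall>i. b j \<le> n $ i) \<Longrightarrow> P j n"
    using assms unfolding for_all_large_def by metis
  have "b j \<le> Max (range b)" for j by simp
  then show ?thesis unfolding for_all_large_def
    by (intro exI[of _ "Max (range b)"]) (meson b order_trans)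
qed

lemma for_all_large_shift:
  assumes "for_all_large P"
  shows "for_all_large (\<lambda>n. P (n + a))"
proof -
  obtain b where b: "\<forall>n. (\<forall>i. b \<le> n $ i) \<longrightarrow> P n"
    using assms unfolding for_all_large_def by blast
  have "P (n + a)" if "\<forall>i. b \<le> n $ i" for n
    using b[rule_format, of "n + a"] that by (simp add: trans_le_add1)
  then show ?thesis unfolding for_all_large_def by blast
qed

lemma for_all_large_unshift:
  assumes "for_all_large (\<lambda>n. P (n + k))" shows "for_all_large P"
proof -
  obtain b where b: "\<forall>n. (\<forall>i. b \<le> n $ i) \<longrightarrow> P (n + k)" using assms unfolding for_all_large_def by blast
  have "P n" if n: "\<forall>i. b + (\<Sum>i\<in>UNIV. k $ i) \<le> n $ i" for n
  proof -
    have "k $ i \<le> (\<Sum>i\<in>UNIV. k $ i)" for i by (rule member_le_sum) auto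
    then have le: "b + k $ i \<le> n $ i" for i using n[rule_format, of i] by (meson add_left_mono order_trans)
    define m where "m = (\<chi> i. n $ i - k $ i)"
    have "n $ i = m $ i + k $ i" "b \<le> m $ i" for i using le[of i] by (simp_all add: m_def)
    then have "n = m + k" "\<forall>i. b \<le> m $ i" by (simp_all add: vec_eq_iff)
    then show ?thesis using b by blast
  qed
  then show ?thesis unfolding for_all_large_def by blast
qed

lemma for_all_large_ex:
  assumes "for_all_large P" shows "\<exists>n. P n"
proof -
  obtain b where "\<forall>n. (\<forall>i. b \<le> n $ i) \<longrightarrow> P n" using assms unfolding for_all_large_def by blast
  then have "P (\<chi> i. b)" by simp
  then show ?thesis by blast
qed

definition binomial_basis :: "nat ^ 'd \<Rightarrow> nat ^ 'd \<Rightarrow> int" where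
  "binomial_basis k n = (\<Prod>i\<in>UNIV. int ((n $ i + k $ i) choose (k $ i)))"

definition numerical_poly :: "(nat ^ 'd \<Rightarrow> int) \<Rightarrow> nat ^ 'd \<Rightarrow> int" where
  "numerical_poly c n = (\<Sum>k\<in>{k. c k \<noteq> 0}. c k * binomial_basis k n)"

definition finite_coeffs :: "(nat ^ 'd \<Rightarrow> int) \<Rightarrow> bool" where
  "finite_coeffs c \<longleftrightarrow> finite {k. c k \<noteq> 0}"

text \<open>The effect on coefficients of the backward difference in direction \<open>j\<close>.\<close>

definition lower_coeffs :: "'d \<Rightarrow> (nat ^ 'd \<Rightarrow> int) \<Rightarrow> nat ^ 'd \<Rightarrow> int" where
  "lower_coeffs j c = (\<lambda>h. c (h + axis j 1))"

lemma numerical_poly_superset: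
  assumes "finite F" "{k. c k \<noteq> 0} \<subseteq> F"
  shows "numerical_poly c n = (\<Sum>k\<in>F. c k * binomial_basis k n)"
  unfolding numerical_poly_def by (rule sum.mono_neutral_left) (use assms in auto)

lemma finite_coeffs_add: "finite_coeffs c \<Longrightarrow> finite_coeffs c' \<Longrightarrow> finite_coeffs (\<lambda>k. c k + c' k)"
  and finite_coeffs_diff: "finite_coeffs c \<Longrightarrow> finite_coeffs c' \<Longrightarrow> finite_coeffs (\<lambda>k. c k - c' k)"
  unfolding finite_coeffs_def
  by (erule (1) finite_subset[OF _ finite_UnI, rotated], force)+

lemma numerical_poly_add:
  assumes "finite_coeffs c" "finite_coeffs c'"
  shows "numerical_poly (\<lambda>k. c k + c' k) n = numerical_poly c n + numerical_poly c' n"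
proof -
  let ?F = "{k. c k \<noteq> 0} \<union> {k. c' k \<noteq> 0}"
  have F: "finite ?F" using assms by (simp add: finite_coeffs_def)
  have "numerical_poly (\<lambda>k. c k + c' k) n = (\<Sum>k\<in>?F. (c k + c' k) * binomial_basis k n)"
    by (rule numerical_poly_superset[OF F]) auto
  moreover have "numerical_poly c n = (\<Sum>k\<in>?F. c k * binomial_basis k n)"
    "numerical_poly c' n = (\<Sum>k\<in>?F. c' k * binomial_basis k n)"
    by (rule numerical_poly_superset[OF F]; auto)+
  ultimately show ?thesis by (simp add: distrib_right sum.distrib)
qed

lemma numerical_poly_diff:
  assumes "finite_coeffs c" "finite_coeffs c'"
  shows "numerical_poly (\<lambda>k. c k - c' k) n = numerical_poly c n - numerical_poly c' n"
  using numerical_poly_add[OF finite_coeffs_diff[OF assms] assms(2), of n] by simp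

lemma binomial_basis_remove:
  "binomial_basis k n = int ((n $ j + k $ j) choose (k $ j)) *
     (\<Prod>i\<in>UNIV - {j}. int ((n $ i + k $ i) choose (k $ i)))"
  unfolding binomial_basis_def by (simp add: prod.remove[of UNIV j])

text \<open>Pascal's rule in the variable \<open>j\<close>.  The basis with \<open>n + k\<close> in place of \<open>n\<close> is what makes the backward, not the forward,
  difference lower the index by a unit vector.\<close>

lemma binomial_basis_difference:
  shows "k $ j = 0 \<Longrightarrow> binomial_basis k (n + axis j 1) = binomial_basis k n"
    and "binomial_basis (h + axis j 1) (n + axis j 1) - binomial_basis (h + axis j 1) n
       = binomial_basis h (n + axis j 1)"
proof -
  have eq: "(\<Prod>i\<in>UNIV - {j}. f (axis j 1 $ i) i) = (\<Prod>i\<in>UNIV - {j}. f 0 i)"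
    for f :: "nat \<Rightarrow> 'a \<Rightarrow> int"
    by (rule prod.cong) (auto simp: axis_def)
  show "binomial_basis k (n + axis j 1) = binomial_basis k n" if "k $ j = 0"
    using that eq[of "\<lambda>t i. int ((n $ i + t + k $ i) choose (k $ i))"]
    by (simp add: binomial_basis_remove[of _ _ j])
  let ?p = "\<Prod>i\<in>UNIV - {j}. int ((n $ i + h $ i) choose (h $ i))"
  have "binomial_basis (h + axis j 1) (n + axis j 1) = int ((n $ j + h $ j + 2) choose (h $ j + 1)) * ?p"
    "binomial_basis (h + axis j 1) n = int ((n $ j + h $ j + 1) choose (h $ j + 1)) * ?p"
    "binomial_basis h (n + axis j 1) = int ((n $ j + h $ j + 1) choose (h $ j)) * ?p"
    using eq[of "\<lambda>t i. int ((n $ i + t + (h $ i + t)) choose (h $ i + t))"]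
      eq[of "\<lambda>t i. int ((n $ i + (h $ i + t)) choose (h $ i + t))"]
      eq[of "\<lambda>t i. int ((n $ i + t + h $ i) choose (h $ i))"]
    by (simp_all add: binomial_basis_remove[of _ _ j] One_nat_def)
  moreover have "(n $ j + h $ j + 2) choose (h $ j + 1) =
      ((n $ j + h $ j + 1) choose (h $ j)) + ((n $ j + h $ j + 1) choose (h $ j + 1))"
    by (simp add: One_nat_def)
  ultimately show "binomial_basis (h + axis j 1) (n + axis j 1) - binomial_basis (h + axis j 1) n
       = binomial_basis h (n + axis j 1)"
    by (simp add: algebra_simps)
qed

lemma pos_component_split:
  fixes k :: "nat ^ 'd"
  assumes "k $ j \<noteq> 0" obtains h where "k = h + axis j 1"
  by (rule that[of "\<chi> i. k $ i - axis j 1 $ i"]) (use assms in \<open>auto simp: vec_eq_iff axis_def\<close>)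

lemma finite_lower_coeffs:
  assumes "finite_coeffs c" shows "finite_coeffs (lower_coeffs j c)"
proof -
  have "inj_on (\<lambda>h. h + axis j 1) A" for A :: "(nat ^ 'a) set" by (simp add: inj_on_def)
  then show ?thesis using assms finite_vimageI[of "{k. c k \<noteq> 0}" "\<lambda>h. h + axis j 1"]
    unfolding finite_coeffs_def lower_coeffs_def vimage_def by auto
qed

lemma numerical_poly_difference:
  assumes "finite_coeffs c"
  shows "numerical_poly c (n + axis j 1) - numerical_poly c n
       = numerical_poly (lower_coeffs j c) (n + axis j 1)"
proof -
  let ?F = "{k. c k \<noteq> 0}" and ?G = "{h. lower_coeffs j c h \<noteq> 0}"
  let ?d = "\<lambda>k. binomial_basis k (n + axis j 1) - binomial_basis k n"
  have F: "finite ?F" using assms by (simp add: finite_coeffs_def)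
  have G: "(\<lambda>h. h + axis j 1) ` ?G \<subseteq> ?F" by (auto simp: lower_coeffs_def)
  have "numerical_poly c (n + axis j 1) - numerical_poly c n = (\<Sum>k\<in>?F. c k * ?d k)"
    by (simp add: numerical_poly_def right_diff_distrib sum_subtractf)
  also have "\<dots> = (\<Sum>k\<in>(\<lambda>h. h + axis j 1) ` ?G. c k * ?d k)"
  proof (rule sum.mono_neutral_right[OF F G], safe)
    fix k assume "c k \<noteq> 0" "k \<notin> (\<lambda>h. h + axis j 1) ` ?G"
    then have "k $ j = 0" using pos_component_split[of k j] by (auto simp: lower_coeffs_def)
    then show "c k * ?d k = 0" by (simp add: binomial_basis_difference)
  qed
  also have "\<dots> = (\<Sum>h\<in>?G. c (h + axis j 1) * ?d (h + axis j 1))"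
    by (rule sum.reindex_cong[of "\<lambda>h. h + axis j 1"]) (auto simp: inj_on_def)
  also have "\<dots> = numerical_poly (lower_coeffs j c) (n + axis j 1)"
    unfolding numerical_poly_def by (simp add: binomial_basis_difference lower_coeffs_def)
  finally show ?thesis .
qed

lemma numerical_poly_constant:
  assumes "\<And>h. h \<noteq> 0 \<Longrightarrow> c h = 0"
  shows "numerical_poly c n = c 0"
  using numerical_poly_superset[of "{0}" c n] assms by (auto simp: binomial_basis_def)

lemma nonzero_component:
  fixes h :: "nat ^ 'd" assumes "h \<noteq> 0" obtains j g where "h = g + axis j 1"
proof -
  obtain j where "h $ j \<noteq> 0" using assms by (auto simp: vec_eq_iff)
  then show ?thesis using pos_component_split that by metis
qed

text \<open>A family of coefficients of total degree at most \<open>B\<close> has differences of total degree less than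
  \<open>B\<close>; a polynomial all of whose differences vanish is constant.\<close>

lemma numerical_poly_eventually_zero:
  assumes "finite_coeffs c" "for_all_large (\<lambda>n. numerical_poly c n = 0)"
  shows "c k = 0"
proof -
  have *: "c k = 0" if "finite_coeffs c" "for_all_large (\<lambda>n. numerical_poly c n = 0)"
    "\<And>k. c k \<noteq> 0 \<Longrightarrow> (\<Sum>i\<in>UNIV. k $ i) < B" for B c and k :: "nat ^ 'a"
    using that
  proof (induction B arbitrary: c k)
    case 0 then show ?case by auto
  next
    case (Suc B)
    have low: "lower_coeffs j c h = 0" for j h
    proof (rule Suc.IH)
      show "finite_coeffs (lower_coeffs j c)" using Suc.prems(1) by (rule finite_lower_coeffs)
      have "for_all_large (\<lambda>n. numerical_poly (lower_coeffs j c) (n + axis j 1) = 0)"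
        by (rule for_all_large_mono[OF for_all_large_conj[OF Suc.prems(2)
              for_all_large_shift[OF Suc.prems(2), of "axis j 1"]]])
           (simp flip: numerical_poly_difference[OF Suc.prems(1)])
      then show "for_all_large (\<lambda>n. numerical_poly (lower_coeffs j c) n = 0)"
        by (rule for_all_large_unshift)
      fix h assume "lower_coeffs j c h \<noteq> 0"
      then have "(\<Sum>i\<in>UNIV. (h + axis j 1) $ i) < Suc B"
        using Suc.prems(3)[of "h + axis j 1"] unfolding lower_coeffs_def by blast
      then show "(\<Sum>i\<in>UNIV. h $ i) < B" by (simp add: sum.distrib axis_def)
    qed
    have c0: "c h = 0" if "h \<noteq> 0" for h
      using nonzero_component[OF that] low by (metis lower_coeffs_def)
    obtain n where "numerical_poly c n = 0" using for_all_large_ex[OF Suc.prems(2)] by auto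
    then have "c 0 = 0" using numerical_poly_constant[of c n] c0 by simp
    then show ?case using c0 by (cases "k = 0") simp_all
  qed
  let ?B = "Suc (\<Sum>k\<in>{k. c k \<noteq> 0}. \<Sum>i\<in>UNIV. k $ i)"
  have "(\<Sum>i\<in>UNIV. k $ i) < ?B" if "c k \<noteq> 0" for k
    using that assms(1) unfolding finite_coeffs_def less_Suc_eq_le
    by (intro member_le_sum[of k "{k. c k \<noteq> 0}" "\<lambda>k. \<Sum>i\<in>UNIV. k $ i"]) auto
  then show ?thesis using *[OF assms] by blast
qed

lemma numerical_poly_unique:
  assumes "finite_coeffs c" "finite_coeffs c'"
    "for_all_large (\<lambda>n. numerical_poly c n = numerical_poly c' n)"
  shows "c = c'"
proof
  fix k
  have "for_all_large (\<lambda>n. numerical_poly (\<lambda>k. c k - c' k) n = 0)"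
    by (rule for_all_large_mono[OF assms(3)]) (simp add: numerical_poly_diff[OF assms(1,2)])
  then show "c k = c' k"
    using numerical_poly_eventually_zero[OF finite_coeffs_diff[OF assms(1,2)], of k] by auto
qed

definition eventually_poly :: "(nat ^ 'd \<Rightarrow> int) \<Rightarrow> (nat ^ 'd \<Rightarrow> int) \<Rightarrow> bool" where
  "eventually_poly H c \<longleftrightarrow> finite_coeffs c \<and> for_all_large (\<lambda>n. H n = numerical_poly c n)"

lemma eventually_poly_unique:
  assumes "eventually_poly H c" "eventually_poly H c'" shows "c = c'"
proof (rule numerical_poly_unique)
  have "for_all_large (\<lambda>n. H n = numerical_poly c n)" "for_all_large (\<lambda>n. H n = numerical_poly c' n)"
    using assms by (auto simp: eventually_poly_def)
  from for_all_large_mono[OF for_all_large_conj[OF this]]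
  show "for_all_large (\<lambda>n. numerical_poly c n = numerical_poly c' n)" by auto
qed (use assms in \<open>auto simp: eventually_poly_def\<close>)

text \<open>Every large point is reached by unit steps from the smallest large one.\<close>

lemma eventually_constantI:
  fixes F :: "nat ^ 'd \<Rightarrow> int"
  assumes "for_all_large (\<lambda>n. \<forall>j. F (n + axis j 1) = F n)"
  shows "\<exists>a. for_all_large (\<lambda>n. F n = a)"
proof -
  obtain b where b: "\<And>n j. (\<forall>i. b \<le> n $ i) \<Longrightarrow> F (n + axis j 1) = F n"
    using assms unfolding for_all_large_def by blast
  define n0 :: "nat ^ 'd" where "n0 = (\<chi> i. b)"
  have "F (n0 + m) = F n0" for m
  proof (induction "\<Sum>i\<in>UNIV. m $ i" arbitrary: m)
    case 0 then have "m = 0" by (auto simp: vec_eq_iff) then show ?case by simp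
  next
    case (Suc t)
    then have "m \<noteq> 0" by auto
    then obtain j g where m: "m = g + axis j 1" by (rule nonzero_component)
    have "t = (\<Sum>i\<in>UNIV. g $ i)" using Suc.hyps(2) by (simp add: m sum.distrib axis_def)
    then have "F (n0 + g) = F n0" by (rule Suc.hyps(1))
    moreover have "F (n0 + g + axis j 1) = F (n0 + g)" by (rule b) (simp add: n0_def)
    ultimately show ?case by (simp add: m add.assoc)
  qed
  moreover have "n = n0 + (\<chi> i. n $ i - b)" if "\<forall>i. b \<le> n $ i" for n
    using that by (simp add: vec_eq_iff n0_def)
  ultimately show ?thesis unfolding for_all_large_def by metis
qed

text \<open>Discrete integration.  The prescribed differences \<open>c j\<close> are compatible,
  \<open>\<nabla>\<^sub>i (c j) = \<nabla>\<^sub>j (c i)\<close>, because the operators \<open>\<nabla>\<^sub>i\<close> and \<open>\<nabla>\<^sub>j\<close> commute; on coefficients \<open>\<nabla>\<^sub>j\<close> is an index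
  shift, so compatible families are visibly the differences of a single family.\<close>

lemma eventually_poly_integrate:
  fixes H :: "nat ^ 'd \<Rightarrow> int"
  assumes fin: "\<And>j. finite_coeffs (c j)"
    and diff: "\<And>j. for_all_large (\<lambda>n. H (n + axis j 1) - H n = numerical_poly (c j) (n + axis j 1))"
  shows "\<exists>p. eventually_poly H p"
proof -
  have compat: "lower_coeffs i (c j) = lower_coeffs j (c i)" for i j
  proof (rule numerical_poly_unique)
    let ?ei = "axis i 1 :: nat ^ 'd" and ?ej = "axis j 1 :: nat ^ 'd"
    have "for_all_large (\<lambda>n. numerical_poly (lower_coeffs i (c j)) (n + ?ei + ?ej)
        = numerical_poly (lower_coeffs j (c i)) (n + ?ei + ?ej))"
    proof (rule for_all_large_mono[OF for_all_large_conj[OF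
            for_all_large_conj[OF diff[of j] for_all_large_shift[OF diff[of j], of ?ei]]
            for_all_large_conj[OF diff[of i] for_all_large_shift[OF diff[of i], of ?ej]]]])
      fix n
      assume "(H (n + ?ej) - H n = numerical_poly (c j) (n + ?ej) \<and>
          H (n + ?ei + ?ej) - H (n + ?ei) = numerical_poly (c j) (n + ?ei + ?ej)) \<and>
         H (n + ?ei) - H n = numerical_poly (c i) (n + ?ei) \<and>
          H (n + ?ej + ?ei) - H (n + ?ej) = numerical_poly (c i) (n + ?ej + ?ei)"
      moreover have "n + ?ei + ?ej = n + ?ej + ?ei" by (simp add: ac_simps)
      ultimately show "numerical_poly (lower_coeffs i (c j)) (n + ?ei + ?ej)
        = numerical_poly (lower_coeffs j (c i)) (n + ?ei + ?ej)"
        using numerical_poly_difference[OF fin, of j "n + ?ej" i]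
          numerical_poly_difference[OF fin, of i "n + ?ei" j] by simp
    qed
    then have "for_all_large (\<lambda>n. numerical_poly (lower_coeffs i (c j)) (n + ?ej)
        = numerical_poly (lower_coeffs j (c i)) (n + ?ej))"
      by (rule for_all_large_unshift)
    then show "for_all_large (\<lambda>n. numerical_poly (lower_coeffs i (c j)) n =
        numerical_poly (lower_coeffs j (c i)) n)"
      by (rule for_all_large_unshift)
  qed (auto intro: finite_lower_coeffs fin)
  \<comment> \<open>The choice of \<open>(j, g)\<close> does not matter, and the constant term is determined only later.\<close>
  define p where "p h = (if h = 0 then 0 else
      (let (j, g) = SOME (j, g). h = g + axis j 1 in c j g))" for h
  have p: "p (g + axis j 1) = c j g" for g j
  proof -
    define q where "q = (SOME (i, f). g + axis j 1 = f + axis i (1 :: nat))"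
    obtain i f where q: "q = (i, f)" by fastforce
    have "case q of (i, f) \<Rightarrow> g + axis j 1 = f + axis i 1"
      unfolding q_def by (rule someI[of _ "(j, g)"]) simp
    then have eq: "g + axis j 1 = f + axis i 1" by (simp add: q)
    have "c i f = c j g"
    proof (cases "i = j")
      case False
      have "(g + axis j 1) $ i = (f + axis i 1) $ i" using eq by simp
      then have "g $ i \<noteq> 0" using False by (auto simp: axis_def)
      then obtain l where l: "g = l + axis i 1" by (rule pos_component_split)
      then have "f + axis i 1 = (l + axis j 1) + axis i 1" using eq by (simp add: ac_simps)
      then have "f = l + axis j 1" by (rule add_right_imp_eq)
      then show ?thesis using fun_cong[OF compat[of i j], of l] by (simp add: l lower_coeffs_def)
    qed (use eq in simp)
    moreover have "g + axis j 1 \<noteq> 0" by (auto simp: vec_eq_iff axis_def intro!: exI[of _ j])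
    ultimately show ?thesis using q by (simp add: p_def q_def)
  qed
  have "{h. p h \<noteq> 0} \<subseteq> (\<Union>j. (\<lambda>g. g + axis j 1) ` {g. c j g \<noteq> 0})"
  proof safe
    fix h assume h: "p h \<noteq> 0"
    then have "h \<noteq> 0" by (auto simp: p_def)
    then obtain j g where "h = g + axis j 1" by (rule nonzero_component)
    then show "h \<in> (\<Union>j. (\<lambda>g. g + axis j 1) ` {g. c j g \<noteq> 0})" using h p by auto
  qed
  then have finp: "finite_coeffs p"
    using fin unfolding finite_coeffs_def by (elim finite_subset) auto
  have "lower_coeffs j p = c j" for j by (simp add: lower_coeffs_def p)
  then have "for_all_large (\<lambda>n. H (n + axis j 1) - numerical_poly p (n + axis j 1) = H n - numerical_poly p n)"
    for j
    by (intro for_all_large_mono[OF diff[of j]])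
       (use numerical_poly_difference[OF finp, of _ j] in \<open>simp add: algebra_simps\<close>)
  then obtain a where a: "for_all_large (\<lambda>n. H n - numerical_poly p n = a)"
    using eventually_constantI[OF for_all_large_all, of "\<lambda>n. H n - numerical_poly p n"] by blast
  let ?a = "\<lambda>h :: nat ^ 'd. if h = 0 then a else 0"
  have "{h. ?a h \<noteq> 0} \<subseteq> {0}" by auto
  then have fina: "finite_coeffs ?a" unfolding finite_coeffs_def by (rule finite_subset) simp
  have "eventually_poly H (\<lambda>k. p k + ?a k)"
    unfolding eventually_poly_def
  proof
    show "finite_coeffs (\<lambda>k. p k + ?a k)" by (rule finite_coeffs_add[OF finp fina])
    show "for_all_large (\<lambda>n. H n = numerical_poly (\<lambda>k. p k + ?a k) n)"
      by (rule for_all_large_mono[OF a])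
         (simp add: numerical_poly_add[OF finp fina] numerical_poly_constant[of ?a])
  qed
  then show ?thesis by blast
qed

section \<open>Lengths of intervals of subgroups\<close>

text \<open>The predicate \<open>P\<close> singles out the subgroups under consideration.  It is kept abstract because submodules of
  records that are not yet known to be modules occur below.\<close>

inductive strict_chain :: "('x set \<Rightarrow> bool) \<Rightarrow> 'x set \<Rightarrow> 'x set \<Rightarrow> nat \<Rightarrow> bool"
  for P :: "'x set \<Rightarrow> bool" and U where
  start: "P U \<Longrightarrow> strict_chain P U U 0"
| step: "strict_chain P U V n \<Longrightarrow> V \<subset> W \<Longrightarrow> P W \<Longrightarrow> strict_chain P U W (Suc n)"

definition chain_length :: "('x set \<Rightarrow> bool) \<Rightarrow> 'x set \<Rightarrow> 'x set \<Rightarrow> enat" where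
  "chain_length P U V = Sup {enat n | n. strict_chain P U V n}"

lemma strict_chainD:
  assumes "strict_chain P U V n"
  shows "U \<subseteq> V" "P U" "P V" "n = 0 \<Longrightarrow> U = V"
  using assms by (induction; auto)+

lemma strict_chain_trans:
  assumes "strict_chain P V W m" "strict_chain P U V n"
  shows "strict_chain P U W (n + m)"
  using assms by (induction rule: strict_chain.induct) (auto intro: strict_chain.step)

lemma strict_chain_two:
  assumes "P U" "P V" "U \<subseteq> V"
  shows "\<exists>n. strict_chain P U V n \<and> (U \<noteq> V \<longrightarrow> n = 1)"
proof (cases "U = V")
  case True then show ?thesis using strict_chain.start[of P U] assms(1) by blast
next
  case False
  then have "strict_chain P U V (Suc 0)"
    using assms by (intro strict_chain.step[OF strict_chain.start]) auto
  then show ?thesis by (auto simp: One_nat_def)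
qed

lemma strict_chain_iff_sequence:
  "strict_chain P U V n \<longleftrightarrow> (\<exists>C. C 0 = U \<and> C n = V \<and> (\<forall>i\<le>n. P (C i)) \<and> (\<forall>i<n. C i \<subset> C (Suc i)))"
proof
  show "\<exists>C. C 0 = U \<and> C n = V \<and> (\<forall>i\<le>n. P (C i)) \<and> (\<forall>i<n. C i \<subset> C (Suc i))"
    if "strict_chain P U V n"
    using that
  proof induction
    case start then show ?case by (intro exI[of _ "\<lambda>_. U"]) auto
  next
    case (step V n W)
    then obtain C where C: "C 0 = U" "C n = V" "\<forall>i\<le>n. P (C i)" "\<forall>i<n. C i \<subset> C (Suc i)" by blast
    show ?case
    proof (intro exI[of _ "C(Suc n := W)"] conjI allI impI)
      show "(C(Suc n := W)) i \<subset> (C(Suc n := W)) (Suc i)" if "i < Suc n" for i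
        using that C step.hyps by (cases "i = n") auto
      show "P ((C(Suc n := W)) i)" if "i \<le> Suc n" for i
        using that C step.hyps by (cases "i = Suc n") auto
    qed (use C in auto)
  qed
  show "strict_chain P U V n"
    if ex: "\<exists>C. C 0 = U \<and> C n = V \<and> (\<forall>i\<le>n. P (C i)) \<and> (\<forall>i<n. C i \<subset> C (Suc i))"
  proof -
    obtain C where C: "C 0 = U" "C n = V" "\<forall>i\<le>n. P (C i)" "\<forall>i<n. C i \<subset> C (Suc i)"
      using ex by blast
    have "strict_chain P U (C i) i" if "i \<le> n" for i
      using that
    proof (induction i)
      case 0 then show ?case using C strict_chain.start by (metis le0)
    next
      case (Suc i) then show ?case using C by (intro strict_chain.step[of P U "C i"]) auto
    qed
    then show ?thesis using C by blast
  qed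
qed

lemma strict_chain_length_le: "strict_chain P U V n \<Longrightarrow> enat n \<le> chain_length P U V"
  unfolding chain_length_def by (rule Sup_upper) blast

lemma chain_length_le:
  "(\<And>n. strict_chain P U V n \<Longrightarrow> enat n \<le> b) \<Longrightarrow> chain_length P U V \<le> b"
  unfolding chain_length_def by (rule Sup_least) blast

lemma chain_length_eq_sup_sequences:
  "chain_length P U V = Sup {enat n | n. \<exists>C :: nat \<Rightarrow> 'x set. C 0 = U \<and> C n = V \<and>
     (\<forall>i\<le>n. P (C i)) \<and> (\<forall>i<n. C i \<subset> C (Suc i))}"
  unfolding chain_length_def strict_chain_iff_sequence ..

text \<open>A strictly monotone map between intervals carries chains to chains; a pair of such maps in opposite directions
  gives equality of lengths, without being mutually inverse.\<close>

lemma chain_length_transport: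
  assumes P: "\<And>X. P X \<Longrightarrow> U \<subseteq> X \<Longrightarrow> X \<subseteq> V \<Longrightarrow> P' (F X)"
    and mono: "\<And>X Y. P X \<Longrightarrow> P Y \<Longrightarrow> U \<subseteq> X \<Longrightarrow> X \<subset> Y \<Longrightarrow> Y \<subseteq> V \<Longrightarrow> F X \<subset> F Y"
    and ends: "F U = U'" "F V = V'"
  shows "chain_length P U V \<le> chain_length P' U' V'"
proof (rule chain_length_le)
  fix n assume *: "strict_chain P U V n"
  have "strict_chain P' (F U) (F W) n" if "strict_chain P U W n" "W \<subseteq> V" for W n
    using that
  proof (induction rule: strict_chain.induct)
    case start
    then show ?case using P by (intro strict_chain.start) auto
  next
    case (step V0 n W)
    then have "U \<subseteq> V0" "P V0" using strict_chainD by blast+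
    with step show ?case using P[of W] mono[of V0 W]
      by (intro strict_chain.step[of P' "F U" "F V0"]) auto
  qed
  from this[OF * order_refl] show "enat n \<le> chain_length P' U' V'"
    unfolding ends by (rule strict_chain_length_le)
qed

lemma chain_length_antimono:
  assumes "P U'" "U' \<subseteq> U"
  shows "chain_length P U V \<le> chain_length P U' V"
proof (rule chain_length_le)
  fix n assume *: "strict_chain P U V n"
  then have "P U" by (rule strict_chainD)
  then obtain m where "strict_chain P U' U m" using strict_chain_two[of P U' U] assms by blast
  from strict_chain_length_le[OF strict_chain_trans[OF * this]]
  show "enat n \<le> chain_length P U' V" by (meson enat_ord_simps(1) le_add2 order_trans)
qed

lemma chain_length_self: "chain_length P U U = 0"
proof -
  have "n = 0" if "strict_chain P U U n" for n
    using that by cases (use strict_chainD in blast)+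
  then have "chain_length P U U \<le> 0" by (intro chain_length_le) (simp add: zero_enat_def)
  then show ?thesis by simp
qed

lemma chain_length_attained:
  assumes "P U" "P V" "U \<subseteq> V" "chain_length P U V = enat l"
  shows "strict_chain P U V l"
proof -
  let ?Q = "strict_chain P U V"
  obtain n where n: "?Q n" using strict_chain_two[OF assms(1-3)] by blast
  have b: "m \<le> l" if "?Q m" for m using strict_chain_length_le[OF that] assms(4) by simp
  define g where "g = Greatest ?Q"
  have g: "?Q g" unfolding g_def using n b by (rule GreatestI_nat)
  have "m \<le> g" if "?Q m" for m unfolding g_def using that b by (rule Greatest_le_nat)
  then have "chain_length P U V \<le> enat g" by (intro chain_length_le) simp
  then have "l = g" using strict_chain_length_le[OF g] assms(4) by simp
  then show ?thesis using g by simp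
qed

lemma chain_length_mono:
  assumes "P V" "P W" "V \<subseteq> W"
  shows "chain_length P U V \<le> chain_length P U W"
proof (rule chain_length_le)
  fix n assume *: "strict_chain P U V n"
  obtain m where "strict_chain P V W m" using strict_chain_two[OF assms] by blast
  from strict_chain_length_le[OF strict_chain_trans[OF this *]]
  show "enat n \<le> chain_length P U W" by (meson enat_ord_simps(1) le_add1 order_trans)
qed

lemma chain_length_add_le:
  assumes "P U" "P V" "P W" "U \<subseteq> V" "V \<subseteq> W"
  shows "chain_length P U V + chain_length P V W \<le> chain_length P U W"
proof (cases "chain_length P U W")
  case (enat b)
  have "chain_length P U V \<le> enat b" "chain_length P V W \<le> enat b"
    using chain_length_mono[of P V W U] chain_length_antimono[of P U V W] assms enat by auto
  then obtain n m where nm: "chain_length P U V = enat n" "chain_length P V W = enat m"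
    using enat_ile by metis
  then have "strict_chain P U W (n + m)"
    using assms by (intro strict_chain_trans[of P V W m U n] chain_length_attained) auto
  then show ?thesis using strict_chain_length_le nm by fastforce
qed simp

section \<open>Subgroups stable under scalars\<close>

text \<open>Submodules over \<open>S\<close>, over \<open>A\<close>, and over the subalgebras generated by some of the generators of
  \<open>S\<close> are all treated as additive subgroups of one and the same \<open>S\<close>-module that are stable under a set
  \<open>\<Omega>\<close> of scalars.\<close>

definition stable_subgroup :: "('a, 'm, 'z) module_scheme \<Rightarrow> 'a set \<Rightarrow> 'm set \<Rightarrow> bool" where
  "stable_subgroup M \<Omega> U \<longleftrightarrow> U \<subseteq> carrier M \<and> \<zero>\<^bsub>M\<^esub> \<in> U \<and> (\<forall>x\<in>U. \<forall>y\<in>U. x \<oplus>\<^bsub>M\<^esub> y \<in> U) \<and>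
     (\<forall>x\<in>U. \<ominus>\<^bsub>M\<^esub> x \<in> U) \<and> (\<forall>a\<in>\<Omega>. \<forall>x\<in>U. a \<odot>\<^bsub>M\<^esub> x \<in> U)"

lemma stable_subgroupD:
  assumes "stable_subgroup M \<Omega> U"
  shows "x \<in> U \<Longrightarrow> x \<in> carrier M" "\<zero>\<^bsub>M\<^esub> \<in> U" "x \<in> U \<Longrightarrow> y \<in> U \<Longrightarrow> x \<oplus>\<^bsub>M\<^esub> y \<in> U"
    "x \<in> U \<Longrightarrow> \<ominus>\<^bsub>M\<^esub> x \<in> U" "a \<in> \<Omega> \<Longrightarrow> x \<in> U \<Longrightarrow> a \<odot>\<^bsub>M\<^esub> x \<in> U"
  using assms unfolding stable_subgroup_def by blast+

lemma stable_subgroup_antimono: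
  "stable_subgroup M \<Omega>' U \<Longrightarrow> \<Omega> \<subseteq> \<Omega>' \<Longrightarrow> stable_subgroup M \<Omega> U"
  unfolding stable_subgroup_def by blast

lemma stable_subgroup_Int:
  "stable_subgroup M \<Omega> U \<Longrightarrow> stable_subgroup M \<Omega> V \<Longrightarrow> stable_subgroup M \<Omega> (U \<inter> V)"
  unfolding stable_subgroup_def by blast

lemma stable_subgroup_insert:
  "stable_subgroup M (insert y \<Omega>) U \<longleftrightarrow> stable_subgroup M \<Omega> U \<and> (\<forall>x\<in>U. y \<odot>\<^bsub>M\<^esub> x \<in> U)"
  unfolding stable_subgroup_def by blast

lemma mem_set_add: "x \<in> U <+>\<^bsub>M\<^esub> V \<longleftrightarrow> (\<exists>u\<in>U. \<exists>v\<in>V. x = u \<oplus>\<^bsub>M\<^esub> v)"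
  by (auto simp: set_add_def')

lemma set_addI: "u \<in> U \<Longrightarrow> v \<in> V \<Longrightarrow> u \<oplus>\<^bsub>M\<^esub> v \<in> U <+>\<^bsub>M\<^esub> V"
  by (auto simp: set_add_def')

lemma set_addE:
  assumes "x \<in> U <+>\<^bsub>M\<^esub> V" obtains u v where "u \<in> U" "v \<in> V" "x = u \<oplus>\<^bsub>M\<^esub> v"
  using assms by (auto simp: set_add_def')

lemma set_add_mono: "U \<subseteq> U' \<Longrightarrow> V \<subseteq> V' \<Longrightarrow> U <+>\<^bsub>M\<^esub> V \<subseteq> U' <+>\<^bsub>M\<^esub> V'"
  unfolding set_add_def' by blast

context module
begin

lemma submodule_iff_stable: "submodule N R M \<longleftrightarrow> stable_subgroup M (carrier R) N"
proof
  show "stable_subgroup M (carrier R) N" if "submodule N R M"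
    using submoduleE[OF that] submodule.axioms(1)[OF that]
    unfolding stable_subgroup_def by (auto dest: subgroup.one_closed)
  show "submodule N R M" if "stable_subgroup M (carrier R) N"
    using that unfolding stable_subgroup_def by (intro submoduleI) auto
qed

lemma stable_cancel:
  assumes "stable_subgroup M \<Omega> U" "x \<oplus>\<^bsub>M\<^esub> y \<in> U" "y \<in> carrier M" "x \<in> U"
  shows "y \<in> U"
proof -
  have x: "x \<in> carrier M" by (rule stable_subgroupD(1)[OF assms(1,4)])
  have "(\<ominus>\<^bsub>M\<^esub> x) \<oplus>\<^bsub>M\<^esub> (x \<oplus>\<^bsub>M\<^esub> y) \<in> U"
    by (rule stable_subgroupD(3)[OF assms(1) stable_subgroupD(4)[OF assms(1,4)] assms(2)])
  then show ?thesis using x assms(3) by (simp add: M.r_neg1)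
qed

lemma stable_cancel_right:
  assumes "stable_subgroup M \<Omega> U" "x \<oplus>\<^bsub>M\<^esub> y \<in> U" "x \<in> carrier M" "y \<in> U"
  shows "x \<in> U"
  using stable_cancel[OF assms(1), of y x] assms stable_subgroupD(1)[OF assms(1)]
  by (simp add: M.a_comm)

lemma stable_carrier: "\<Omega> \<subseteq> carrier R \<Longrightarrow> stable_subgroup M \<Omega> (carrier M)"
  unfolding stable_subgroup_def by auto

lemma stable_zero: "\<Omega> \<subseteq> carrier R \<Longrightarrow> stable_subgroup M \<Omega> {\<zero>\<^bsub>M\<^esub>}"
  unfolding stable_subgroup_def by (auto simp: smult_r_null)

lemma stable_set_add:
  assumes "\<Omega> \<subseteq> carrier R" "stable_subgroup M \<Omega> U" "stable_subgroup M \<Omega> V"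
  shows "stable_subgroup M \<Omega> (U <+>\<^bsub>M\<^esub> V)"
proof -
  note U = stable_subgroupD[OF assms(2)] and V = stable_subgroupD[OF assms(3)]
  show ?thesis
    unfolding stable_subgroup_def
  proof (intro conjI ballI subsetI)
    show "x \<in> carrier M" if "x \<in> U <+>\<^bsub>M\<^esub> V" for x
      using that U(1) V(1) by (auto simp: mem_set_add)
    show "\<zero>\<^bsub>M\<^esub> \<in> U <+>\<^bsub>M\<^esub> V" using U(2) V(2) by (force simp: mem_set_add)
    show "\<ominus>\<^bsub>M\<^esub> x \<in> U <+>\<^bsub>M\<^esub> V" if "x \<in> U <+>\<^bsub>M\<^esub> V" for x
      using that U(1,4) V(1,4) by (fastforce simp: mem_set_add M.minus_add)
    show "a \<odot>\<^bsub>M\<^esub> x \<in> U <+>\<^bsub>M\<^esub> V" if "a \<in> \<Omega>" "x \<in> U <+>\<^bsub>M\<^esub> V" for a x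
      using that U(1,5) V(1,5) assms(1) by (fastforce simp: mem_set_add smult_r_distr)
    fix x y assume "x \<in> U <+>\<^bsub>M\<^esub> V" "y \<in> U <+>\<^bsub>M\<^esub> V"
    then obtain u v u' v' where uv: "u \<in> U" "v \<in> V" "u' \<in> U" "v' \<in> V" "x = u \<oplus>\<^bsub>M\<^esub> v" "y = u' \<oplus>\<^bsub>M\<^esub> v'"
      by (auto simp: mem_set_add)
    then have "x \<oplus>\<^bsub>M\<^esub> y = (u \<oplus>\<^bsub>M\<^esub> u') \<oplus>\<^bsub>M\<^esub> (v \<oplus>\<^bsub>M\<^esub> v')"
      using U(1) V(1) by (simp add: M.a_ac)
    then show "x \<oplus>\<^bsub>M\<^esub> y \<in> U <+>\<^bsub>M\<^esub> V" using uv U(3) V(3) by (simp add: set_addI)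
  qed
qed

lemma set_add_upper:
  assumes "stable_subgroup M \<Omega> U" "stable_subgroup M \<Omega>' V"
  shows "U \<subseteq> U <+>\<^bsub>M\<^esub> V" "V \<subseteq> U <+>\<^bsub>M\<^esub> V"
proof -
  note U = stable_subgroupD[OF assms(1)] and V = stable_subgroupD[OF assms(2)]
  have "x = x \<oplus>\<^bsub>M\<^esub> \<zero>\<^bsub>M\<^esub>" if "x \<in> U" for x using U(1) that by simp
  then show "U \<subseteq> U <+>\<^bsub>M\<^esub> V" using set_addI[OF _ V(2), of _ U M] by (metis subsetI)
  have "x = \<zero>\<^bsub>M\<^esub> \<oplus>\<^bsub>M\<^esub> x" if "x \<in> V" for x using V(1) that by simp
  then show "V \<subseteq> U <+>\<^bsub>M\<^esub> V" using set_addI[OF U(2), of _ V M] by (metis subsetI)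
qed

lemma set_add_least:
  assumes "stable_subgroup M \<Omega> W" "U \<subseteq> W" "V \<subseteq> W" shows "U <+>\<^bsub>M\<^esub> V \<subseteq> W"
  using assms(2,3) stable_subgroupD(3)[OF assms(1)] by (blast elim: set_addE)

lemma stable_scaled:
  assumes "\<Omega> \<subseteq> carrier R" "stable_subgroup M \<Omega> U" "z \<in> carrier R"
  shows "stable_subgroup M \<Omega> ((\<lambda>u. z \<odot>\<^bsub>M\<^esub> u) ` U)"
proof -
  note U = stable_subgroupD[OF assms(2)]
  show ?thesis
    unfolding stable_subgroup_def
  proof (intro conjI ballI subsetI; (elim imageE)?)
    show "x \<in> carrier M" if "x = z \<odot>\<^bsub>M\<^esub> u" "u \<in> U" for x u using that U(1) assms(3) by simp
    show "\<zero>\<^bsub>M\<^esub> \<in> (\<lambda>u. z \<odot>\<^bsub>M\<^esub> u) ` U" using assms(3) U(2) by (intro image_eqI[of _ _ "\<zero>\<^bsub>M\<^esub>"]) simp_all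
    show "x \<oplus>\<^bsub>M\<^esub> y \<in> (\<lambda>u. z \<odot>\<^bsub>M\<^esub> u) ` U" if "x = z \<odot>\<^bsub>M\<^esub> u" "u \<in> U" "y = z \<odot>\<^bsub>M\<^esub> v" "v \<in> U" for x y u v
      using that U(1,3) assms(3) by (intro image_eqI[of _ _ "u \<oplus>\<^bsub>M\<^esub> v"]) (simp_all add: smult_r_distr)
    show "\<ominus>\<^bsub>M\<^esub> x \<in> (\<lambda>u. z \<odot>\<^bsub>M\<^esub> u) ` U" if "x = z \<odot>\<^bsub>M\<^esub> u" "u \<in> U" for x u
      using that U(1,4) assms(3) by (intro image_eqI[of _ _ "\<ominus>\<^bsub>M\<^esub> u"]) (simp_all add: smult_r_minus)
    show "a \<odot>\<^bsub>M\<^esub> x \<in> (\<lambda>u. z \<odot>\<^bsub>M\<^esub> u) ` U" if "x = z \<odot>\<^bsub>M\<^esub> u" "u \<in> U" "a \<in> \<Omega>" for a x u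
      using that U(1,5) assms(1,3)
      by (intro image_eqI[of _ _ "a \<odot>\<^bsub>M\<^esub> u"]) (simp_all flip: smult_assoc1 add: R.m_comm subsetD)
  qed
qed

lemma stable_preimage:
  assumes "\<Omega> \<subseteq> carrier R" "stable_subgroup M \<Omega> V" "stable_subgroup M \<Omega> L" "z \<in> carrier R"
  shows "stable_subgroup M \<Omega> {v \<in> V. z \<odot>\<^bsub>M\<^esub> v \<in> L}"
proof -
  note V = stable_subgroupD[OF assms(2)] and L = stable_subgroupD[OF assms(3)]
  have "z \<odot>\<^bsub>M\<^esub> (a \<odot>\<^bsub>M\<^esub> x) = a \<odot>\<^bsub>M\<^esub> (z \<odot>\<^bsub>M\<^esub> x)" if "a \<in> \<Omega>" "x \<in> V" for a x
    using that assms V(1) by (simp flip: smult_assoc1 add: R.m_comm subsetD)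
  then show ?thesis
    using V L assms(4) unfolding stable_subgroup_def
    by (auto simp: smult_r_distr smult_r_minus)
qed

text \<open>One half of additivity (the other is concatenation of chains): intersecting with \<open>V\<close> and adding \<open>V\<close> turns a chain into
  two chains, and by the modular law no step becomes stationary in both.\<close>

lemma modular_step:
  assumes "stable_subgroup M \<Omega> W" "stable_subgroup M \<Omega> W'" "stable_subgroup M \<Omega> V" "W \<subseteq> W'"
    and "W \<inter> V = W' \<inter> V" "W <+>\<^bsub>M\<^esub> V = W' <+>\<^bsub>M\<^esub> V"
  shows "W = W'"
proof
  show "W' \<subseteq> W"
  proof
    fix w' assume w': "w' \<in> W'"
    then have "w' \<in> W <+>\<^bsub>M\<^esub> V"
      using set_add_upper(1)[OF assms(2,3)] assms(6) by blast
    then obtain w v where wv: "w \<in> W" "v \<in> V" "w' = w \<oplus>\<^bsub>M\<^esub> v" by (auto simp: mem_set_add)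
    then have "v \<in> W'"
      using stable_cancel[OF assms(2), of w v] w' assms(4) stable_subgroupD(1)[OF assms(3)] by blast
    then have "v \<in> W" using wv(2) assms(5) by blast
    then show "w' \<in> W" using wv stable_subgroupD(3)[OF assms(1)] by simp
  qed
qed (fact assms(4))

lemma strict_chain_split:
  assumes \<Omega>: "\<Omega> \<subseteq> carrier R" and V: "stable_subgroup M \<Omega> V"
    and "strict_chain (stable_subgroup M \<Omega>) U W n"
  shows "\<exists>a b. strict_chain (stable_subgroup M \<Omega>) (U \<inter> V) (W \<inter> V) a \<and>
     strict_chain (stable_subgroup M \<Omega>) (U <+>\<^bsub>M\<^esub> V) (W <+>\<^bsub>M\<^esub> V) b \<and> n \<le> a + b"
  using assms(3)
proof induction
  case start
  then show ?case using stable_subgroup_Int[OF start V] stable_set_add[OF \<Omega> start V]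
    by (intro exI[of _ 0] conjI strict_chain.start) auto
next
  case (step W n W')
  let ?P = "stable_subgroup M \<Omega>"
  have W: "?P W" using step.hyps(1) by (rule strict_chainD)
  obtain a b where ab: "strict_chain ?P (U \<inter> V) (W \<inter> V) a"
    "strict_chain ?P (U <+>\<^bsub>M\<^esub> V) (W <+>\<^bsub>M\<^esub> V) b" "n \<le> a + b" using step.IH by blast
  have le: "W \<inter> V \<subseteq> W' \<inter> V" "W <+>\<^bsub>M\<^esub> V \<subseteq> W' <+>\<^bsub>M\<^esub> V"
    using step.hyps(2) set_add_mono[of W W' V V M] by auto
  obtain a' where a': "strict_chain ?P (W \<inter> V) (W' \<inter> V) a'" "W \<inter> V \<noteq> W' \<inter> V \<longrightarrow> a' = 1"
    using strict_chain_two[of ?P, OF stable_subgroup_Int[OF W V] stable_subgroup_Int[OF step.hyps(3) V] le(1)]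
    by blast
  obtain b' where b': "strict_chain ?P (W <+>\<^bsub>M\<^esub> V) (W' <+>\<^bsub>M\<^esub> V) b'"
    "W <+>\<^bsub>M\<^esub> V \<noteq> W' <+>\<^bsub>M\<^esub> V \<longrightarrow> b' = 1"
    using strict_chain_two[of ?P, OF stable_set_add[OF \<Omega> W V] stable_set_add[OF \<Omega> step.hyps(3) V] le(2)]
    by blast
  have "a' = 1 \<or> b' = 1"
    using modular_step[OF W step.hyps(3) V] step.hyps(2) a'(2) b'(2) by blast
  then have "Suc n \<le> (a + a') + (b + b')" using ab(3) by auto
  then show ?case
    using strict_chain_trans[OF a'(1) ab(1)] strict_chain_trans[OF b'(1) ab(2)] by blast
qed

lemma chain_length_add:
  assumes \<Omega>: "\<Omega> \<subseteq> carrier R" and st: "stable_subgroup M \<Omega> U" "stable_subgroup M \<Omega> V"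
    "stable_subgroup M \<Omega> W" and le: "U \<subseteq> V" "V \<subseteq> W"
  shows "chain_length (stable_subgroup M \<Omega>) U W =
     chain_length (stable_subgroup M \<Omega>) U V + chain_length (stable_subgroup M \<Omega>) V W"
proof (rule antisym)
  let ?P = "stable_subgroup M \<Omega>"
  show "chain_length ?P U W \<le> chain_length ?P U V + chain_length ?P V W"
  proof (rule chain_length_le)
    fix n assume "strict_chain ?P U W n"
    from strict_chain_split[OF \<Omega> st(2) this]
    obtain a b where ab: "strict_chain ?P (U \<inter> V) (W \<inter> V) a"
      "strict_chain ?P (U <+>\<^bsub>M\<^esub> V) (W <+>\<^bsub>M\<^esub> V) b" "n \<le> a + b" by blast
    have "U \<inter> V = U" "W \<inter> V = V" using le by auto
    moreover have "U <+>\<^bsub>M\<^esub> V = V" "W <+>\<^bsub>M\<^esub> V = W"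
      using set_add_least[OF st(2) le(1)] set_add_least[OF st(3) _ le(2)]
        set_add_upper(2)[OF st(1,2)] set_add_upper(1)[OF st(3,2)] by blast+
    ultimately have "enat a \<le> chain_length ?P U V" "enat b \<le> chain_length ?P V W"
      using ab by (auto intro: strict_chain_length_le)
    then have "enat a + enat b \<le> chain_length ?P U V + chain_length ?P V W" by (rule add_mono)
    moreover have "enat n \<le> enat a + enat b" using ab(3) by simp
    ultimately show "enat n \<le> chain_length ?P U V + chain_length ?P V W" by (rule order_trans[rotated])
  qed
  show "chain_length ?P U V + chain_length ?P V W \<le> chain_length ?P U W"
    using st le by (rule chain_length_add_le)
qed

text \<open>The isomorphism \<open>V / (L : z) \<cong> (L + z V) / L\<close> given by multiplication with \<open>z\<close>; for \<open>z = 1\<close> it is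
  the second isomorphism theorem.\<close>

lemma chain_length_scaled:
  assumes \<Omega>: "\<Omega> \<subseteq> carrier R" and L: "stable_subgroup M \<Omega> L" and V: "stable_subgroup M \<Omega> V"
    and z: "z \<in> carrier R"
  shows "chain_length (stable_subgroup M \<Omega>) {v \<in> V. z \<odot>\<^bsub>M\<^esub> v \<in> L} V =
     chain_length (stable_subgroup M \<Omega>) L (L <+>\<^bsub>M\<^esub> ((\<lambda>v. z \<odot>\<^bsub>M\<^esub> v) ` V))"
proof (rule antisym)
  let ?P = "stable_subgroup M \<Omega>" and ?K = "{v \<in> V. z \<odot>\<^bsub>M\<^esub> v \<in> L}"
  let ?F = "\<lambda>X. L <+>\<^bsub>M\<^esub> ((\<lambda>v. z \<odot>\<^bsub>M\<^esub> v) ` X)" and ?G = "\<lambda>Y. {v \<in> V. z \<odot>\<^bsub>M\<^esub> v \<in> Y}"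
  note LD = stable_subgroupD[OF L] and VD = stable_subgroupD[OF V]
  have P_F: "?P (?F X)" if "?P X" for X
    using that by (intro stable_set_add stable_scaled \<Omega> L z)
  have P_G: "?P (?G Y)" if "?P Y" for Y
    using that by (intro stable_preimage \<Omega> V z)
  have F_K: "?F ?K = L"
  proof
    show "?F ?K \<subseteq> L" by (rule set_add_least[OF L]) auto
    show "L \<subseteq> ?F ?K"
      using set_add_upper(1)[OF L stable_scaled[OF \<Omega> P_G[OF L] z]] .
  qed
  have K: "?P ?K" using L by (rule P_G)
  show "chain_length ?P ?K V \<le> chain_length ?P L (?F V)"
  proof (rule chain_length_transport[of ?P _ _ ?P ?F])
    fix X Y assume XY: "?P X" "?P Y" "?K \<subseteq> X" "X \<subset> Y" "Y \<subseteq> V"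
    have "X = Y" if eq: "?F Y \<subseteq> ?F X"
    proof
      show "Y \<subseteq> X"
      proof
        fix y assume y: "y \<in> Y"
        then have "z \<odot>\<^bsub>M\<^esub> y \<in> ?F X"
          using set_add_upper(2)[OF L stable_scaled[OF \<Omega> XY(2) z]] eq by blast
        then obtain l x where lx: "l \<in> L" "x \<in> X" "z \<odot>\<^bsub>M\<^esub> y = l \<oplus>\<^bsub>M\<^esub> z \<odot>\<^bsub>M\<^esub> x"
          by (auto simp: mem_set_add)
        have c: "x \<in> carrier M" "y \<in> carrier M" "l \<in> carrier M"
          using lx y stable_subgroupD(1)[OF XY(1)] stable_subgroupD(1)[OF XY(2)] LD(1) by auto
        have "z \<odot>\<^bsub>M\<^esub> (y \<oplus>\<^bsub>M\<^esub> \<ominus>\<^bsub>M\<^esub> x) = l"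
          using c z lx(3) by (simp add: smult_r_distr smult_r_minus M.a_assoc M.r_neg)
        moreover have "y \<oplus>\<^bsub>M\<^esub> \<ominus>\<^bsub>M\<^esub> x \<in> V"
          using VD(3)[of y] VD(4)[of x] y lx XY by blast
        ultimately have "y \<oplus>\<^bsub>M\<^esub> \<ominus>\<^bsub>M\<^esub> x \<in> X" using lx(1) XY(3) by auto
        then show "y \<in> X"
          using stable_cancel_right[OF XY(1), of y "\<ominus>\<^bsub>M\<^esub> x"] c stable_subgroupD(4)[OF XY(1) lx(2)] by simp
      qed
    qed (use XY in blast)
    moreover have "?F X \<subseteq> ?F Y" using XY(4) by (intro set_add_mono) auto
    ultimately show "?F X \<subset> ?F Y" using XY(4) by blast
  qed (use F_K P_F in auto)
  show "chain_length ?P L (?F V) \<le> chain_length ?P ?K V"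
  proof (rule chain_length_transport[of ?P _ _ ?P ?G])
    fix X Y assume XY: "?P X" "?P Y" "L \<subseteq> X" "X \<subset> Y" "Y \<subseteq> ?F V"
    obtain y where y: "y \<in> Y" "y \<notin> X" using XY(4) by blast
    then obtain l v where lv: "l \<in> L" "v \<in> V" "y = l \<oplus>\<^bsub>M\<^esub> z \<odot>\<^bsub>M\<^esub> v"
      using XY(5) by (auto elim!: set_addE)
    have "z \<odot>\<^bsub>M\<^esub> v \<in> Y"
      using stable_cancel[OF XY(2), of l "z \<odot>\<^bsub>M\<^esub> v"] lv y XY VD(1) z by blast
    moreover have "z \<odot>\<^bsub>M\<^esub> v \<notin> X" using stable_subgroupD(3)[OF XY(1), of l] lv y XY(3) by blast
    ultimately show "?G X \<subset> ?G Y" using XY(4) lv(2) by blast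
  next
    show "?G (?F V) = V"
      using set_add_upper(2)[OF L stable_scaled[OF \<Omega> V z]] by blast
  qed (use P_G in auto)
qed

lemma chain_length_set_add:
  assumes "\<Omega> \<subseteq> carrier R" "stable_subgroup M \<Omega> U" "stable_subgroup M \<Omega> V"
  shows "chain_length (stable_subgroup M \<Omega>) U (U <+>\<^bsub>M\<^esub> V) =
    chain_length (stable_subgroup M \<Omega>) (U \<inter> V) V"
proof -
  have "{v \<in> V. \<one> \<odot>\<^bsub>M\<^esub> v \<in> U} = U \<inter> V" "(\<lambda>v. \<one> \<odot>\<^bsub>M\<^esub> v) ` V = V"
    using stable_subgroupD(1)[OF assms(3)] by (auto simp: image_iff)
  then show ?thesis using chain_length_scaled[OF assms R.one_closed] by simp
qed

end

section \<open>Chain conditions\<close>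

definition noetherian_below :: "('x set \<Rightarrow> bool) \<Rightarrow> 'x set \<Rightarrow> bool" where
  "noetherian_below P U \<longleftrightarrow>
    (\<forall>C :: nat \<Rightarrow> 'x set. (\<forall>i. P (C i) \<and> C i \<subseteq> U \<and> C i \<subseteq> C (Suc i)) \<longrightarrow> (\<exists>N. \<forall>i\<ge>N. C i = C N))"

lemma noetherian_stabilizes:
  assumes "noetherian_below P U" "\<And>i. P (C i)" "\<And>i. C i \<subseteq> U" "\<And>i. C i \<subseteq> C (Suc i)"
  shows "\<exists>N. \<forall>i\<ge>N. C i = C N"
proof -
  have "\<forall>i. P (C i) \<and> C i \<subseteq> U \<and> C i \<subseteq> C (Suc i)" by (intro allI conjI assms)
  then show ?thesis using assms(1) unfolding noetherian_below_def by simp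
qed

lemma noetherian_below_antimono:
  assumes "noetherian_below P U" "\<And>X. Q X \<Longrightarrow> P X" shows "noetherian_below Q U"
  unfolding noetherian_below_def
proof (intro allI impI)
  fix C :: "nat \<Rightarrow> 'a set"
  assume C: "\<forall>i. Q (C i) \<and> C i \<subseteq> U \<and> C i \<subseteq> C (Suc i)"
  have "P (C i)" "C i \<subseteq> U" "C i \<subseteq> C (Suc i)" for i using C[rule_format, of i] assms(2)[of "C i"] by simp_all
  from noetherian_stabilizes[of P U C, OF assms(1) this] show "\<exists>N. \<forall>i\<ge>N. C i = C N" .
qed

lemma noetherian_induct:
  assumes noeth: "noetherian_below P U"
    and step: "\<And>L. P L \<Longrightarrow> L \<subseteq> U \<Longrightarrow> (\<And>L'. P L' \<Longrightarrow> L \<subset> L' \<Longrightarrow> L' \<subseteq> U \<Longrightarrow> Q L') \<Longrightarrow> Q L"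
    and L: "P L" "L \<subseteq> U"
  shows "Q L"
proof (rule ccontr)
  assume "\<not> Q L"
  have "\<exists>f. \<forall>n :: nat. (P (f n) \<and> f n \<subseteq> U \<and> \<not> Q (f n)) \<and> f n \<subset> f (Suc n)"
  proof (rule dependent_nat_choice)
    show "\<exists>x. P x \<and> x \<subseteq> U \<and> \<not> Q x" using L \<open>\<not> Q L\<close> by blast
    fix X :: "'a set" and n :: nat
    assume X: "P X \<and> X \<subseteq> U \<and> \<not> Q X"
    show "\<exists>Y. (P Y \<and> Y \<subseteq> U \<and> \<not> Q Y) \<and> X \<subset> Y"
    proof (rule ccontr)
      assume none: "\<nexists>Y. (P Y \<and> Y \<subseteq> U \<and> \<not> Q Y) \<and> X \<subset> Y"
      have "Q X" by (rule step) (use X none in auto)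
      then show False using X by blast
    qed
  qed
  then obtain f where f: "\<forall>n :: nat. (P (f n) \<and> f n \<subseteq> U \<and> \<not> Q (f n)) \<and> f n \<subset> f (Suc n)" ..
  have "P (f i)" "f i \<subseteq> U" "f i \<subseteq> f (Suc i)" for i using f[rule_format, of i] by auto
  from noetherian_stabilizes[of P U f, OF noeth this] obtain N where "\<forall>i\<ge>N. f i = f N" ..
  then have "f (Suc N) = f N" by (rule allE[of _ "Suc N"]) simp
  then show False using f[rule_format, of N] by auto
qed

lemma noetherian_maximal:
  assumes "noetherian_below P U" "L \<in> F" "\<And>X. X \<in> F \<Longrightarrow> P X \<and> X \<subseteq> U"
  shows "\<exists>X\<in>F. \<forall>Y\<in>F. \<not> X \<subset> Y"
proof -
  have "L \<in> F \<longrightarrow> (\<exists>X\<in>F. \<forall>Y\<in>F. \<not> X \<subset> Y)"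
  proof (rule noetherian_induct[OF assms(1)])
    show "P L" "L \<subseteq> U" using assms(2,3) by auto
    fix K assume IH: "\<And>L'. P L' \<Longrightarrow> K \<subset> L' \<Longrightarrow> L' \<subseteq> U \<Longrightarrow> L' \<in> F \<longrightarrow> (\<exists>X\<in>F. \<forall>Y\<in>F. \<not> X \<subset> Y)"
    show "K \<in> F \<longrightarrow> (\<exists>X\<in>F. \<forall>Y\<in>F. \<not> X \<subset> Y)"
    proof (cases "\<exists>Y\<in>F. K \<subset> Y")
      case True then show ?thesis using IH assms(3) by blast
    qed blast
  qed
  then show ?thesis using assms(2) by blast
qed

lemma finite_length_noetherian:
  assumes fin: "chain_length P U0 U \<noteq> \<infinity>" and P: "P U0" "P U" and least: "\<And>X. P X \<Longrightarrow> U0 \<subseteq> X"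
  shows "noetherian_below P U"
  unfolding noetherian_below_def
proof (intro allI impI, rule ccontr)
  fix C :: "nat \<Rightarrow> 'a set"
  assume C: "\<forall>i. P (C i) \<and> C i \<subseteq> U \<and> C i \<subseteq> C (Suc i)" and ns: "\<nexists>N. \<forall>i\<ge>N. C i = C N"
  have mono: "C i \<subseteq> C j" if "i \<le> j" for i j
  proof (rule lift_Suc_mono_le[of C, OF _ that])
    show "C n \<subseteq> C (Suc n)" for n using C[rule_format, of n] by simp
  qed
  obtain l where l: "chain_length P U0 U = enat l" using fin by blast
  have "\<exists>i m. n \<le> m \<and> strict_chain P U0 (C i) m" for n
  proof (induction n)
    case 0
    have "P (C 0)" using C[rule_format, of 0] by simp
    with strict_chain_two[of P U0 "C 0", OF P(1) this least[OF this]] show ?case by blast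
  next
    case (Suc n)
    then obtain i m where im: "n \<le> m" "strict_chain P U0 (C i) m" by blast
    obtain j where "j \<ge> i" "C j \<noteq> C i" using ns by blast
    then have "C i \<subset> C j" using mono by blast
    moreover have "P (C j)" using C[rule_format, of j] by simp
    ultimately have "strict_chain P U0 (C j) (Suc m)" using strict_chain.step[OF im(2)] by simp
    then show ?case using im(1) by (intro exI[of _ j] exI[of _ "Suc m"]) auto
  qed
  then obtain i m where im: "Suc l \<le> m" "strict_chain P U0 (C i) m" by blast
  have "chain_length P U0 (C i) \<le> chain_length P U0 U"
    using C[rule_format, of i] P(2) by (intro chain_length_mono) auto
  with strict_chain_length_le[OF im(2)] have "enat m \<le> chain_length P U0 U" by (rule order_trans)
  then show False using l im(1) by simp
qed

context module
begin

lemma stable_Union_chain: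
  assumes "\<C> \<noteq> {}" "\<And>X. X \<in> \<C> \<Longrightarrow> stable_subgroup M \<Omega> X"
    and chain: "\<And>X Y. X \<in> \<C> \<Longrightarrow> Y \<in> \<C> \<Longrightarrow> X \<subseteq> Y \<or> Y \<subseteq> X"
  shows "stable_subgroup M \<Omega> (\<Union>\<C>)"
proof -
  note D = stable_subgroupD[OF assms(2)]
  show ?thesis
    unfolding stable_subgroup_def
  proof (intro conjI ballI subsetI; (elim UnionE)?)
    show "x \<in> carrier M" if "x \<in> X" "X \<in> \<C>" for x X using D(1)[OF that(2,1)] .
    obtain X where "X \<in> \<C>" using assms(1) by blast
    then show "\<zero>\<^bsub>M\<^esub> \<in> \<Union>\<C>" using D(2)[of X] by blast
    show "x \<oplus>\<^bsub>M\<^esub> y \<in> \<Union>\<C>" if "x \<in> X" "X \<in> \<C>" "y \<in> Y" "Y \<in> \<C>" for x y X Y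
    proof (cases "X \<subseteq> Y")
      case True then show ?thesis using D(3)[of Y x y] that by blast
    next
      case False then show ?thesis using D(3)[of X x y] that chain[of X Y] by blast
    qed
    show "\<ominus>\<^bsub>M\<^esub> x \<in> \<Union>\<C>" if "x \<in> X" "X \<in> \<C>" for x X using D(4)[OF that(2,1)] that(2) by blast
    show "a \<odot>\<^bsub>M\<^esub> x \<in> \<Union>\<C>" if "a \<in> \<Omega>" "x \<in> X" "X \<in> \<C>" for a x X
      using D(5)[OF that(3,1,2)] that(3) by blast
  qed
qed

lemma stable_maximal_avoiding:
  assumes "stable_subgroup M \<Omega> N" "N \<subseteq> U" "w \<notin> N"
  obtains J where "stable_subgroup M \<Omega> J" "N \<subseteq> J" "J \<subseteq> U" "w \<notin> J"
    "\<And>K. stable_subgroup M \<Omega> K \<Longrightarrow> J \<subset> K \<Longrightarrow> K \<subseteq> U \<Longrightarrow> w \<in> K"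
proof -
  let ?F = "{J. stable_subgroup M \<Omega> J \<and> N \<subseteq> J \<and> J \<subseteq> U \<and> w \<notin> J}"
  have "\<exists>J\<in>?F. \<forall>X\<in>?F. J \<subseteq> X \<longrightarrow> X = J"
  proof (rule subset_Zorn_nonempty)
    show "?F \<noteq> {}" using assms by blast
    fix \<C> assume c: "\<C> \<noteq> {}" "subset.chain ?F \<C>"
    then have "\<C> \<subseteq> ?F" "\<And>X Y. X \<in> \<C> \<Longrightarrow> Y \<in> \<C> \<Longrightarrow> X \<subseteq> Y \<or> Y \<subseteq> X"
      unfolding subset_chain_def by auto
    moreover from this have "stable_subgroup M \<Omega> (\<Union>\<C>)"
      by (intro stable_Union_chain c(1)) auto
    ultimately show "\<Union>\<C> \<in> ?F" using c(1) by blast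
  qed
  then obtain J where J: "J \<in> ?F" "\<forall>X\<in>?F. J \<subseteq> X \<longrightarrow> X = J" ..
  show ?thesis
  proof (rule that[of J])
    show "w \<in> K" if "stable_subgroup M \<Omega> K" "J \<subset> K" "K \<subseteq> U" for K
      using that J(1) bspec[OF J(2), of K] by blast
  qed (use J(1) in auto)
qed

text \<open>The polynomials in \<open>y\<close> of degree less than \<open>i\<close> with coefficients in \<open>U\<close>.\<close>

primrec adjoin_upto :: "'a \<Rightarrow> 'c set \<Rightarrow> nat \<Rightarrow> 'c set" where
  "adjoin_upto y U 0 = {\<zero>\<^bsub>M\<^esub>}"
| "adjoin_upto y U (Suc i) = adjoin_upto y U i <+>\<^bsub>M\<^esub> ((\<lambda>u. (y [^] i) \<odot>\<^bsub>M\<^esub> u) ` U)"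

lemma stable_adjoin_upto:
  assumes "\<Omega> \<subseteq> carrier R" "stable_subgroup M \<Omega> U" "y \<in> carrier R"
  shows "stable_subgroup M \<Omega> (adjoin_upto y U i)"
proof (induction i)
  case 0 show ?case using stable_zero[OF assms(1)] by simp
next
  case (Suc i)
  then show ?case using assms by (simp add: stable_set_add stable_scaled)
qed

lemma adjoin_upto_mono:
  assumes "\<Omega> \<subseteq> carrier R" "stable_subgroup M \<Omega> U" "y \<in> carrier R" "i \<le> j"
  shows "adjoin_upto y U i \<subseteq> adjoin_upto y U j"
proof (rule lift_Suc_mono_le[OF _ assms(4)])
  fix i :: nat
  have "stable_subgroup M \<Omega> ((\<lambda>u. (y [^] i) \<odot>\<^bsub>M\<^esub> u) ` U)"
    using assms(1-3) by (intro stable_scaled) simp_all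
  from set_add_upper(1)[OF stable_adjoin_upto[OF assms(1-3)] this]
  show "adjoin_upto y U i \<subseteq> adjoin_upto y U (Suc i)" by simp
qed

lemma adjoin_upto_shift:
  assumes "\<Omega> \<subseteq> carrier R" "stable_subgroup M \<Omega> U" "y \<in> carrier R" "x \<in> adjoin_upto y U i"
  shows "y \<odot>\<^bsub>M\<^esub> x \<in> adjoin_upto y U (Suc i)"
  using assms(4)
proof (induction i arbitrary: x)
  case 0
  then have "y \<odot>\<^bsub>M\<^esub> x = \<zero>\<^bsub>M\<^esub>" using assms(3) by simp
  then show ?case
    using stable_subgroupD(2)[OF stable_adjoin_upto[OF assms(1-3)], of "Suc 0"]
    by (simp del: adjoin_upto.simps)
next
  case (Suc i)
  from Suc.prems[unfolded adjoin_upto.simps]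
  obtain v w where "v \<in> adjoin_upto y U i" "w \<in> (\<lambda>u. (y [^] i) \<odot>\<^bsub>M\<^esub> u) ` U" "x = v \<oplus>\<^bsub>M\<^esub> w"
    by (rule set_addE)
  then obtain u where vu: "v \<in> adjoin_upto y U i" "u \<in> U" "x = v \<oplus>\<^bsub>M\<^esub> (y [^] i) \<odot>\<^bsub>M\<^esub> u" by blast
  have c: "v \<in> carrier M" "u \<in> carrier M"
    using stable_subgroupD(1)[OF stable_adjoin_upto[OF assms(1-3)]]
      stable_subgroupD(1)[OF assms(2)] vu by blast+
  have "y \<odot>\<^bsub>M\<^esub> x = y \<odot>\<^bsub>M\<^esub> v \<oplus>\<^bsub>M\<^esub> (y [^] Suc i) \<odot>\<^bsub>M\<^esub> u"
    using c assms(3) by (simp add: vu(3) smult_r_distr R.m_comm flip: smult_assoc1)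
  moreover have "y \<odot>\<^bsub>M\<^esub> v \<in> adjoin_upto y U (Suc i)" using vu(1) by (rule Suc.IH)
  ultimately show ?case
    using vu(2) unfolding adjoin_upto.simps(2)[of y U "Suc i"] by (simp add: set_addI del: adjoin_upto.simps)
qed

text \<open>Hilbert's basis theorem without polynomial rings.  Let \<open>E\<^sub>i\<close> be the group of polynomials in \<open>y\<close> of degree less than
  \<open>i\<close> with coefficients in \<open>U\<close>.  For a submodule \<open>L\<close> of their union, \<open>{u \<in> U. y\<^sup>i u \<in> E\<^sub>i + L}\<close> consists of the
  leading coefficients of the elements of degree \<open>i\<close> of \<open>L\<close>.  These groups ascend with \<open>i\<close> and with
  \<open>L\<close>, and submodules \<open>L \<subseteq> L'\<close> with the same leading coefficients are equal; so an ascending chain of submodules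
  becomes stationary as soon as the doubly indexed family of its leading coefficients does, which is seen on the diagonal and in finitely many rows.\<close>

lemma noetherian_adjoin:
  assumes \<Omega>: "\<Omega> \<subseteq> carrier R" and U: "stable_subgroup M \<Omega> U" and y: "y \<in> carrier R"
    and noeth: "noetherian_below (stable_subgroup M \<Omega>) U"
  shows "\<exists>V. stable_subgroup M (insert y \<Omega>) V \<and> U \<subseteq> V \<and>
    noetherian_below (stable_subgroup M (insert y \<Omega>)) V"
proof (intro exI conjI)
  let ?E = "adjoin_upto y U"
  let ?V = "\<Union> (range ?E)"
  note E = stable_adjoin_upto[OF \<Omega> U y] and E_mono = adjoin_upto_mono[OF \<Omega> U y]
  have y_pow: "y [^] i \<in> carrier R" for i :: nat using y by simp
  have E_total: "?E i \<subseteq> ?E j \<or> ?E j \<subseteq> ?E i" for i j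
    using E_mono[of i j] E_mono[of j i] by linarith
  have "stable_subgroup M \<Omega> ?V" using E E_total by (intro stable_Union_chain) auto
  then show "stable_subgroup M (insert y \<Omega>) ?V"
    using adjoin_upto_shift[OF \<Omega> U y] unfolding stable_subgroup_insert by blast
  have "(\<lambda>u. (y [^] (0::nat)) \<odot>\<^bsub>M\<^esub> u) ` U = U"
    using stable_subgroupD(1)[OF U] by (auto simp: image_iff)
  then have "U \<subseteq> ?E 1" using set_add_upper(2)[OF stable_zero[OF \<Omega>] U] by (simp add: One_nat_def)
  then show "U \<subseteq> ?V" by blast
  define lc where "lc L i = {u \<in> U. (y [^] (i :: nat)) \<odot>\<^bsub>M\<^esub> u \<in> ?E i <+>\<^bsub>M\<^esub> L}" for L i
  have lc_stable: "stable_subgroup M \<Omega> (lc L i)" if "stable_subgroup M \<Omega> L" for L i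
    unfolding lc_def using that by (intro stable_preimage stable_set_add \<Omega> U E y_pow)
  have lc_mono1: "lc L i \<subseteq> lc L' i" if "L \<subseteq> L'" for L L' i
    unfolding lc_def using set_add_mono[OF order_refl that] by blast
  have lc_Suc: "lc L i \<subseteq> lc L (Suc i)" if L: "stable_subgroup M (insert y \<Omega>) L" for L i
  proof
    fix u assume "u \<in> lc L i"
    then have u: "u \<in> U" "(y [^] i) \<odot>\<^bsub>M\<^esub> u \<in> ?E i <+>\<^bsub>M\<^esub> L" by (auto simp: lc_def)
    from u(2) obtain e l where el: "e \<in> ?E i" "l \<in> L" "(y [^] i) \<odot>\<^bsub>M\<^esub> u = e \<oplus>\<^bsub>M\<^esub> l"
      by (rule set_addE)
    have c: "u \<in> carrier M" "e \<in> carrier M" "l \<in> carrier M"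
      using stable_subgroupD(1)[OF U u(1)] stable_subgroupD(1)[OF E el(1)]
        stable_subgroupD(1)[OF L el(2)] .
    have "(y [^] Suc i) \<odot>\<^bsub>M\<^esub> u = y \<odot>\<^bsub>M\<^esub> ((y [^] i) \<odot>\<^bsub>M\<^esub> u)"
      using c y by (simp add: R.m_comm flip: smult_assoc1)
    also have "\<dots> = y \<odot>\<^bsub>M\<^esub> e \<oplus>\<^bsub>M\<^esub> y \<odot>\<^bsub>M\<^esub> l" using c y by (simp add: el(3) smult_r_distr)
    also have "\<dots> \<in> ?E (Suc i) <+>\<^bsub>M\<^esub> L"
      using adjoin_upto_shift[OF \<Omega> U y el(1)] stable_subgroupD(5)[OF L insertI1 el(2)]
      by (rule set_addI)
    finally show "u \<in> lc L (Suc i)" using u(1) by (simp add: lc_def del: adjoin_upto.simps)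
  qed
  have lc_mono2: "lc L i \<subseteq> lc L j" if "stable_subgroup M (insert y \<Omega>) L" "i \<le> j" for L i j
    by (rule lift_Suc_mono_le[of "lc L", OF lc_Suc[OF that(1)] that(2)])
  have lc_determines: "L' \<subseteq> L"
    if L: "stable_subgroup M \<Omega> L" "stable_subgroup M \<Omega> L'" "L \<subseteq> L'" "L' \<subseteq> ?V"
      and eq: "\<And>i. lc L i = lc L' i" for L L'
  proof -
    have "L' \<inter> ?E i \<subseteq> L" for i
    proof (induction i)
      case 0 then show ?case using stable_subgroupD(2)[OF L(1)] by auto
    next
      case (Suc i)
      show ?case
      proof
        fix x assume x: "x \<in> L' \<inter> ?E (Suc i)"
        then obtain v w where "v \<in> ?E i" "w \<in> (\<lambda>u. (y [^] i) \<odot>\<^bsub>M\<^esub> u) ` U" "x = v \<oplus>\<^bsub>M\<^esub> w"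
          unfolding adjoin_upto.simps by (blast elim: set_addE)
        then obtain u where vu: "v \<in> ?E i" "u \<in> U" "x = v \<oplus>\<^bsub>M\<^esub> (y [^] i) \<odot>\<^bsub>M\<^esub> u" by blast
        have c: "v \<in> carrier M" "(y [^] i) \<odot>\<^bsub>M\<^esub> u \<in> carrier M"
          using stable_subgroupD(1)[OF E vu(1)] stable_subgroupD(1)[OF U vu(2)] y by simp_all
        have "(y [^] i) \<odot>\<^bsub>M\<^esub> u = \<ominus>\<^bsub>M\<^esub> v \<oplus>\<^bsub>M\<^esub> x" using c by (simp add: vu(3) M.r_neg1)
        also have "\<dots> \<in> ?E i <+>\<^bsub>M\<^esub> L'"
          using stable_subgroupD(4)[OF E vu(1)] x by (intro set_addI) auto
        finally have "u \<in> lc L i" unfolding eq using vu(2) by (simp add: lc_def)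
        then have "(y [^] i) \<odot>\<^bsub>M\<^esub> u \<in> ?E i <+>\<^bsub>M\<^esub> L" by (simp add: lc_def)
        then obtain e l where el: "e \<in> ?E i" "l \<in> L" "(y [^] i) \<odot>\<^bsub>M\<^esub> u = e \<oplus>\<^bsub>M\<^esub> l"
          by (rule set_addE)
        have c': "e \<in> carrier M" "l \<in> carrier M"
          using stable_subgroupD(1)[OF E el(1)] stable_subgroupD(1)[OF L(1) el(2)] .
        have x_eq: "x = (v \<oplus>\<^bsub>M\<^esub> e) \<oplus>\<^bsub>M\<^esub> l" using c c' by (simp add: vu(3) el(3) M.a_assoc)
        have "l \<in> L'" using el(2) L(3) by blast
        then have "v \<oplus>\<^bsub>M\<^esub> e \<in> L'"
          using stable_cancel_right[OF L(2), of "v \<oplus>\<^bsub>M\<^esub> e" l] x x_eq c c' by simp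
        moreover have "v \<oplus>\<^bsub>M\<^esub> e \<in> ?E i" using vu(1) el(1) by (rule stable_subgroupD(3)[OF E])
        ultimately have "v \<oplus>\<^bsub>M\<^esub> e \<in> L" using Suc by blast
        then show "x \<in> L" unfolding x_eq using el(2) by (rule stable_subgroupD(3)[OF L(1)])
      qed
    qed
    then show ?thesis using L(4) by blast
  qed
  show "noetherian_below (stable_subgroup M (insert y \<Omega>)) ?V"
    unfolding noetherian_below_def
  proof (intro allI impI)
    fix C :: "nat \<Rightarrow> 'c set"
    assume C: "\<forall>i. stable_subgroup M (insert y \<Omega>) (C i) \<and> C i \<subseteq> ?V \<and> C i \<subseteq> C (Suc i)"
    have C_stable: "stable_subgroup M (insert y \<Omega>) (C p)" "C p \<subseteq> ?V" "C p \<subseteq> C (Suc p)" for p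
      using C[rule_format, of p] by simp_all
    have C\<Omega>: "stable_subgroup M \<Omega> (C p)" for p
      using C_stable(1)[of p] by (simp add: stable_subgroup_insert)
    have C_mono: "C p \<subseteq> C q" if "p \<le> q" for p q
      using C_stable(3) that by (rule lift_Suc_mono_le[of C])
    have D_mono: "lc (C p) i \<subseteq> lc (C q) j" if "p \<le> q" "i \<le> j" for p q i j
      using lc_mono1[OF C_mono[OF that(1)], of i] lc_mono2[of "C q" i j] that(2) C_stable(1)[of q] by simp
    have acc: "\<exists>N. \<forall>p\<ge>N. lc (C p) (f p) = lc (C N) (f N)" if "\<And>p. f p \<le> f (Suc p)" for f
    proof -
      have "lc (C p) (f p) \<subseteq> U" for p unfolding lc_def by blast
      moreover have "lc (C p) (f p) \<subseteq> lc (C (Suc p)) (f (Suc p))" for p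
        using D_mono[of p "Suc p", OF _ that] by simp
      ultimately show ?thesis using noetherian_stabilizes[OF noeth lc_stable[OF C\<Omega>]] by simp
    qed
    \<comment> \<open>Beyond \<open>N\<close>, both indices are controlled by the diagonal; the rows below \<open>N\<close> are treated separately.\<close>
    obtain N where N: "\<And>p. p \<ge> N \<Longrightarrow> lc (C p) p = lc (C N) N" using acc[of "\<lambda>p. p"] by auto
    obtain m where m: "\<And>i p. p \<ge> m i \<Longrightarrow> lc (C p) i = lc (C (m i)) i"
      using acc[of "\<lambda>_. i" for i] by (metis order_refl)
    define K where "K = max N (Max (m ` {..N}))"
    have "C p = C K" if p: "p \<ge> K" for p
    proof
      show "C K \<subseteq> C p" using C_mono p by blast
      show "C p \<subseteq> C K"
      proof (rule lc_determines[OF C\<Omega> C\<Omega> C_mono[OF p]])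
        show "lc (C K) i = lc (C p) i" for i
        proof (cases "i \<le> N")
          case True
          then have "m i \<le> K" by (simp add: K_def le_max_iff_disj)
          then show ?thesis using m[of i K] m[of i p] p by simp
        next
          case False
          then have i: "N \<le> i" by simp
          have NK: "N \<le> K" by (simp add: K_def)
          have "lc (C q) i = lc (C N) N" if "N \<le> q" for q
            using D_mono[OF that i] D_mono[of q "max q i" i "max q i"] N[of "max q i"] that by auto
          then show ?thesis using NK p by simp
        qed
      qed (rule C_stable(2))
    qed
    then show "\<exists>N. \<forall>i\<ge>N. C i = C N" by blast
  qed
qed

lemma noetherian_finite_adjoin:
  assumes "finite Y" "Y \<subseteq> carrier R" "\<Omega> \<subseteq> carrier R" "stable_subgroup M \<Omega> U"
    "noetherian_below (stable_subgroup M \<Omega>) U"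
  shows "\<exists>V. stable_subgroup M (Y \<union> \<Omega>) V \<and> U \<subseteq> V \<and> noetherian_below (stable_subgroup M (Y \<union> \<Omega>)) V"
  using assms
proof (induction Y rule: finite_induct)
  case empty then show ?case by (intro exI[of _ U]) auto
next
  case (insert y Y)
  then obtain V where V: "stable_subgroup M (Y \<union> \<Omega>) V" "U \<subseteq> V"
    "noetherian_below (stable_subgroup M (Y \<union> \<Omega>)) V" by auto
  have "Y \<union> \<Omega> \<subseteq> carrier R" "y \<in> carrier R" using insert.prems by auto
  from noetherian_adjoin[OF this(1) V(1) this(2) V(3)] V(2) show ?case
    by (metis Un_insert_left order_trans)
qed

end

section \<open>Artinian local rings have finite length\<close>

text \<open>Through this record, statements about modules apply to ideals.\<close>

definition regular_module :: "('a, 'r) ring_scheme \<Rightarrow> ('a, 'a) module" where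
  "regular_module R = \<lparr>carrier = carrier R, mult = mult R, one = one R, zero = zero R, add = add R,
     smult = mult R\<rparr>"

lemma regular_module_simps [simp]:
  "carrier (regular_module R) = carrier R" "\<zero>\<^bsub>regular_module R\<^esub> = \<zero>\<^bsub>R\<^esub>"
  "x \<oplus>\<^bsub>regular_module R\<^esub> y = x \<oplus>\<^bsub>R\<^esub> y" "a \<odot>\<^bsub>regular_module R\<^esub> x = a \<otimes>\<^bsub>R\<^esub> x"
  by (simp_all add: regular_module_def)

lemma a_inv_regular_module [simp]: "\<ominus>\<^bsub>regular_module R\<^esub> x = \<ominus>\<^bsub>R\<^esub> x"
  by (simp add: a_inv_def m_inv_def)

context cring
begin

lemma regular_module_is_module: "Module.module R (regular_module R)"
proof (rule moduleI)
  show "cring R" by unfold_locales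
  have "comm_group (add_monoid R)" by (rule a_comm_group)
  then show "abelian_group (regular_module R)"
    by (intro abelian_groupI) (auto simp: a_ac intro: a_inv_closed l_neg bexI[of _ "\<ominus> _"])
qed (auto simp: l_distr r_distr m_assoc)

lemma ideal_iff_stable:
  "ideal I R \<longleftrightarrow> stable_subgroup (regular_module R) (carrier R) I"
proof
  assume I: "ideal I R"
  then interpret ideal I R .
  show "stable_subgroup (regular_module R) (carrier R) I"
    unfolding stable_subgroup_def by (auto simp: I_l_closed a_Hcarr)
next
  assume "stable_subgroup (regular_module R) (carrier R) I"
  note I = stable_subgroupD[OF this, simplified]
  show "ideal I R"
  proof (rule idealI)
    show "ring R" by unfold_locales
    show "subgroup I (add_monoid R)"
      by (rule subgroup.intro) (use I in \<open>auto simp flip: a_inv_def\<close>)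
    show "x \<otimes> a \<in> I" if "a \<in> I" "x \<in> carrier R" for a x using I(5) that by simp
    then show "a \<otimes> x \<in> I" if "a \<in> I" "x \<in> carrier R" for a x
      using that I(1) by (simp add: m_comm)
  qed
qed

end

context artinian_local_ring
begin

interpretation reg: module A "regular_module A" by (rule regular_module_is_module)

text \<open>Otherwise an ideal maximal among those that contain \<open>a\<close> but not \<open>\<one>\<close> would be a second maximal ideal.\<close>

lemma nonmember_unit:
  assumes a: "a \<in> carrier A" "a \<notin> \<mm>" shows "\<exists>b\<in>carrier A. b \<otimes> a = \<one>"
proof (rule ccontr)
  let ?P = "stable_subgroup (regular_module A) (carrier A)"
  assume "\<not> (\<exists>b\<in>carrier A. b \<otimes> a = \<one>)"
  then have one: "\<one> \<notin> PIdl a" by (auto simp: cgenideal_def) 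
  have P: "?P (PIdl a)" using cgenideal_ideal[OF a(1)] by (simp add: ideal_iff_stable)
  have le: "PIdl a \<subseteq> carrier A" using cgenideal_ideal[OF a(1)] by (simp add: ideal.Icarr subsetI)
  obtain J where J: "?P J" "PIdl a \<subseteq> J" "J \<subseteq> carrier A" "\<one> \<notin> J"
    "\<And>K. ?P K \<Longrightarrow> J \<subset> K \<Longrightarrow> K \<subseteq> carrier A \<Longrightarrow> \<one> \<in> K"
    by (rule reg.stable_maximal_avoiding[OF P le one]) (rule that)
  have idJ: "ideal J A" using J(1) by (simp add: ideal_iff_stable)
  have "maximalideal J A"
  proof (rule maximalidealI[OF idJ])
    show "carrier A \<noteq> J" using J(4) by auto
    show "K = J \<or> K = carrier A" if K: "ideal K A" "J \<subseteq> K" "K \<subseteq> carrier A" for K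
      using J(5)[of K] K ideal.one_imp_carrier[OF K(1)] by (auto simp: ideal_iff_stable)
  qed
  then have "J = \<mm>" by (rule unique_maximal)
  then show False using cgenideal_self[OF a(1)] J(2) a(2) by blast
qed

lemma one_minus_unit:
  assumes "t \<in> \<mm>" shows "\<exists>b\<in>carrier A. b \<otimes> (\<one> \<ominus> t) = \<one>"
proof (rule nonmember_unit)
  have t: "t \<in> carrier A" using assms by (rule Icarr)
  then show "\<one> \<ominus> t \<in> carrier A" by simp
  show "\<one> \<ominus> t \<notin> \<mm>"
  proof
    assume "\<one> \<ominus> t \<in> \<mm>"
    then have "(\<one> \<ominus> t) \<oplus> t \<in> \<mm>" using assms by (rule a_closed)
    then have "\<one> \<in> \<mm>" using t by (simp add: minus_eq a_assoc l_neg)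
    then show False using one_imp_carrier I_notcarr by simp
  qed
qed

lemma minimal_ideal_exists:
  assumes "F \<noteq> {}" "\<And>I. I \<in> F \<Longrightarrow> ideal I A"
  shows "\<exists>I\<in>F. \<forall>J\<in>F. \<not> J \<subset> I"
proof (rule ccontr)
  assume none: "\<not> (\<exists>I\<in>F. \<forall>J\<in>F. \<not> J \<subset> I)"
  have "\<exists>f. \<forall>n :: nat. f n \<in> F \<and> f (Suc n) \<subset> f n"
    by (rule dependent_nat_choice) (use assms(1) none in auto)
  then obtain f where f: "\<forall>n :: nat. f n \<in> F \<and> f (Suc n) \<subset> f n" ..
  then have "\<exists>N. \<forall>n\<ge>N. f n = f N" using assms(2) by (intro descending_chain) auto
  then obtain N where "\<forall>n\<ge>N. f n = f N" ..
  then have "f (Suc N) = f N" by (rule allE[of _ "Suc N"]) simp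
  then show False using f by auto
qed

text \<open>If \<open>\<mm>I \<noteq> I\<close>, a subideal maximal among those that contain \<open>\<mm>I\<close> and avoid some given element of \<open>I\<close> outside of \<open>\<mm>I\<close> is a
  hyperplane over the residue field.  The case \<open>\<mm>I = I \<noteq> 0\<close> does not occur: among the elements with
  \<open>aI \<noteq> 0\<close> choose \<open>a\<close> with \<open>(a)\<close> minimal; as \<open>aI = a\<mm>I\<close>, also \<open>maI \<noteq> 0\<close> for some
  \<open>m \<in> \<mm>\<close>, so \<open>(ma) = (a)\<close> and \<open>a = rma\<close>, whence \<open>a = 0\<close>.\<close>

lemma finite_colength_subideal:
  assumes I: "ideal I A" "I \<noteq> {\<zero>}"
  shows "\<exists>J. ideal J A \<and> J \<subset> I \<and> chain_length (\<lambda>I. ideal I A) J I \<noteq> \<infinity>"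
proof -
  interpret I: ideal I A by (rule I(1))
  define mI where "mI = \<Inter>{J. ideal J A \<and> (\<forall>m\<in>\<mm>. \<forall>x\<in>I. m \<otimes> x \<in> J)}"
  have mI_in: "m \<otimes> x \<in> mI" if "m \<in> \<mm>" "x \<in> I" for m x using that by (auto simp: mI_def)
  have mI_I: "mI \<subseteq> I" using I(1) Icarr I.I_l_closed unfolding mI_def by blast
  have "ideal mI A" unfolding mI_def using I(1) Icarr I.I_l_closed by (intro i_Intersect) auto
  show ?thesis
  proof (cases "mI = I")
    case False
    then obtain w where w: "w \<in> I" "w \<notin> mI" using mI_I by blast
    have "stable_subgroup (regular_module A) (carrier A) mI"
      using \<open>ideal mI A\<close> by (simp add: ideal_iff_stable)
    note avoid = reg.stable_maximal_avoiding[OF this mI_I w(2), folded ideal_iff_stable]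
    obtain J where J: "ideal J A" "mI \<subseteq> J" "J \<subseteq> I" "w \<notin> J"
      "\<And>K. ideal K A \<Longrightarrow> J \<subset> K \<Longrightarrow> K \<subseteq> I \<Longrightarrow> w \<in> K"
      by (rule avoid) (rule that)
    interpret J: ideal J A by (rule J(1))
    \<comment> \<open>There is nothing strictly between \<open>J\<close> and \<open>I\<close>, so the interval has length one.\<close>
    have top: "K = I" if K: "ideal K A" "J \<subset> K" "K \<subseteq> I" for K
    proof
      interpret K: ideal K A by (rule K(1))
      have wK: "w \<in> K" using J(5)[OF K] .
      show "I \<subseteq> K"
      proof
        fix v assume v: "v \<in> I"
        show "v \<in> K"
        proof (cases "v \<in> J")
          case False
          have vc: "v \<in> carrier A" using v by (rule I.Icarr)
          have "ideal (J <+> PIdl v) A" by (intro add_ideals J(1) cgenideal_ideal vc)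
          moreover have "J \<subset> J <+> PIdl v"
          proof
            show "J \<subseteq> J <+> PIdl v"
            proof
              fix j assume j: "j \<in> J"
              then have "j \<oplus> \<zero> \<in> J <+> PIdl v"
                by (intro set_addI) (auto simp: cgenideal_def vc intro!: exI[of _ \<zero>])
              then show "j \<in> J <+> PIdl v" using J.Icarr[OF j] by simp
            qed
            have "\<zero> \<oplus> v \<in> J <+> PIdl v" by (intro set_addI cgenideal_self vc) simp
            then show "J \<noteq> J <+> PIdl v" using False vc by auto
          qed
          moreover have "J <+> PIdl v \<subseteq> I"
            using J(3) v I.I_l_closed by (auto elim!: set_addE simp: cgenideal_def)
          ultimately have "w \<in> J <+> PIdl v" by (rule J(5))
          then obtain j a where ja: "j \<in> J" "a \<in> carrier A" "w = j \<oplus> a \<otimes> v"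
            by (auto elim!: set_addE simp: cgenideal_def)
          have jc: "j \<in> carrier A" using ja(1) by (rule J.Icarr)
          have "a \<notin> \<mm>"
          proof
            assume "a \<in> \<mm>"
            then have "a \<otimes> v \<in> J" using mI_in[OF _ v] J(2) by blast
            then show False using ja J(4) by simp
          qed
          then obtain b where b: "b \<in> carrier A" "b \<otimes> a = \<one>" using nonmember_unit ja(2) by blast
          have "\<ominus> j \<oplus> w \<in> K" using ja(1) K(2) wK by (intro K.a_closed K.a_inv_closed) auto
          moreover have "\<ominus> j \<oplus> w = a \<otimes> v" using jc ja(2) vc by (simp add: ja(3) r_neg1)
          ultimately have "b \<otimes> (a \<otimes> v) \<in> K" using b(1) by (simp add: K.I_l_closed)
          then show "v \<in> K" using b ja(2) vc by (simp flip: m_assoc)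
        qed (use K(2) in blast)
      qed
    qed (rule K(3))
    have "n \<le> 1" if "strict_chain (\<lambda>I. ideal I A) J I n" for n
      using that
    proof cases
      case (step V n')
      have "V = J"
      proof (rule ccontr)
        assume "V \<noteq> J"
        then have "J \<subset> V" using strict_chainD(1)[OF step(2)] by blast
        then have "V = I" using top[of V] strict_chainD(3)[OF step(2)] step(3) by blast
        then show False using step(3) by blast
      qed
      then have "enat n' \<le> 0"
        using strict_chain_length_le[OF step(2)] by (simp add: chain_length_self)
      then show ?thesis using step(1) by (simp add: zero_enat_def)
    qed simp
    then have "chain_length (\<lambda>I. ideal I A) J I \<le> enat 1" by (intro chain_length_le) simp
    then have "chain_length (\<lambda>I. ideal I A) J I \<noteq> \<infinity>" by (auto dest: enat_ile)
    then show ?thesis using J w(1) by blast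
  next
    case True
    let ?G = "{a \<in> carrier A. \<exists>x\<in>I. a \<otimes> x \<noteq> \<zero>}"
    have "\<one> \<in> ?G" using I(2) I.Icarr I.zero_closed by auto
    then have "(\<lambda>a. PIdl a) ` ?G \<noteq> {}" by blast
    moreover have "ideal K A" if "K \<in> (\<lambda>a. PIdl a) ` ?G" for K using that cgenideal_ideal by auto
    ultimately have "\<exists>K\<in>(\<lambda>a. PIdl a) ` ?G. \<forall>J\<in>(\<lambda>a. PIdl a) ` ?G. \<not> J \<subset> K"
      by (rule minimal_ideal_exists)
    then obtain a where a: "a \<in> carrier A" "a \<in> ?G" "\<And>b. b \<in> ?G \<Longrightarrow> \<not> PIdl b \<subset> PIdl a" by auto
    let ?Z = "{x \<in> carrier A. a \<otimes> x = \<zero>}"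
    have "ideal ?Z A"
      unfolding ideal_iff_stable stable_subgroup_def using a(1) by (auto simp: r_distr r_minus m_lcomm)
    obtain x where x: "x \<in> I" "x \<notin> ?Z" using a(2) I.Icarr by auto
    then have "\<not> mI \<subseteq> ?Z" using True by blast
    then obtain m y where my: "m \<in> \<mm>" "y \<in> I" "m \<otimes> y \<notin> ?Z"
      using \<open>ideal ?Z A\<close> unfolding mI_def by blast
    have c: "m \<in> carrier A" "y \<in> carrier A" using my Icarr I.Icarr by auto
    have "(m \<otimes> a) \<otimes> y \<noteq> \<zero>" using my(3) c a(1) by (simp add: m_ac)
    then have "m \<otimes> a \<in> ?G" using c a(1) my(2) by auto
    then have "\<not> PIdl (m \<otimes> a) \<subset> PIdl a" by (rule a(3))
    moreover have "PIdl (m \<otimes> a) \<subseteq> PIdl a"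
      using c a(1) by (auto simp: cgenideal_def) (metis m_assoc m_closed)
    ultimately have "a \<in> PIdl (m \<otimes> a)" using cgenideal_self[OF a(1)] by blast
    then obtain r where r: "r \<in> carrier A" "a = r \<otimes> (m \<otimes> a)" by (auto simp: cgenideal_def)
    have "r \<otimes> m \<in> \<mm>" using my(1) r(1) by (rule I_l_closed)
    then obtain b where b: "b \<in> carrier A" "b \<otimes> (\<one> \<ominus> r \<otimes> m) = \<one>" using one_minus_unit by blast
    have "(\<one> \<ominus> r \<otimes> m) \<otimes> a = a \<ominus> r \<otimes> (m \<otimes> a)"
      using r(1) c a(1) by (simp add: minus_eq l_distr l_minus m_assoc)
    also have "\<dots> = \<zero>" using r(2) a(1) by (simp add: minus_eq r_neg)
    finally have "(b \<otimes> (\<one> \<ominus> r \<otimes> m)) \<otimes> a = \<zero>" using b(1) r(1) c a(1) by (simp add: m_assoc)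
    then have "a = \<zero>" using b(2) a(1) by simp
    then show ?thesis using a(2) I.Icarr by auto
  qed
qed

text \<open>An ideal minimal among those of finite colength must be zero.\<close>

theorem finite_length: "chain_length (\<lambda>I. ideal I A) {\<zero>} (carrier A) \<noteq> \<infinity>"
proof -
  let ?P = "\<lambda>I. ideal I A"
  let ?F = "{I. ideal I A \<and> chain_length ?P I (carrier A) \<noteq> \<infinity>}"
  have "carrier A \<in> ?F" using oneideal by (simp add: chain_length_self del: not_infinity_eq)
  then have "?F \<noteq> {}" by blast
  then have "\<exists>I\<in>?F. \<forall>J\<in>?F. \<not> J \<subset> I" by (rule minimal_ideal_exists) simp
  then obtain I where I: "ideal I A" "chain_length ?P I (carrier A) \<noteq> \<infinity>"
    "\<And>J. ideal J A \<Longrightarrow> J \<subset> I \<Longrightarrow> chain_length ?P J (carrier A) = \<infinity>" by blast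
  have "I = {\<zero>}"
  proof (rule ccontr)
    assume "I \<noteq> {\<zero>}"
    then obtain J where J: "ideal J A" "J \<subset> I" "chain_length ?P J I \<noteq> \<infinity>"
      using finite_colength_subideal[OF I(1)] by blast
    have "I \<subseteq> carrier A" using I(1) by (simp add: ideal.Icarr subsetI)
    then have "chain_length ?P J (carrier A) = chain_length ?P J I + chain_length ?P I (carrier A)"
      using J I(1) reg.chain_length_add[OF order_refl, of J I "carrier A"] oneideal
      unfolding ideal_iff_stable by auto
    then show False using J I(2) I(3)[of J] by auto
  qed
  then show ?thesis using I(2) by simp
qed

end

section \<open>Homogeneous components\<close>

definition hcomp :: "('g, 'z) ring_scheme \<Rightarrow> ('i \<Rightarrow> 'g set) \<Rightarrow> 'i \<Rightarrow> 'g \<Rightarrow> 'g" where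
  "hcomp G gr n x = (THE f. (\<forall>n. f n \<in> gr n) \<and> finite {n. f n \<noteq> \<zero>\<^bsub>G\<^esub>} \<and>
     x = (\<Oplus>\<^bsub>G\<^esub>n\<in>{n. f n \<noteq> \<zero>\<^bsub>G\<^esub>}. f n)) n"

locale graded_group = abelian_group G for G (structure) +
  fixes gr :: "'i \<Rightarrow> 'a set"
  assumes direct_sum: "internal_direct_sum G gr"
begin

lemma gr_subgroup: "subgroup (gr n) (add_monoid G)"
  using direct_sum by (simp add: internal_direct_sum_def)

lemma gr_closed: "x \<in> gr n \<Longrightarrow> x \<in> carrier G"
  using subgroup.mem_carrier[OF gr_subgroup] by simp

lemma gr_zero [simp]: "\<zero> \<in> gr n"
  using subgroup.one_closed[OF gr_subgroup[of n]] by simp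

lemma gr_add: "x \<in> gr n \<Longrightarrow> y \<in> gr n \<Longrightarrow> x \<oplus> y \<in> gr n"
  using subgroup.m_closed[OF gr_subgroup[of n]] by simp

lemma gr_inv: "x \<in> gr n \<Longrightarrow> \<ominus> x \<in> gr n"
  using subgroup.m_inv_closed[OF gr_subgroup[of n]] by (simp add: a_inv_def)

lemma hcomp_properties:
  assumes x: "x \<in> carrier G"
  shows "hcomp G gr n x \<in> gr n" "finite {n. hcomp G gr n x \<noteq> \<zero>}"
    "x = (\<Oplus>n\<in>{n. hcomp G gr n x \<noteq> \<zero>}. hcomp G gr n x)"
proof -
  let ?D = "\<lambda>f. (\<forall>n. f n \<in> gr n) \<and> finite {n. f n \<noteq> \<zero>} \<and> x = (\<Oplus>n\<in>{n. f n \<noteq> \<zero>}. f n)"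
  have "\<exists>!f. ?D f" using direct_sum x by (simp add: internal_direct_sum_def)
  then have "?D (THE f. ?D f)" by (rule theI')
  moreover have "(THE f. ?D f) = (\<lambda>n. hcomp G gr n x)" by (simp add: hcomp_def)
  ultimately have "?D (\<lambda>n. hcomp G gr n x)" by simp
  then show "hcomp G gr n x \<in> gr n" "finite {n. hcomp G gr n x \<noteq> \<zero>}"
    "x = (\<Oplus>n\<in>{n. hcomp G gr n x \<noteq> \<zero>}. hcomp G gr n x)" by simp_all
qed

lemma hcomp_closed: "x \<in> carrier G \<Longrightarrow> hcomp G gr n x \<in> carrier G"
  by (rule gr_closed[OF hcomp_properties(1)])

lemma finsum_support:
  assumes "finite F" "\<And>n. n \<notin> F \<Longrightarrow> f n = \<zero>" "\<And>n. f n \<in> carrier G"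
  shows "(\<Oplus>n\<in>{n. f n \<noteq> \<zero>}. f n) = (\<Oplus>n\<in>F. f n)"
  by (rule add.finprod_mono_neutral_cong_left) (use assms in auto)

lemma hcomp_unique:
  assumes "\<And>n. f n \<in> gr n" "finite F" "\<And>n. n \<notin> F \<Longrightarrow> f n = \<zero>" "x = (\<Oplus>n\<in>F. f n)"
  shows "hcomp G gr n x = f n"
proof -
  let ?D = "\<lambda>f. (\<forall>n. f n \<in> gr n) \<and> finite {n. f n \<noteq> \<zero>} \<and> x = (\<Oplus>n\<in>{n. f n \<noteq> \<zero>}. f n)"
  have c: "f n \<in> carrier G" for n using assms(1) gr_closed by blast
  then have x: "x \<in> carrier G" using assms(4) by simp
  have "{n. f n \<noteq> \<zero>} \<subseteq> F" using assms(3) by blast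
  then have D: "?D f" using assms finsum_support[OF assms(2,3) c] finite_subset by auto
  have "\<exists>!f. ?D f" using direct_sum x by (simp add: internal_direct_sum_def)
  from the1_equality[of ?D f, OF this D] have "(THE f. ?D f) = f" .
  then show ?thesis by (simp add: hcomp_def)
qed

lemma hcomp_add:
  assumes "x \<in> carrier G" "y \<in> carrier G"
  shows "hcomp G gr n (x \<oplus> y) = hcomp G gr n x \<oplus> hcomp G gr n y"
proof (rule hcomp_unique)
  let ?F = "{n. hcomp G gr n x \<noteq> \<zero>} \<union> {n. hcomp G gr n y \<noteq> \<zero>}"
  note X = hcomp_properties[OF assms(1)] and Y = hcomp_properties[OF assms(2)]
  show F: "finite ?F" using X(2) Y(2) by simp
  show "hcomp G gr n x \<oplus> hcomp G gr n y \<in> gr n" for n using X(1) Y(1) by (rule gr_add)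
  show "hcomp G gr n x \<oplus> hcomp G gr n y = \<zero>" if "n \<notin> ?F" for n using that by simp
  have "x = (\<Oplus>n\<in>?F. hcomp G gr n x)" "y = (\<Oplus>n\<in>?F. hcomp G gr n y)"
    using X(3) Y(3) finsum_support[OF F, of "\<lambda>n. hcomp G gr n x"]
      finsum_support[OF F, of "\<lambda>n. hcomp G gr n y"] assms hcomp_closed by auto
  then have "x \<oplus> y = (\<Oplus>n\<in>?F. hcomp G gr n x) \<oplus> (\<Oplus>n\<in>?F. hcomp G gr n y)" by simp
  then show "x \<oplus> y = (\<Oplus>n\<in>?F. hcomp G gr n x \<oplus> hcomp G gr n y)"
    using assms hcomp_closed by (simp add: finsum_addf)
qed

lemma hcomp_homogeneous:
  assumes "x \<in> gr m" shows "hcomp G gr n x = (if n = m then x else \<zero>)"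
  by (rule hcomp_unique[of _ "{m}"]) (use assms gr_closed[OF assms] in auto)

lemma hcomp_zero [simp]: "hcomp G gr n \<zero> = \<zero>"
  using hcomp_homogeneous[of \<zero> n n] by simp

lemma hcomp_inv:
  assumes "x \<in> carrier G" shows "hcomp G gr n (\<ominus> x) = \<ominus> hcomp G gr n x"
proof -
  have "hcomp G gr n (\<ominus> x) \<oplus> hcomp G gr n x = \<zero>"
    using hcomp_add[of "\<ominus> x" x n] assms by (simp add: l_neg)
  then show ?thesis using minus_equality assms hcomp_closed by simp
qed

lemma finsum_mem:
  assumes "finite F" "\<zero> \<in> U" "\<And>x y. x \<in> U \<Longrightarrow> y \<in> U \<Longrightarrow> x \<oplus> y \<in> U" "U \<subseteq> carrier G" "\<And>n. n \<in> F \<Longrightarrow> f n \<in> U"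
  shows "(\<Oplus>n\<in>F. f n) \<in> U"
  using assms(1,5)
proof (induction F rule: finite_induct)
  case empty then show ?case using assms(2) by simp
next
  case (insert n F)
  then have "f \<in> F \<rightarrow> carrier G" "f n \<in> carrier G" using assms(4) by auto
  then show ?case using insert assms(3) by simp
qed

text \<open>This also serves as an induction principle: to prove an additive property of \<open>x\<close>, take for \<open>U\<close> the set of
  all elements with the property.\<close>

lemma mem_if_hcomps:
  assumes "x \<in> carrier G" "\<zero> \<in> U" "\<And>x y. x \<in> U \<Longrightarrow> y \<in> U \<Longrightarrow> x \<oplus> y \<in> U" "U \<subseteq> carrier G"
    "\<And>n. hcomp G gr n x \<in> U"
  shows "x \<in> U"
  by (subst hcomp_properties(3)[OF assms(1)], rule finsum_mem)
     (use assms hcomp_properties(2)[OF assms(1)] in auto)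

end

section \<open>Graded modules over a standard graded algebra\<close>

definition scalars :: "('a, 'r) ring_scheme \<Rightarrow> ('a, 's, 'z) module_scheme \<Rightarrow> 's set" where
  "scalars A S = (\<lambda>a. a \<odot>\<^bsub>S\<^esub> \<one>\<^bsub>S\<^esub>) ` carrier A"

lemma generate_ring_mono: "X \<subseteq> Y \<Longrightarrow> generate_ring R X \<subseteq> generate_ring R Y"
proof
  fix x assume "X \<subseteq> Y" "x \<in> generate_ring R X"
  from this(2,1) show "x \<in> generate_ring R Y"
    by induction (auto intro: generate_ring.intros)
qed

lemma generate_ring_least: "X \<subseteq> generate_ring R Y \<Longrightarrow> generate_ring R X \<subseteq> generate_ring R Y"
proof
  fix x assume "X \<subseteq> generate_ring R Y" "x \<in> generate_ring R X"
  from this(2,1) show "x \<in> generate_ring R Y"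
    by induction (auto intro: generate_ring.intros)
qed

lemma generate_ring_finite:
  assumes "x \<in> generate_ring R (W \<union> X)"
  shows "\<exists>X'\<subseteq>X. finite X' \<and> x \<in> generate_ring R (W \<union> X')"
  using assms
proof induction
  case one then show ?case using generate_ring.one by blast
next
  case (incl h)
  then show ?case
  proof
    assume "h \<in> W"
    then show ?thesis by (intro exI[of _ "{}"]) (auto intro: generate_ring.incl)
  next
    assume "h \<in> X"
    then show ?thesis by (intro exI[of _ "{h}"]) (auto intro: generate_ring.incl)
  qed
next
  case (a_inv h) then show ?case by (meson generate_ring.a_inv)
next
  case (eng_add h1 h2)
  then obtain X1 X2 where X: "X1 \<subseteq> X" "finite X1" "h1 \<in> generate_ring R (W \<union> X1)"
    "X2 \<subseteq> X" "finite X2" "h2 \<in> generate_ring R (W \<union> X2)" by blast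
  have "h1 \<in> generate_ring R (W \<union> (X1 \<union> X2))" "h2 \<in> generate_ring R (W \<union> (X1 \<union> X2))"
    using X generate_ring_mono[of "W \<union> X1" "W \<union> (X1 \<union> X2)" R]
      generate_ring_mono[of "W \<union> X2" "W \<union> (X1 \<union> X2)" R] by auto
  then show ?case using X by (intro exI[of _ "X1 \<union> X2"]) (auto intro: generate_ring.eng_add)
next
  case (eng_mult h1 h2)
  then obtain X1 X2 where X: "X1 \<subseteq> X" "finite X1" "h1 \<in> generate_ring R (W \<union> X1)"
    "X2 \<subseteq> X" "finite X2" "h2 \<in> generate_ring R (W \<union> X2)" by blast
  have "h1 \<in> generate_ring R (W \<union> (X1 \<union> X2))" "h2 \<in> generate_ring R (W \<union> (X1 \<union> X2))"
    using X generate_ring_mono[of "W \<union> X1" "W \<union> (X1 \<union> X2)" R]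
      generate_ring_mono[of "W \<union> X2" "W \<union> (X1 \<union> X2)" R] by auto
  then show ?case using X by (intro exI[of _ "X1 \<union> X2"]) (auto intro: generate_ring.eng_mult)
qed

locale fg_graded =
  fixes A :: "('a, 'r) ring_scheme" and \<mm> and S :: "('a, 's, 'y) module_scheme"
    and grS :: "nat ^ 'd \<Rightarrow> 's set"
    and M :: "('s, 'm, 'z) module_scheme" and grM :: "nat ^ 'd \<Rightarrow> 'm set"
  assumes artinian: "artinian_local_ring A \<mm>"
    and standard: "fg_standard_graded_algebra A S grS"
    and graded_mod: "graded_module S grS M grM"
    and fin_gen: "fin_gen_module S M"
begin

sublocale module S M using graded_mod by (simp add: graded_module_def)

sublocale alg: algebra A S
  using standard by (simp add: fg_standard_graded_algebra_def graded_algebra_def)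

sublocale Sgr: graded_group S grS
  by unfold_locales (use standard in \<open>simp add: fg_standard_graded_algebra_def graded_algebra_def\<close>)

sublocale Mgr: graded_group M grM
  by unfold_locales (use graded_mod in \<open>simp add: graded_module_def\<close>)

abbreviation "\<Omega> \<equiv> scalars A S"

lemma smult_gr: "x \<in> grS m \<Longrightarrow> v \<in> grM n \<Longrightarrow> x \<odot>\<^bsub>M\<^esub> v \<in> grM (m + n)"
  using graded_mod by (simp add: graded_module_def)

lemma mult_gr: "x \<in> grS m \<Longrightarrow> y \<in> grS n \<Longrightarrow> x \<otimes>\<^bsub>S\<^esub> y \<in> grS (m + n)"
  using standard by (simp add: fg_standard_graded_algebra_def graded_algebra_def)

lemma one_gr: "\<one>\<^bsub>S\<^esub> \<in> grS 0"
  using standard by (simp add: fg_standard_graded_algebra_def graded_algebra_def)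

lemma scalars_gr: "\<omega> \<in> \<Omega> \<Longrightarrow> \<omega> \<in> grS 0"
  using standard one_gr submodule.smult_closed[of "grS 0" A S]
  by (auto simp: scalars_def fg_standard_graded_algebra_def graded_algebra_def)

lemma scalars_carrier: "\<Omega> \<subseteq> carrier S" by (auto simp: scalars_def)

lemma scalar_mult:
  assumes "a \<in> carrier A" "b \<in> carrier A"
  shows "(a \<odot>\<^bsub>S\<^esub> \<one>\<^bsub>S\<^esub>) \<otimes>\<^bsub>S\<^esub> (b \<odot>\<^bsub>S\<^esub> \<one>\<^bsub>S\<^esub>) = (a \<otimes>\<^bsub>A\<^esub> b) \<odot>\<^bsub>S\<^esub> \<one>\<^bsub>S\<^esub>"
  using assms by (simp add: alg.smult_assoc2 alg.smult_assoc1)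

text \<open>The finite set of algebra generators need not consist of elements of degree one, and the elements of degree one need
  not be finite in number; but each of the finitely many generators involves only finitely many elements of degree one.\<close>

definition gens :: "'s set" where
  "gens = (SOME Y. finite Y \<and> Y \<subseteq> (\<Union>j. grS (axis j 1)) \<and> carrier S = generate_ring S (\<Omega> \<union> Y))"

lemma gens: "finite gens" "y \<in> gens \<Longrightarrow> \<exists>j. y \<in> grS (axis j 1)" "carrier S = generate_ring S (\<Omega> \<union> gens)"
proof -
  let ?X = "\<Union>j. grS (axis j 1)"
  obtain F where F: "F \<subseteq> carrier S" "finite F" "carrier S = generate_ring S (\<Omega> \<union> F)"
    using standard by (auto simp: fg_standard_graded_algebra_def subalgebra_span_def scalars_def)
  have X: "carrier S = generate_ring S (\<Omega> \<union> ?X)"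
    using standard by (simp add: fg_standard_graded_algebra_def subalgebra_span_def scalars_def)
  have "\<exists>X'\<subseteq>?X. finite X' \<and> f \<in> generate_ring S (\<Omega> \<union> X')" if "f \<in> F" for f
    by (rule generate_ring_finite) (use that F(1) X in blast)
  then obtain h where h: "\<And>f. f \<in> F \<Longrightarrow> h f \<subseteq> ?X \<and> finite (h f) \<and> f \<in> generate_ring S (\<Omega> \<union> h f)"
    by metis
  let ?Y = "\<Union> (h ` F)"
  have "f \<in> generate_ring S (\<Omega> \<union> ?Y)" if "f \<in> F" for f
    using h[OF that] generate_ring_mono[of "\<Omega> \<union> h f" "\<Omega> \<union> ?Y" S] that by blast
  then have "\<Omega> \<union> F \<subseteq> generate_ring S (\<Omega> \<union> ?Y)" by (auto intro: generate_ring.incl)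
  then have "carrier S \<subseteq> generate_ring S (\<Omega> \<union> ?Y)" unfolding F(3) by (rule generate_ring_least)
  moreover have "generate_ring S (\<Omega> \<union> ?Y) \<subseteq> carrier S"
    using h by (subst X, intro generate_ring_mono) blast
  moreover have "finite ?Y" "?Y \<subseteq> ?X" using F(2) h by auto
  ultimately have "\<exists>Y. finite Y \<and> Y \<subseteq> ?X \<and> carrier S = generate_ring S (\<Omega> \<union> Y)" by blast
  from someI_ex[OF this, folded gens_def]
  show "finite gens" "y \<in> gens \<Longrightarrow> \<exists>j. y \<in> grS (axis j 1)" "carrier S = generate_ring S (\<Omega> \<union> gens)"
    by auto
qed

lemma gens_carrier: "gens \<subseteq> carrier S"
  using gens(2) Sgr.gr_closed by blast

lemma stable_generators:
  assumes "stable_subgroup M (gens \<union> \<Omega>) U" shows "stable_subgroup M (carrier S) U"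
proof -
  note U = stable_subgroupD[OF assms]
  have sub: "generate_ring S (\<Omega> \<union> gens) \<subseteq> carrier S" using gens(3) by simp
  have "\<forall>u\<in>U. s \<odot>\<^bsub>M\<^esub> u \<in> U" if "s \<in> generate_ring S (\<Omega> \<union> gens)" for s
    using that
  proof induction
    case one then show ?case using U(1) by simp
  next
    case (incl h) then show ?case using U(5) by blast
  next
    case (a_inv h)
    then have "h \<in> carrier S" using sub by blast
    then show ?case using a_inv U(1,4) by (simp add: smult_l_minus)
  next
    case (eng_add h1 h2)
    then have "h1 \<in> carrier S" "h2 \<in> carrier S" using sub by blast+
    then show ?case using eng_add U(1,3) by (simp add: smult_l_distr)
  next
    case (eng_mult h1 h2)
    then have "h1 \<in> carrier S" "h2 \<in> carrier S" using sub by blast+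
    then show ?case using eng_mult U(1) by (simp add: smult_assoc1)
  qed
  then show ?thesis using assms gens(3) unfolding stable_subgroup_def by blast
qed

lemma hcomp_smult:
  assumes z: "z \<in> grS m" and v: "v \<in> carrier M"
  shows "hcomp M grM (m + n) (z \<odot>\<^bsub>M\<^esub> v) = z \<odot>\<^bsub>M\<^esub> hcomp M grM n v"
    and "(\<nexists>n'. k = m + n') \<Longrightarrow> hcomp M grM k (z \<odot>\<^bsub>M\<^esub> v) = \<zero>\<^bsub>M\<^esub>"
proof -
  have zc: "z \<in> carrier S" using z by (rule Sgr.gr_closed)
  have hom: "hcomp M grM k (z \<odot>\<^bsub>M\<^esub> u) = (if k = m + l then z \<odot>\<^bsub>M\<^esub> u else \<zero>\<^bsub>M\<^esub>)"
    if "u \<in> grM l" for u l k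
    by (rule Mgr.hcomp_homogeneous[OF smult_gr[OF z that]])
  let ?U = "{v \<in> carrier M. (\<forall>n. hcomp M grM (m + n) (z \<odot>\<^bsub>M\<^esub> v) = z \<odot>\<^bsub>M\<^esub> hcomp M grM n v) \<and>
    (\<forall>k. (\<nexists>n'. k = m + n') \<longrightarrow> hcomp M grM k (z \<odot>\<^bsub>M\<^esub> v) = \<zero>\<^bsub>M\<^esub>)}"
  have "v \<in> ?U"
  proof (rule Mgr.mem_if_hcomps[OF v])
    show "\<zero>\<^bsub>M\<^esub> \<in> ?U" using zc by simp
    show "x \<oplus>\<^bsub>M\<^esub> y \<in> ?U" if "x \<in> ?U" "y \<in> ?U" for x y
      using that zc by (auto simp: smult_r_distr Mgr.hcomp_add Mgr.hcomp_closed)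
    show "hcomp M grM l v \<in> ?U" for l
    proof -
      let ?u = "hcomp M grM l v"
      have u: "?u \<in> grM l" using Mgr.hcomp_properties(1)[OF v] .
      show ?thesis
        using Mgr.gr_closed[OF u] zc by (auto simp: hom[OF u] Mgr.hcomp_homogeneous[OF u])
    qed
  qed auto
  then show "hcomp M grM (m + n) (z \<odot>\<^bsub>M\<^esub> v) = z \<odot>\<^bsub>M\<^esub> hcomp M grM n v"
    "(\<nexists>n'. k = m + n') \<Longrightarrow> hcomp M grM k (z \<odot>\<^bsub>M\<^esub> v) = \<zero>\<^bsub>M\<^esub>" by auto
qed

definition graded_sub :: "'m set \<Rightarrow> bool" where
  "graded_sub L \<longleftrightarrow> stable_subgroup M (carrier S) L \<and> (\<forall>x\<in>L. \<forall>n. hcomp M grM n x \<in> L)"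

lemma graded_subD:
  assumes "graded_sub L"
  shows "stable_subgroup M (carrier S) L" "stable_subgroup M \<Omega> L" "x \<in> L \<Longrightarrow> hcomp M grM n x \<in> L"
    "x \<in> L \<Longrightarrow> x \<in> carrier M"
proof -
  show *: "stable_subgroup M (carrier S) L" using assms by (simp add: graded_sub_def)
  show "stable_subgroup M \<Omega> L" using stable_subgroup_antimono[OF * scalars_carrier] .
  show "x \<in> L \<Longrightarrow> hcomp M grM n x \<in> L" using assms by (simp add: graded_sub_def)
  show "x \<in> L \<Longrightarrow> x \<in> carrier M" using stable_subgroupD(1)[OF *] .
qed

lemma graded_sub_zero: "graded_sub {\<zero>\<^bsub>M\<^esub>}"
  using stable_zero[OF order_refl] by (simp add: graded_sub_def)

lemma graded_sub_carrier: "graded_sub (carrier M)"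
  using stable_carrier[OF order_refl] by (simp add: graded_sub_def Mgr.hcomp_closed)

lemma graded_sub_set_add:
  assumes "graded_sub L" "graded_sub L'" shows "graded_sub (L <+>\<^bsub>M\<^esub> L')"
  unfolding graded_sub_def
proof (intro conjI ballI allI)
  show "stable_subgroup M (carrier S) (L <+>\<^bsub>M\<^esub> L')"
    by (intro stable_set_add order_refl graded_subD(1) assms)
  fix x n assume "x \<in> L <+>\<^bsub>M\<^esub> L'"
  then obtain u v where uv: "u \<in> L" "v \<in> L'" "x = u \<oplus>\<^bsub>M\<^esub> v" by (rule set_addE)
  then show "hcomp M grM n x \<in> L <+>\<^bsub>M\<^esub> L'"
    using graded_subD(3,4)[OF assms(1)] graded_subD(3,4)[OF assms(2)]
    by (simp add: Mgr.hcomp_add set_addI)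
qed

lemma graded_sub_scaled:
  assumes "graded_sub L" "z \<in> grS m" shows "graded_sub ((\<lambda>v. z \<odot>\<^bsub>M\<^esub> v) ` L)"
  unfolding graded_sub_def
proof (intro conjI ballI allI)
  have z: "z \<in> carrier S" using assms(2) by (rule Sgr.gr_closed)
  show "stable_subgroup M (carrier S) ((\<lambda>v. z \<odot>\<^bsub>M\<^esub> v) ` L)"
    by (intro stable_scaled order_refl graded_subD(1) assms z)
  fix x n assume "x \<in> (\<lambda>v. z \<odot>\<^bsub>M\<^esub> v) ` L"
  then obtain v where v: "v \<in> L" "x = z \<odot>\<^bsub>M\<^esub> v" by blast
  have vc: "v \<in> carrier M" using graded_subD(4)[OF assms(1) v(1)] .
  show "hcomp M grM n x \<in> (\<lambda>v. z \<odot>\<^bsub>M\<^esub> v) ` L"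
  proof (cases "\<exists>n'. n = m + n'")
    case True
    then obtain n' where "n = m + n'" ..
    then show ?thesis
      using hcomp_smult(1)[OF assms(2) vc, of n'] graded_subD(3)[OF assms(1) v(1), of n'] v(2) by simp
  next
    case False
    then have "hcomp M grM n x = z \<odot>\<^bsub>M\<^esub> \<zero>\<^bsub>M\<^esub>"
      using hcomp_smult(2)[OF assms(2) vc] v(2) z by simp
    moreover have "\<zero>\<^bsub>M\<^esub> \<in> L" by (rule stable_subgroupD(2)[OF graded_subD(1)[OF assms(1)]])
    ultimately show ?thesis by blast
  qed
qed

lemma graded_sub_colon:
  assumes "graded_sub L" "graded_sub L'" "z \<in> grS m" shows "graded_sub {v \<in> L'. z \<odot>\<^bsub>M\<^esub> v \<in> L}"
  unfolding graded_sub_def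
proof (intro conjI ballI allI)
  have z: "z \<in> carrier S" using assms(3) by (rule Sgr.gr_closed)
  show "stable_subgroup M (carrier S) {v \<in> L'. z \<odot>\<^bsub>M\<^esub> v \<in> L}"
    by (intro stable_preimage order_refl graded_subD(1) assms z)
  fix x n assume x: "x \<in> {v \<in> L'. z \<odot>\<^bsub>M\<^esub> v \<in> L}"
  have xc: "x \<in> carrier M" using graded_subD(4)[OF assms(2)] x by blast
  show "hcomp M grM n x \<in> {v \<in> L'. z \<odot>\<^bsub>M\<^esub> v \<in> L}"
    using graded_subD(3)[OF assms(2), of x n] graded_subD(3)[OF assms(1), of "z \<odot>\<^bsub>M\<^esub> x" "m + n"] x
      hcomp_smult(1)[OF assms(3) xc, of n] by simp
qed

lemma graded_sub_le:
  assumes "graded_sub L" "graded_sub L'" "\<And>n. L \<inter> grM n \<subseteq> L'" shows "L \<subseteq> L'"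
proof
  fix x assume x: "x \<in> L"
  note D = stable_subgroupD[OF graded_subD(1)[OF assms(2)]]
  show "x \<in> L'"
  proof (rule Mgr.mem_if_hcomps)
    show xc: "x \<in> carrier M" using graded_subD(4)[OF assms(1) x] .
    show "hcomp M grM n x \<in> L'" for n
      using graded_subD(3)[OF assms(1) x, of n] Mgr.hcomp_properties(1)[OF xc, of n] assms(3)[of n] by blast
    show "L' \<subseteq> carrier M" using D(1) by blast
  qed (use D(2,3) in simp_all)
qed

lemma stable_gr: "stable_subgroup M \<Omega> (grM n)"
  unfolding stable_subgroup_def
proof (intro conjI ballI subsetI)
  show "a \<odot>\<^bsub>M\<^esub> x \<in> grM n" if "a \<in> \<Omega>" "x \<in> grM n" for a x
    using smult_gr[OF scalars_gr[OF that(1)] that(2)] by simp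
qed (use Mgr.gr_closed Mgr.gr_add Mgr.gr_inv in simp_all)

text \<open>Length over \<open>A\<close>.\<close>

abbreviation "alen \<equiv> chain_length (stable_subgroup M \<Omega>)"

text \<open>Submodules of \<open>Ag\<close> correspond to ideals of \<open>A\<close>.\<close>

lemma cyclic_finite_length:
  assumes g: "g \<in> carrier M"
  defines "U \<equiv> (\<lambda>\<omega>. \<omega> \<odot>\<^bsub>M\<^esub> g) ` \<Omega>"
  shows "stable_subgroup M \<Omega> U" "g \<in> U" "alen {\<zero>\<^bsub>M\<^esub>} U \<noteq> \<infinity>"
proof -
  interpret A: artinian_local_ring A \<mm> by (rule artinian)
  interpret reg: module A "regular_module A" by (rule alg.R.regular_module_is_module)
  let ?f = "\<lambda>a. (a \<odot>\<^bsub>S\<^esub> \<one>\<^bsub>S\<^esub>) \<odot>\<^bsub>M\<^esub> g"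
  have U: "U = ?f ` carrier A" by (auto simp: U_def scalars_def)
  have f: "?f a \<in> carrier M" "?f (a \<oplus>\<^bsub>A\<^esub> b) = ?f a \<oplus>\<^bsub>M\<^esub> ?f b" "?f (\<ominus>\<^bsub>A\<^esub> a) = \<ominus>\<^bsub>M\<^esub> ?f a"
    "?f (a \<otimes>\<^bsub>A\<^esub> b) = (a \<odot>\<^bsub>S\<^esub> \<one>\<^bsub>S\<^esub>) \<odot>\<^bsub>M\<^esub> ?f b" "?f \<zero>\<^bsub>A\<^esub> = \<zero>\<^bsub>M\<^esub>"
    if "a \<in> carrier A" "b \<in> carrier A" for a b
    using that g by (simp_all add: alg.smult_l_distr smult_l_distr alg.smult_l_minus smult_l_minus
        flip: scalar_mult smult_assoc1)
  note f0 = f(5)[OF alg.R.zero_closed alg.R.zero_closed]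
  show "g \<in> U" unfolding U using g by (intro image_eqI[of _ _ "\<one>\<^bsub>A\<^esub>"]) auto
  show "stable_subgroup M \<Omega> U"
    unfolding stable_subgroup_def U
  proof (intro conjI ballI subsetI; (elim imageE)?)
    show "\<zero>\<^bsub>M\<^esub> \<in> ?f ` carrier A" using f0 by (intro image_eqI[of _ _ "\<zero>\<^bsub>A\<^esub>"]) auto
    show "x \<in> carrier M" if "x = ?f a" "a \<in> carrier A" for x a using that f(1) by simp
    show "x \<oplus>\<^bsub>M\<^esub> y \<in> ?f ` carrier A"
      if "x = ?f a" "a \<in> carrier A" "y = ?f b" "b \<in> carrier A" for x y a b
      using that f(2) by (intro image_eqI[of _ _ "a \<oplus>\<^bsub>A\<^esub> b"]) auto
    show "\<ominus>\<^bsub>M\<^esub> x \<in> ?f ` carrier A" if "x = ?f a" "a \<in> carrier A" for x a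
      using that f(3) by (intro image_eqI[of _ _ "\<ominus>\<^bsub>A\<^esub> a"]) auto
    show "\<omega> \<odot>\<^bsub>M\<^esub> x \<in> ?f ` carrier A" if w: "\<omega> \<in> \<Omega>" and "x = ?f a" "a \<in> carrier A" for \<omega> x a
    proof -
      obtain b where b: "b \<in> carrier A" "\<omega> = b \<odot>\<^bsub>S\<^esub> \<one>\<^bsub>S\<^esub>"
        using w unfolding scalars_def by blast
      show ?thesis
      proof (rule image_eqI[of _ _ "b \<otimes>\<^bsub>A\<^esub> a"])
        show "\<omega> \<odot>\<^bsub>M\<^esub> x = ?f (b \<otimes>\<^bsub>A\<^esub> a)" unfolding that(2) b(2) using f(4)[OF b(1) that(3)] by (rule sym)
        show "b \<otimes>\<^bsub>A\<^esub> a \<in> carrier A" using b(1) that(3) by simp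
      qed
    qed
  qed
  let ?F = "\<lambda>X. {a \<in> carrier A. ?f a \<in> X}"
  have "alen {\<zero>\<^bsub>M\<^esub>} U \<le> chain_length (\<lambda>I. ideal I A) (?F {\<zero>\<^bsub>M\<^esub>}) (carrier A)"
  proof (rule chain_length_transport)
    show "ideal (?F X) A" if "stable_subgroup M \<Omega> X" for X
    proof -
      note X = stable_subgroupD[OF that]
      show ?thesis
        unfolding alg.R.ideal_iff_stable stable_subgroup_def
      proof (intro conjI ballI subsetI)
        show "\<zero>\<^bsub>regular_module A\<^esub> \<in> ?F X" using X(2) f0 by simp
        show "x \<oplus>\<^bsub>regular_module A\<^esub> y \<in> ?F X" if "x \<in> ?F X" "y \<in> ?F X" for x y
          using that X(3)[of "?f x" "?f y"] f(2)[of x y] by simp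
        show "\<ominus>\<^bsub>regular_module A\<^esub> x \<in> ?F X" if "x \<in> ?F X" for x
          using that X(4)[of "?f x"] f(3)[of x x] by simp
        show "a \<odot>\<^bsub>regular_module A\<^esub> x \<in> ?F X" if "a \<in> carrier A" "x \<in> ?F X" for a x
        proof -
          have "a \<odot>\<^bsub>S\<^esub> \<one>\<^bsub>S\<^esub> \<in> \<Omega>" using that(1) by (simp add: scalars_def)
          then show ?thesis using that X(5)[of "a \<odot>\<^bsub>S\<^esub> \<one>\<^bsub>S\<^esub>" "?f x"] f(4)[of a x] by simp
        qed
      qed simp
    qed
    show "?F X \<subset> ?F Y" if "X \<subset> Y" "Y \<subseteq> U" for X Y
      using that unfolding U by blast
    show "?F U = carrier A" unfolding U by blast
  qed simp
  also have "\<dots> \<le> chain_length (\<lambda>I. ideal I A) {\<zero>\<^bsub>A\<^esub>} (carrier A)"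
    using alg.R.zeroideal f0 by (intro chain_length_antimono) auto
  finally show "alen {\<zero>\<^bsub>M\<^esub>} U \<noteq> \<infinity>" using A.finite_length by (auto dest: enat_ile)
qed

text \<open>For arbitrary sets, so that unions can take the place of sums of groups.\<close>

definition finite_alen :: "'m set \<Rightarrow> bool" where
  "finite_alen X \<longleftrightarrow> (\<exists>W. stable_subgroup M \<Omega> W \<and> X \<subseteq> W \<and> alen {\<zero>\<^bsub>M\<^esub>} W \<noteq> \<infinity>)"

lemma stable_zero_least: "stable_subgroup M \<Omega>' X \<Longrightarrow> {\<zero>\<^bsub>M\<^esub>} \<subseteq> X"
  using stable_subgroupD(2) by blast

lemma alen_set_add_finite:
  assumes "stable_subgroup M \<Omega> U" "alen {\<zero>\<^bsub>M\<^esub>} U \<noteq> \<infinity>" "stable_subgroup M \<Omega> V" "alen {\<zero>\<^bsub>M\<^esub>} V \<noteq> \<infinity>"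
  shows "alen {\<zero>\<^bsub>M\<^esub>} (U <+>\<^bsub>M\<^esub> V) \<noteq> \<infinity>"
proof -
  have zero: "stable_subgroup M \<Omega> {\<zero>\<^bsub>M\<^esub>}" using stable_zero[OF scalars_carrier] .
  have UV: "stable_subgroup M \<Omega> (U <+>\<^bsub>M\<^esub> V)" using stable_set_add[OF scalars_carrier assms(1,3)] .
  have "alen {\<zero>\<^bsub>M\<^esub>} (U <+>\<^bsub>M\<^esub> V) = alen {\<zero>\<^bsub>M\<^esub>} U + alen U (U <+>\<^bsub>M\<^esub> V)"
    using set_add_upper(1)[OF assms(1,3)] stable_zero_least[OF assms(1)]
    by (intro chain_length_add scalars_carrier zero assms UV)
  also have "alen U (U <+>\<^bsub>M\<^esub> V) = alen (U \<inter> V) V"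
    by (rule chain_length_set_add[OF scalars_carrier assms(1,3)])
  also have "alen (U \<inter> V) V \<le> alen {\<zero>\<^bsub>M\<^esub>} V"
    using zero stable_zero_least[OF stable_subgroup_Int[OF assms(1,3)]] by (rule chain_length_antimono)
  finally show ?thesis using assms(2,4) by (auto simp: add_mono dest: enat_ile)
qed

lemma finite_alen_Un:
  assumes "finite_alen X" "finite_alen Y" shows "finite_alen (X \<union> Y)"
proof -
  obtain W W' where W: "stable_subgroup M \<Omega> W" "X \<subseteq> W" "alen {\<zero>\<^bsub>M\<^esub>} W \<noteq> \<infinity>"
    "stable_subgroup M \<Omega> W'" "Y \<subseteq> W'" "alen {\<zero>\<^bsub>M\<^esub>} W' \<noteq> \<infinity>"
    using assms unfolding finite_alen_def by blast
  then show ?thesis unfolding finite_alen_def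
    using set_add_upper[OF W(1,4)] alen_set_add_finite[OF W(1,3,4,6)]
      stable_set_add[OF scalars_carrier W(1,4)]
    by (intro exI[of _ "W <+>\<^bsub>M\<^esub> W'"]) blast
qed

lemma finite_alen_UN:
  "finite I \<Longrightarrow> (\<And>i. i \<in> I \<Longrightarrow> finite_alen (X i)) \<Longrightarrow> finite_alen (\<Union>i\<in>I. X i)"
proof (induction I rule: finite_induct)
  case empty
  show ?case unfolding finite_alen_def
    using stable_zero[OF scalars_carrier] chain_length_self[of "stable_subgroup M \<Omega>" "{\<zero>\<^bsub>M\<^esub>}"]
    by (intro exI[of _ "{\<zero>\<^bsub>M\<^esub>}"]) auto
next
  case (insert i I) then show ?case using finite_alen_Un[of "X i"] by auto
qed

lemma finite_alen_scaled:
  assumes "finite_alen X" "z \<in> carrier S" shows "finite_alen ((\<lambda>v. z \<odot>\<^bsub>M\<^esub> v) ` X)"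
proof -
  obtain W where W: "stable_subgroup M \<Omega> W" "X \<subseteq> W" "alen {\<zero>\<^bsub>M\<^esub>} W \<noteq> \<infinity>"
    using assms unfolding finite_alen_def by blast
  have zero: "stable_subgroup M \<Omega> {\<zero>\<^bsub>M\<^esub>}" using stable_zero[OF scalars_carrier] .
  let ?zW = "(\<lambda>v. z \<odot>\<^bsub>M\<^esub> v) ` W"
  have zW: "stable_subgroup M \<Omega> ?zW" by (rule stable_scaled[OF scalars_carrier W(1) assms(2)])
  have "{\<zero>\<^bsub>M\<^esub>} <+>\<^bsub>M\<^esub> ?zW = ?zW"
    using set_add_upper(2)[OF zero zW] set_add_least[OF zW stable_zero_least[OF zW]] by blast
  then have "alen {\<zero>\<^bsub>M\<^esub>} ?zW = alen {v \<in> W. z \<odot>\<^bsub>M\<^esub> v \<in> {\<zero>\<^bsub>M\<^esub>}} W"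
    using chain_length_scaled[OF scalars_carrier zero W(1) assms(2)] by simp
  also have "\<dots> \<le> alen {\<zero>\<^bsub>M\<^esub>} W"
    using zero stable_zero_least[OF stable_preimage[OF scalars_carrier W(1) zero assms(2)]]
    by (rule chain_length_antimono)
  finally have "alen {\<zero>\<^bsub>M\<^esub>} ?zW \<noteq> \<infinity>" using W(3) by (auto dest: enat_ile)
  then show ?thesis unfolding finite_alen_def using zW W(2) by (intro exI[of _ ?zW]) auto
qed

text \<open>The \<open>A\<close>-span of the homogeneous components of finitely many generators.  The chain condition for \<open>M\<close> results
  from adjoining the generators of \<open>S\<close> to it, the finite length of the components of \<open>M\<close> from an induction that starts with it.\<close>

lemma finite_generating_group:
  obtains U where "stable_subgroup M \<Omega> U" "alen {\<zero>\<^bsub>M\<^esub>} U \<noteq> \<infinity>" "\<And>x n. x \<in> U \<Longrightarrow> hcomp M grM n x \<in> U"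
    "\<And>N. stable_subgroup M (carrier S) N \<Longrightarrow> U \<subseteq> N \<Longrightarrow> N = carrier M"
proof -
  obtain F where F: "F \<subseteq> carrier M" "finite F" "carrier M = module_span S M F"
    using fin_gen unfolding fin_gen_module_def by blast
  define G where "G = (\<Union>f\<in>F. (\<lambda>n. hcomp M grM n f) ` {n. hcomp M grM n f \<noteq> \<zero>\<^bsub>M\<^esub>})"
  have G: "finite G" unfolding G_def using F Mgr.hcomp_properties(2) by auto
  have hom: "\<exists>n. g \<in> grM n" if "g \<in> G" for g
    using that F(1) Mgr.hcomp_properties(1) unfolding G_def by blast
  have "\<exists>U. stable_subgroup M \<Omega> U \<and> alen {\<zero>\<^bsub>M\<^esub>} U \<noteq> \<infinity> \<and> (\<forall>x\<in>U. \<forall>n. hcomp M grM n x \<in> U) \<and> G \<subseteq> U"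
    using G hom
  proof (induction G rule: finite_induct)
    case empty
    show ?case using stable_zero[OF scalars_carrier] chain_length_self[of "stable_subgroup M \<Omega>" "{\<zero>\<^bsub>M\<^esub>}"]
      by (intro exI[of _ "{\<zero>\<^bsub>M\<^esub>}"]) auto
  next
    case (insert g G)
    then obtain U where U: "stable_subgroup M \<Omega> U" "alen {\<zero>\<^bsub>M\<^esub>} U \<noteq> \<infinity>"
      "\<forall>x\<in>U. \<forall>n. hcomp M grM n x \<in> U" "G \<subseteq> U" by auto
    obtain n where g: "g \<in> grM n" using insert.prems by auto
    let ?V = "(\<lambda>\<omega>. \<omega> \<odot>\<^bsub>M\<^esub> g) ` \<Omega>"
    note V = cyclic_finite_length[OF Mgr.gr_closed[OF g]]
    have "?V \<subseteq> grM n" using smult_gr[OF scalars_gr g] by auto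
    then have hV: "hcomp M grM l v \<in> ?V" if "v \<in> ?V" for l v
      using Mgr.hcomp_homogeneous[of v n l] that stable_subgroupD(2)[OF V(1)] by auto
    have "hcomp M grM l x \<in> U <+>\<^bsub>M\<^esub> ?V" if x: "x \<in> U <+>\<^bsub>M\<^esub> ?V" for l x
    proof -
      obtain u v where uv: "u \<in> U" "v \<in> ?V" "x = u \<oplus>\<^bsub>M\<^esub> v" using x by (rule set_addE)
      have "hcomp M grM l x = hcomp M grM l u \<oplus>\<^bsub>M\<^esub> hcomp M grM l v"
        using uv stable_subgroupD(1)[OF U(1) uv(1)] stable_subgroupD(1)[OF V(1) uv(2)]
        by (simp only: Mgr.hcomp_add)
      then show ?thesis using U(3) uv(1) hV[OF uv(2)] set_addI[of "hcomp M grM l u" U _ ?V M] by simp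
    qed
    then show ?case
      using stable_set_add[OF scalars_carrier U(1) V(1)] alen_set_add_finite[OF U(1,2) V(1,3)]
        set_add_upper[OF U(1) V(1)] U(4) V(2)
      by (intro exI[of _ "U <+>\<^bsub>M\<^esub> ?V"]) blast
  qed
  then obtain U where U: "stable_subgroup M \<Omega> U" "alen {\<zero>\<^bsub>M\<^esub>} U \<noteq> \<infinity>"
    "\<forall>x\<in>U. \<forall>n. hcomp M grM n x \<in> U" "G \<subseteq> U" by blast
  have FU: "F \<subseteq> U"
  proof
    fix f assume f: "f \<in> F"
    have h: "hcomp M grM n f \<in> U" for n
      using U(4) f stable_subgroupD(2)[OF U(1)] unfolding G_def by (cases "hcomp M grM n f = \<zero>\<^bsub>M\<^esub>") auto
    show "f \<in> U"
    proof (rule Mgr.mem_if_hcomps)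
      show "f \<in> carrier M" using f F(1) by blast
      show "U \<subseteq> carrier M" using stable_subgroupD(1)[OF U(1)] by blast
    qed (use h stable_subgroupD(2,3)[OF U(1)] in simp_all)
  qed
  show ?thesis
  proof (rule that[OF U(1,2)])
    show "hcomp M grM n x \<in> U" if "x \<in> U" for x n using U(3) that by blast
    show "N = carrier M" if N: "stable_subgroup M (carrier S) N" "U \<subseteq> N" for N
    proof
      show "N \<subseteq> carrier M" using stable_subgroupD(1)[OF N(1)] by blast
      show "carrier M \<subseteq> N"
        unfolding F(3) module_span_def
      proof (rule Inter_lower, rule CollectI, intro conjI)
        show "submodule N S M" using N(1) by (simp add: submodule_iff_stable)
        show "F \<subseteq> N" using FU N(2) by (rule order_trans)
      qed
    qed
  qed
qed

theorem noetherian: "noetherian_below graded_sub (carrier M)"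
proof -
  obtain U where U: "stable_subgroup M \<Omega> U" "alen {\<zero>\<^bsub>M\<^esub>} U \<noteq> \<infinity>"
    "\<And>N. stable_subgroup M (carrier S) N \<Longrightarrow> U \<subseteq> N \<Longrightarrow> N = carrier M"
    by (rule finite_generating_group) (rule that)
  have "noetherian_below (stable_subgroup M \<Omega>) U"
    by (rule finite_length_noetherian[OF U(2) stable_zero[OF scalars_carrier] U(1) stable_zero_least])
  from noetherian_finite_adjoin[OF gens(1) gens_carrier scalars_carrier U(1) this]
  obtain V where V: "stable_subgroup M (gens \<union> \<Omega>) V" "U \<subseteq> V"
    "noetherian_below (stable_subgroup M (gens \<union> \<Omega>)) V" by blast
  have VM: "V = carrier M" by (rule U(3)[OF stable_generators[OF V(1)] V(2)])
  have P: "stable_subgroup M (gens \<union> \<Omega>) L" if "graded_sub L" for L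
    using stable_subgroup_antimono[OF graded_subD(1)[OF that]] gens_carrier scalars_carrier by simp
  show ?thesis
    using V(3) P unfolding VM by (rule noetherian_below_antimono)
qed

text \<open>Every element of \<open>M\<^sub>n\<close> is the sum of an element of the generating group and of elements of \<open>y M\<^sub>n\<^sub>-\<^sub>e\<close>, where
  \<open>y\<close> runs over the generators of \<open>S\<close> and \<open>e\<close> is the degree of \<open>y\<close>.  Hence induction on the total degree of \<open>n\<close>.\<close>

lemma gr_finite_length: "alen {\<zero>\<^bsub>M\<^esub>} (grM n) \<noteq> \<infinity>"
proof -
  obtain U where U: "stable_subgroup M \<Omega> U" "alen {\<zero>\<^bsub>M\<^esub>} U \<noteq> \<infinity>" "\<And>x n. x \<in> U \<Longrightarrow> hcomp M grM n x \<in> U"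
    "\<And>N. stable_subgroup M (carrier S) N \<Longrightarrow> U \<subseteq> N \<Longrightarrow> N = carrier M"
    by (rule finite_generating_group) (rule that)
  have "finite_alen (grM n)"
  proof (induction "\<Sum>i\<in>UNIV. n $ i" arbitrary: n rule: less_induct)
    case less
    \<comment> \<open>The image of \<open>M\<^sub>n\<^sub>-\<^sub>e\<close> under \<open>y\<close>, for \<open>y\<close> of degree \<open>e = \<bold>e\<^sub>j\<close>; it is empty if \<open>n - e\<close> has a negative component.\<close>
    let ?X = "\<lambda>(y, j). if y \<in> grS (axis j 1) \<and> (\<exists>n'. n = axis j 1 + n')
      then (\<lambda>v. y \<odot>\<^bsub>M\<^esub> v) ` grM (THE n'. n = axis j 1 + n') else {}"
    have "finite_alen (\<Union>p\<in>gens \<times> UNIV. ?X p)"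
    proof (rule finite_alen_UN)
      show "finite (gens \<times> (UNIV :: 'd set))" using gens(1) by simp
      fix p :: "'s \<times> 'd" assume "p \<in> gens \<times> UNIV"
      then obtain y j where p: "p = (y, j)" "y \<in> gens" by auto
      show "finite_alen (?X p)"
      proof (cases "y \<in> grS (axis j 1) \<and> (\<exists>n'. n = axis j 1 + n')")
        case True
        then obtain n' where n': "n = axis j 1 + n'" by blast
        then have "(THE n'. n = axis j 1 + n') = n'" by simp
        moreover have "(\<Sum>i\<in>UNIV. n' $ i) < (\<Sum>i\<in>UNIV. n $ i)"
          by (simp add: n' sum.distrib axis_def)
        then have "finite_alen (grM n')" by (rule less)
        ultimately show ?thesis
          using True p gens_carrier finite_alen_scaled by auto
      next
        case False
        then show ?thesis using finite_alen_UN[of "{}"] p by auto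
      qed
    qed
    moreover have "finite_alen U" unfolding finite_alen_def using U(1,2) by blast
    ultimately have "finite_alen (U \<union> (\<Union>p\<in>gens \<times> UNIV. ?X p))" by (intro finite_alen_Un)
    then obtain W where W: "stable_subgroup M \<Omega> W" "U \<subseteq> W" "\<And>p. p \<in> gens \<times> UNIV \<Longrightarrow> ?X p \<subseteq> W"
      "alen {\<zero>\<^bsub>M\<^esub>} W \<noteq> \<infinity>" unfolding finite_alen_def by (auto simp: UN_subset_iff)
    note WD = stable_subgroupD[OF W(1)]
    let ?N = "{x \<in> carrier M. hcomp M grM n x \<in> W}"
    have "stable_subgroup M (gens \<union> \<Omega>) ?N"
      unfolding stable_subgroup_def
    proof (intro conjI ballI)
      show "x \<oplus>\<^bsub>M\<^esub> y \<in> ?N" if "x \<in> ?N" "y \<in> ?N" for x y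
        using that WD(3) by (simp add: Mgr.hcomp_add)
      show "\<ominus>\<^bsub>M\<^esub> x \<in> ?N" if "x \<in> ?N" for x using that WD(4) by (simp add: Mgr.hcomp_inv)
      fix a x assume a: "a \<in> gens \<union> \<Omega>" and x: "x \<in> ?N"
      have xc: "x \<in> carrier M" using x by simp
      have ac: "a \<in> carrier S" using a gens_carrier scalars_carrier by blast
      have "hcomp M grM n (a \<odot>\<^bsub>M\<^esub> x) \<in> W"
      proof (cases "a \<in> \<Omega>")
        case True
        then show ?thesis
          using hcomp_smult(1)[OF scalars_gr[OF True] xc, of n] WD(5)[OF True] x by simp
      next
        case False
        then have ag: "a \<in> gens" using a by blast
        obtain j where j: "a \<in> grS (axis j 1)" using gens(2)[OF ag] by blast
        show ?thesis
        proof (cases "\<exists>n'. n = axis j 1 + n'")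
          case True
          then obtain n' where n': "n = axis j 1 + n'" by blast
          then have the: "(THE n'. n = axis j 1 + n') = n'" by simp
          have "a \<odot>\<^bsub>M\<^esub> hcomp M grM n' x \<in> ?X (a, j)"
            using j True Mgr.hcomp_properties(1)[OF xc] by (simp add: the)
          then show ?thesis
            using W(3)[of "(a, j)"] ag hcomp_smult(1)[OF j xc, of n'] n' by auto
        next
          case False
          then show ?thesis using hcomp_smult(2)[OF j xc] WD(2) by simp
        qed
      qed
      then show "a \<odot>\<^bsub>M\<^esub> x \<in> ?N" using ac xc by simp
    qed (use WD(2) in auto)
    then have N: "?N = carrier M"
      using U(3) W(2) stable_subgroupD(1)[OF U(1)] by (intro U(4) stable_generators) blast+
    have "x \<in> W" if x: "x \<in> grM n" for x
    proof -
      have "x \<in> ?N" using Mgr.gr_closed[OF x] N by blast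
      then show ?thesis using Mgr.hcomp_homogeneous[OF x, of n] by simp
    qed
    then have "grM n \<subseteq> W" ..
    then show ?case unfolding finite_alen_def using W by blast
  qed
  then obtain W where W: "stable_subgroup M \<Omega> W" "grM n \<subseteq> W" "alen {\<zero>\<^bsub>M\<^esub>} W \<noteq> \<infinity>"
    unfolding finite_alen_def by blast
  then have "alen {\<zero>\<^bsub>M\<^esub>} (grM n) \<le> alen {\<zero>\<^bsub>M\<^esub>} W" by (intro chain_length_mono stable_gr)
  then show ?thesis using W(3) by (auto dest: enat_ile)
qed

end

section \<open>Hilbert polynomials of subquotients\<close>

context fg_graded
begin

definition hilb :: "'m set \<Rightarrow> 'm set \<Rightarrow> nat ^ 'd \<Rightarrow> int" where
  "hilb L L' n = int (the_enat (alen (L \<inter> grM n) (L' \<inter> grM n)))"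

lemma stable_section: "graded_sub L \<Longrightarrow> stable_subgroup M \<Omega> (L \<inter> grM n)"
  by (intro stable_subgroup_Int graded_subD(2) stable_gr)

lemma section_finite_length:
  assumes "graded_sub L" "graded_sub L'" shows "alen (L \<inter> grM n) (L' \<inter> grM n) \<noteq> \<infinity>"
proof -
  have "alen (L \<inter> grM n) (L' \<inter> grM n) \<le> alen {\<zero>\<^bsub>M\<^esub>} (L' \<inter> grM n)"
    by (rule chain_length_antimono[of "stable_subgroup M \<Omega>", OF stable_zero[OF scalars_carrier]
          stable_zero_least[OF stable_section[OF assms(1)]]])
  also have "\<dots> \<le> alen {\<zero>\<^bsub>M\<^esub>} (grM n)"
    by (rule chain_length_mono[of "stable_subgroup M \<Omega>", OF stable_section[OF assms(2)] stable_gr]) blast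
  finally show ?thesis using gr_finite_length[of n] by (auto dest: enat_ile)
qed

lemma hilb_add:
  assumes "graded_sub L" "graded_sub L'" "graded_sub L''" "L \<subseteq> L'" "L' \<subseteq> L''"
  shows "hilb L L'' n = hilb L L' n + hilb L' L'' n"
proof -
  have "alen (L \<inter> grM n) (L'' \<inter> grM n) = alen (L \<inter> grM n) (L' \<inter> grM n) + alen (L' \<inter> grM n) (L'' \<inter> grM n)"
    using assms by (intro chain_length_add scalars_carrier stable_section) auto
  moreover obtain a b where "alen (L \<inter> grM n) (L' \<inter> grM n) = enat a"
    "alen (L' \<inter> grM n) (L'' \<inter> grM n) = enat b"
    using section_finite_length[OF assms(1,2)] section_finite_length[OF assms(2,3)] by blast
  ultimately show ?thesis by (simp add: hilb_def)
qed

lemma hilb_zero: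
  assumes "L \<subseteq> L'" "L' \<inter> grM n \<subseteq> L" shows "hilb L L' n = 0"
proof -
  have "L' \<inter> grM n = L \<inter> grM n" using assms by blast
  then show ?thesis by (simp add: hilb_def chain_length_self zero_enat_def)
qed

lemma hilb_self: "hilb L L n = 0" by (rule hilb_zero) auto

lemma hilb_scaled:
  assumes L: "graded_sub L" "graded_sub L'" and z: "z \<in> grS m"
  shows "hilb {v \<in> L'. z \<odot>\<^bsub>M\<^esub> v \<in> L} L' n = hilb L (L <+>\<^bsub>M\<^esub> ((\<lambda>v. z \<odot>\<^bsub>M\<^esub> v) ` L')) (m + n)"
proof -
  have zc: "z \<in> carrier S" using z by (rule Sgr.gr_closed)
  let ?z = "\<lambda>v. z \<odot>\<^bsub>M\<^esub> v"
  have "(L <+>\<^bsub>M\<^esub> (?z ` L')) \<inter> grM (m + n) = (L \<inter> grM (m + n)) <+>\<^bsub>M\<^esub> (?z ` (L' \<inter> grM n))"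
  proof (intro equalityI subsetI)
    fix x assume x: "x \<in> (L <+>\<^bsub>M\<^esub> (?z ` L')) \<inter> grM (m + n)"
    then obtain l v where lv: "l \<in> L" "v \<in> L'" "x = l \<oplus>\<^bsub>M\<^esub> z \<odot>\<^bsub>M\<^esub> v" by (auto elim!: set_addE)
    have c: "l \<in> carrier M" "v \<in> carrier M"
      using graded_subD(4)[OF L(1) lv(1)] graded_subD(4)[OF L(2) lv(2)] .
    have "x = hcomp M grM (m + n) x" using x Mgr.hcomp_homogeneous[of x "m + n" "m + n"] by simp
    also have "\<dots> = hcomp M grM (m + n) l \<oplus>\<^bsub>M\<^esub> z \<odot>\<^bsub>M\<^esub> hcomp M grM n v"
      using c zc hcomp_smult(1)[OF z c(2)] by (simp add: lv(3) Mgr.hcomp_add)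
    also have "\<dots> \<in> (L \<inter> grM (m + n)) <+>\<^bsub>M\<^esub> (?z ` (L' \<inter> grM n))"
      using graded_subD(3)[OF L(1) lv(1)] graded_subD(3)[OF L(2) lv(2)]
        Mgr.hcomp_properties(1)[OF c(1)] Mgr.hcomp_properties(1)[OF c(2)] by (intro set_addI) auto
    finally show "x \<in> (L \<inter> grM (m + n)) <+>\<^bsub>M\<^esub> (?z ` (L' \<inter> grM n))" .
  next
    fix x assume "x \<in> (L \<inter> grM (m + n)) <+>\<^bsub>M\<^esub> (?z ` (L' \<inter> grM n))"
    then obtain l v where lv: "l \<in> L" "l \<in> grM (m + n)" "v \<in> L'" "v \<in> grM n" "x = l \<oplus>\<^bsub>M\<^esub> z \<odot>\<^bsub>M\<^esub> v"
      by (auto elim!: set_addE)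
    then show "x \<in> (L <+>\<^bsub>M\<^esub> (?z ` L')) \<inter> grM (m + n)"
      using Mgr.gr_add[OF lv(2) smult_gr[OF z lv(4)]] by (auto intro: set_addI)
  qed
  moreover have "{v \<in> L'. z \<odot>\<^bsub>M\<^esub> v \<in> L} \<inter> grM n = {v \<in> L' \<inter> grM n. z \<odot>\<^bsub>M\<^esub> v \<in> L \<inter> grM (m + n)}"
    using smult_gr[OF z] by auto
  ultimately show ?thesis
    unfolding hilb_def
    by (simp only: chain_length_scaled[OF scalars_carrier stable_section[OF L(1)] stable_section[OF L(2)] zc])
qed

text \<open>The lengths in the exact sequence
  \<open>0 \<rightarrow> ((L : z) \<inter> L')/L \<rightarrow> L'/L \<rightarrow> L'/L \<rightarrow> L'/(L + zL') \<rightarrow> 0\<close>, whose middle map is multiplication by \<open>z\<close> and raises degrees by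
  \<open>\<bold>e\<^sub>j\<close>.\<close>

lemma hilb_difference:
  assumes L: "graded_sub L" "graded_sub L'" "L \<subseteq> L'" and z: "z \<in> grS (axis j 1)"
  defines "K \<equiv> {v \<in> L'. z \<odot>\<^bsub>M\<^esub> v \<in> L}" and "C \<equiv> L <+>\<^bsub>M\<^esub> ((\<lambda>v. z \<odot>\<^bsub>M\<^esub> v) ` L')"
  shows "graded_sub K" "graded_sub C" "L \<subseteq> K" "K \<subseteq> L'" "L \<subseteq> C" "C \<subseteq> L'"
    and "hilb L L' (n + axis j 1) - hilb L L' n = hilb C L' (n + axis j 1) - hilb L K n"
proof -
  have zc: "z \<in> carrier S" using z by (rule Sgr.gr_closed)
  note LD = stable_subgroupD[OF graded_subD(1)[OF L(1)]] and LD' = stable_subgroupD[OF graded_subD(1)[OF L(2)]]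
  show K: "graded_sub K" unfolding K_def by (rule graded_sub_colon[OF L(1,2) z])
  show C: "graded_sub C" unfolding C_def by (intro graded_sub_set_add graded_sub_scaled[OF _ z] L)
  show KL: "L \<subseteq> K" "K \<subseteq> L'" unfolding K_def using L(3) LD(5)[OF zc] by auto
  show CL: "L \<subseteq> C" unfolding C_def
    by (rule set_add_upper(1)[OF graded_subD(1)[OF L(1)] graded_subD(1)[OF graded_sub_scaled[OF L(2) z]]])
  show CL': "C \<subseteq> L'" unfolding C_def
    by (rule set_add_least[OF graded_subD(1)[OF L(2)] L(3)]) (use LD'(5)[OF zc] in auto)
  have "hilb K L' n = hilb L C (n + axis j 1)"
    unfolding K_def C_def using hilb_scaled[OF L(1,2) z, of n] by (simp add: add.commute)
  then show "hilb L L' (n + axis j 1) - hilb L L' n = hilb C L' (n + axis j 1) - hilb L K n"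
    using hilb_add[OF L(1) C L(2) CL CL', of "n + axis j 1"] hilb_add[OF L(1) K L(2) KL, of n] by simp
qed

lemma hilb_difference_poly:
  assumes L: "graded_sub L" "graded_sub L'" "L \<subseteq> L'" and z: "z \<in> grS (axis j 1)"
    and c: "eventually_poly (hilb (L <+>\<^bsub>M\<^esub> ((\<lambda>v. z \<odot>\<^bsub>M\<^esub> v) ` L')) L') c"
    and q: "eventually_poly (hilb L {v \<in> L'. z \<odot>\<^bsub>M\<^esub> v \<in> L}) q"
  defines "r \<equiv> \<lambda>k. (c k - q k) + lower_coeffs j q k"
  shows "finite_coeffs r"
    "for_all_large (\<lambda>n. hilb L L' (n + axis j 1) - hilb L L' n = numerical_poly r (n + axis j 1))"
proof -
  have fc: "finite_coeffs c" "finite_coeffs q" using c q by (simp_all add: eventually_poly_def)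
  then show "finite_coeffs r" unfolding r_def
    by (intro finite_coeffs_add finite_coeffs_diff finite_lower_coeffs)
  have C: "for_all_large (\<lambda>n. hilb (L <+>\<^bsub>M\<^esub> ((\<lambda>v. z \<odot>\<^bsub>M\<^esub> v) ` L')) L' (n + axis j 1) = numerical_poly c (n + axis j 1))"
    using c by (intro for_all_large_shift) (simp add: eventually_poly_def)
  have Q: "for_all_large (\<lambda>n. hilb L {v \<in> L'. z \<odot>\<^bsub>M\<^esub> v \<in> L} n = numerical_poly q n)"
    using q by (simp add: eventually_poly_def)
  have "numerical_poly r (n + axis j 1) = numerical_poly c (n + axis j 1) - numerical_poly q n" for n
    unfolding r_def
    using numerical_poly_add[OF finite_coeffs_diff[OF fc] finite_lower_coeffs[OF fc(2), of j], where n = "n + axis j 1"]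
      numerical_poly_diff[OF fc, where n = "n + axis j 1"]
      numerical_poly_difference[OF fc(2), where n = n and j = j] by simp
  then show "for_all_large (\<lambda>n. hilb L L' (n + axis j 1) - hilb L L' n = numerical_poly r (n + axis j 1))"
    using hilb_difference(7)[OF L z]
    by (intro for_all_large_mono[OF for_all_large_conj[OF C Q]]) simp
qed

text \<open>If no generator of direction \<open>j\<close> acts on \<open>L'/L\<close>, the elements of \<open>L'\<close> whose components of
  \<open>j\<close>-degree greater than \<open>b\<close> lie in \<open>L\<close> form a submodule; these submodules ascend with
  \<open>b\<close>, hence become all of \<open>L'\<close>.\<close>

lemma direction_killed:
  assumes L: "graded_sub L" "graded_sub L'" "L \<subseteq> L'"
    and killed: "\<And>y v. y \<in> gens \<Longrightarrow> y \<in> grS (axis j 1) \<Longrightarrow> v \<in> L' \<Longrightarrow> y \<odot>\<^bsub>M\<^esub> v \<in> L"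
  shows "\<exists>N. \<forall>n. N < n $ j \<longrightarrow> L' \<inter> grM n \<subseteq> L"
proof -
  note LD = stable_subgroupD[OF graded_subD(1)[OF L(1)]] and LD' = stable_subgroupD[OF graded_subD(1)[OF L(2)]]
  define U where "U b = {x \<in> L'. \<forall>n. b < n $ j \<longrightarrow> hcomp M grM n x \<in> L}" for b
  have U_stable: "stable_subgroup M (gens \<union> \<Omega>) (U b)" for b
    unfolding stable_subgroup_def
  proof (intro conjI ballI subsetI)
    show "x \<in> carrier M" if "x \<in> U b" for x using that LD'(1) by (simp add: U_def)
    show "\<zero>\<^bsub>M\<^esub> \<in> U b" using LD(2) LD'(2) by (simp add: U_def)
    show "x \<oplus>\<^bsub>M\<^esub> y \<in> U b" if "x \<in> U b" "y \<in> U b" for x y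
      using that LD(3) LD'(1,3) by (simp add: U_def Mgr.hcomp_add)
    show "\<ominus>\<^bsub>M\<^esub> x \<in> U b" if "x \<in> U b" for x
      using that LD(4) LD'(1,4) by (simp add: U_def Mgr.hcomp_inv)
    fix y x assume y: "y \<in> gens \<union> \<Omega>" and x: "x \<in> U b"
    have xL: "x \<in> L'" and xc: "x \<in> carrier M" using x LD'(1) by (simp_all add: U_def)
    have yc: "y \<in> carrier S" using y gens_carrier scalars_carrier by blast
    have "hcomp M grM n (y \<odot>\<^bsub>M\<^esub> x) \<in> L" if n: "b < n $ j" for n
    proof (cases "y \<in> \<Omega>")
      case True
      then show ?thesis
        using hcomp_smult(1)[OF scalars_gr[OF True] xc, of n] LD(5)[OF yc] x n by (simp add: U_def)
    next
      case False
      then have yg: "y \<in> gens" using y by blast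
      then obtain l where l: "y \<in> grS (axis l 1)" using gens(2) by blast
      show ?thesis
      proof (cases "l = j")
        case True
        then show ?thesis using graded_subD(3)[OF L(1)] killed[OF yg _ xL] l by blast
      next
        case False
        show ?thesis
        proof (cases "\<exists>n'. n = axis l 1 + n'")
          case True
          then obtain n' where n': "n = axis l 1 + n'" ..
          have "n' $ j = n $ j" using False by (simp add: n' axis_def)
          then have "hcomp M grM n' x \<in> L" using x n by (simp add: U_def)
          then show ?thesis using hcomp_smult(1)[OF l xc, of n'] LD(5)[OF yc] n' by simp
        next
          case False
          then show ?thesis using hcomp_smult(2)[OF l xc] LD(2) by simp
        qed
      qed
    qed
    moreover have "y \<odot>\<^bsub>M\<^esub> x \<in> L'" using LD'(5)[OF yc xL] .
    ultimately show "y \<odot>\<^bsub>M\<^esub> x \<in> U b" by (simp add: U_def)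
  qed
  have U_graded: "graded_sub (U b)" for b
    unfolding graded_sub_def
  proof (intro conjI ballI allI stable_generators U_stable)
    fix x n assume x: "x \<in> U b"
    then have "x \<in> L'" "x \<in> carrier M" using LD'(1) by (simp_all add: U_def)
    then have h: "hcomp M grM n x \<in> L'" "hcomp M grM n x \<in> grM n"
      using graded_subD(3)[OF L(2)] Mgr.hcomp_properties(1) by simp_all
    have "hcomp M grM n' (hcomp M grM n x) \<in> L" if "b < n' $ j" for n'
      using x that LD(2) Mgr.hcomp_homogeneous[OF h(2), of n'] by (cases "n' = n") (simp_all add: U_def)
    then show "hcomp M grM n x \<in> U b" using h(1) by (simp add: U_def)
  qed
  have "U b \<subseteq> carrier M" for b using stable_subgroupD(1)[OF U_stable[of b]] by blast
  moreover have U_mono: "U b \<subseteq> U b'" if "b \<le> b'" for b b' using that by (auto simp: U_def)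
  ultimately have "\<exists>N. \<forall>i\<ge>N. U i = U N"
    by (intro noetherian_stabilizes[OF noetherian U_graded]) simp_all
  then obtain N where N: "\<forall>i\<ge>N. U i = U N" ..
  have "L' \<inter> grM n \<subseteq> L" if nj: "N < n $ j" for n
  proof
    fix x assume x: "x \<in> L' \<inter> grM n"
    have "x \<in> U (n $ j)"
      using x Mgr.hcomp_homogeneous[of x n] LD(2) by (simp add: U_def)
    moreover have "U (n $ j) = U N" using N[rule_format, of "n $ j"] nj by simp
    ultimately have "x \<in> U N" by simp
    then have "hcomp M grM n x \<in> L" using nj by (simp add: U_def)
    then show "x \<in> L" using x Mgr.hcomp_homogeneous[of x n n] by simp
  qed
  then show ?thesis by blast
qed

text \<open>Induction on the set of generators acting nontrivially: in a subquotient whose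
  Hilbert function is not eventually zero, every direction has such a generator \<open>y\<close>, and both the kernel and
  the cokernel of \<open>y\<close> are killed by \<open>y\<close> in addition.  So all difference functions are eventually polynomial.\<close>

lemma hilbert_polynomial_exists:
  assumes "graded_sub L" "graded_sub L'" "L \<subseteq> L'"
  shows "\<exists>c. eventually_poly (hilb L L') c"
proof -
  have "\<exists>c. eventually_poly (hilb L L') c"
    if "finite Y" "graded_sub L" "graded_sub L'" "L \<subseteq> L'"
      "\<And>y v. y \<in> gens - Y \<Longrightarrow> v \<in> L' \<Longrightarrow> y \<odot>\<^bsub>M\<^esub> v \<in> L" for Y L L'
    using that
  proof (induction Y arbitrary: L L' rule: finite_psubset_induct)
    case (psubset Y)
    note L = psubset.prems(1-3) and killed = psubset.prems(4)
    note LD = stable_subgroupD[OF graded_subD(1)[OF L(1)]]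
    show ?case
    proof (cases "\<exists>j. \<forall>y\<in>Y. y \<notin> grS (axis j 1)")
      case True
      then obtain j where j: "\<forall>y\<in>Y. y \<notin> grS (axis j 1)" ..
      have "\<exists>N. \<forall>n. N < n $ j \<longrightarrow> L' \<inter> grM n \<subseteq> L"
        using killed j by (intro direction_killed[OF L, of j]) blast
      then obtain N where N: "\<forall>n. N < n $ j \<longrightarrow> L' \<inter> grM n \<subseteq> L" ..
      have "hilb L L' n = 0" if "\<forall>i. Suc N \<le> n $ i" for n
        using N that by (intro hilb_zero[OF L(3)]) (simp add: Suc_le_eq)
      then have zero: "for_all_large (\<lambda>n. hilb L L' n = 0)" unfolding for_all_large_def by blast
      have "eventually_poly (hilb L L') (\<lambda>_. 0)"
        unfolding eventually_poly_def finite_coeffs_def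
        using zero by (simp add: numerical_poly_def)
      then show ?thesis by (rule exI[of _ "\<lambda>_. 0"])
    next
      case False
      then have "\<forall>j. \<exists>y. y \<in> Y \<and> y \<in> grS (axis j 1)" by blast
      then obtain y where y: "\<And>j. y j \<in> Y" "\<And>j. y j \<in> grS (axis j 1)" by metis
      let ?C = "\<lambda>j. L <+>\<^bsub>M\<^esub> ((\<lambda>v. y j \<odot>\<^bsub>M\<^esub> v) ` L')" and ?K = "\<lambda>j. {v \<in> L'. y j \<odot>\<^bsub>M\<^esub> v \<in> L}"
      have "\<exists>c. eventually_poly (hilb (?C j) L') c" for j
      proof (rule psubset.IH)
        note D = hilb_difference[OF L y(2)[of j]]
        show "Y - {y j} \<subset> Y" using y(1) by blast
        show "graded_sub (?C j)" "graded_sub L'" "?C j \<subseteq> L'" using D L by auto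
        show "a \<odot>\<^bsub>M\<^esub> v \<in> ?C j" if "a \<in> gens - (Y - {y j})" "v \<in> L'" for a v
        proof (cases "a = y j")
          case True
          have "(\<lambda>v. y j \<odot>\<^bsub>M\<^esub> v) ` L' \<subseteq> ?C j"
            by (rule set_add_upper(2)[OF graded_subD(1)[OF L(1)]
                  graded_subD(1)[OF graded_sub_scaled[OF L(2) y(2)]]])
          then show ?thesis using True that(2) by blast
        next
          case False then show ?thesis using killed[of a v] that D(5) by blast
        qed
      qed
      then obtain c where c: "\<And>j. eventually_poly (hilb (?C j) L') (c j)" by metis
      have "\<exists>q. eventually_poly (hilb L (?K j)) q" for j
      proof (rule psubset.IH)
        note D = hilb_difference[OF L y(2)[of j]]
        show "Y - {y j} \<subset> Y" using y(1) by blast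
        show "graded_sub L" "graded_sub (?K j)" "L \<subseteq> ?K j" using D L by auto
        show "a \<odot>\<^bsub>M\<^esub> v \<in> L" if "a \<in> gens - (Y - {y j})" "v \<in> ?K j" for a v
          using that killed[of a v] by (cases "a = y j") auto
      qed
      then obtain q where q: "\<And>j. eventually_poly (hilb L (?K j)) (q j)" by metis
      show ?thesis
        by (rule eventually_poly_integrate[OF hilb_difference_poly(1)[OF L y(2) c q]
              hilb_difference_poly(2)[OF L y(2) c q]])
    qed
  qed
  from this[OF gens(1) assms] show ?thesis by blast
qed

definition hilbert_coeffs :: "'m set \<Rightarrow> 'm set \<Rightarrow> nat ^ 'd \<Rightarrow> int" where
  "hilbert_coeffs L L' = (THE c. eventually_poly (hilb L L') c)"

lemma hilbert_coeffs:
  assumes "graded_sub L" "graded_sub L'" "L \<subseteq> L'"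
  shows "eventually_poly (hilb L L') (hilbert_coeffs L L')"
proof -
  obtain c where c: "eventually_poly (hilb L L') c" using hilbert_polynomial_exists[OF assms] ..
  have "hilbert_coeffs L L' = c" unfolding hilbert_coeffs_def
    by (rule the_equality[of "eventually_poly (hilb L L')" c, OF c]) (rule eventually_poly_unique[OF _ c])
  then show ?thesis using c by simp
qed

lemma hilbert_coeffs_recursion:
  assumes L: "graded_sub L" "graded_sub L'" "L \<subseteq> L'" and z: "z \<in> grS (axis j 1)"
  defines "K \<equiv> {v \<in> L'. z \<odot>\<^bsub>M\<^esub> v \<in> L}" and "C \<equiv> L <+>\<^bsub>M\<^esub> ((\<lambda>v. z \<odot>\<^bsub>M\<^esub> v) ` L')"
  shows "hilbert_coeffs L L' (h + axis j 1) =
    hilbert_coeffs C L' h - hilbert_coeffs L K h + hilbert_coeffs L K (h + axis j 1)"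
proof -
  note D = hilb_difference[OF L z, folded K_def C_def]
  let ?p = "hilbert_coeffs L L'"
  note p = hilbert_coeffs[OF L]
  note C = hilbert_coeffs[OF D(2) L(2) D(6)] and K = hilbert_coeffs[OF L(1) D(1) D(3)]
  let ?r = "\<lambda>k. (hilbert_coeffs C L' k - hilbert_coeffs L K k) + lower_coeffs j (hilbert_coeffs L K) k"
  note R = hilb_difference_poly[OF L z, folded K_def C_def, OF C K]
  have fp: "finite_coeffs ?p" and ep: "for_all_large (\<lambda>n. hilb L L' n = numerical_poly ?p n)"
    using p by (simp_all add: eventually_poly_def)
  have "lower_coeffs j ?p = ?r"
  proof (rule numerical_poly_unique[OF finite_lower_coeffs[OF fp] R(1)])
    have "for_all_large (\<lambda>n. numerical_poly (lower_coeffs j ?p) (n + axis j 1) = numerical_poly ?r (n + axis j 1))"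
      by (rule for_all_large_mono[OF for_all_large_conj[OF R(2)
            for_all_large_conj[OF ep for_all_large_shift[OF ep, of "axis j 1"]]]])
         (simp flip: numerical_poly_difference[OF fp])
    then show "for_all_large (\<lambda>n. numerical_poly (lower_coeffs j ?p) n = numerical_poly ?r n)"
      by (rule for_all_large_unshift)
  qed
  then show ?thesis by (simp add: lower_coeffs_def fun_eq_iff)
qed

lemma hilbert_coeffs_constant:
  assumes "graded_sub L" "graded_sub L'" "L \<subseteq> L'" "for_all_large (\<lambda>n. hilb L L' n = a)"
  shows "hilbert_coeffs L L' h = (if h = 0 then a else 0)"
proof -
  have "{h :: nat ^ 'd. (if h = 0 then a else 0) \<noteq> 0} \<subseteq> {0}" by auto
  then have "finite_coeffs (\<lambda>h :: nat ^ 'd. if h = 0 then a else 0)"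
    unfolding finite_coeffs_def by (rule finite_subset) simp
  then have "eventually_poly (hilb L L') (\<lambda>h. if h = 0 then a else 0)"
    using assms(4) by (simp add: eventually_poly_def numerical_poly_constant[of "\<lambda>h. if h = 0 then a else 0"])
  from eventually_poly_unique[OF hilbert_coeffs[OF assms(1-3)] this] show ?thesis by simp
qed

end

section \<open>Homogeneous primes\<close>

text \<open>A total order on multidegrees compatible with addition, needed to speak of leading components; \<open>f\<close> is an
  enumeration of the directions.\<close>

definition lex_less :: "('d \<Rightarrow> nat) \<Rightarrow> nat ^ 'd \<Rightarrow> nat ^ 'd \<Rightarrow> bool" where
  "lex_less f m n \<longleftrightarrow> (\<exists>i. m $ i < n $ i \<and> (\<forall>j. f j < f i \<longrightarrow> m $ j = n $ j))"

lemma lex_less_total: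
  fixes m n :: "nat ^ 'd"
  assumes "inj f" "m \<noteq> n" shows "lex_less f m n \<or> lex_less f n m"
proof -
  have "\<exists>i. m $ i \<noteq> n $ i" using assms(2) by (simp add: vec_eq_iff)
  then obtain i where i: "m $ i \<noteq> n $ i" "\<And>j. m $ j \<noteq> n $ j \<Longrightarrow> f i \<le> f j"
    using ex_has_least_nat[of "\<lambda>i. m $ i \<noteq> n $ i" _ f] by blast
  have "m $ j = n $ j" if "f j < f i" for j using i(2)[of j] that by linarith
  then show ?thesis using i(1) unfolding lex_less_def by (metis nat_neq_iff)
qed

lemma lex_less_max:
  assumes inj: "inj f" and "finite (X :: (nat ^ 'd) set)" "X \<noteq> {}"
  shows "\<exists>m\<in>X. \<forall>n\<in>X. \<not> lex_less f m n"
proof -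
  have asym: "asymp_on X (lex_less f)"
    unfolding asymp_on_def lex_less_def
    by (metis inj injD less_irrefl_nat linorder_neqE_nat order.asym)
  have trans: "transp_on X (lex_less f)"
    unfolding transp_on_def
  proof (intro ballI impI)
    fix a b c assume "lex_less f a b" "lex_less f b c"
    then obtain i k where i: "a $ i < b $ i" "\<And>j. f j < f i \<Longrightarrow> a $ j = b $ j"
      and k: "b $ k < c $ k" "\<And>j. f j < f k \<Longrightarrow> b $ j = c $ j" unfolding lex_less_def by blast
    consider "f i < f k" | "f k < f i" | "i = k" using inj by (metis injD linorder_neqE_nat)
    then show "lex_less f a c"
    proof cases
      case 1 then show ?thesis unfolding lex_less_def
        using i k by (intro exI[of _ i]) (metis less_trans)
    next
      case 2 then show ?thesis unfolding lex_less_def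
        using i k by (intro exI[of _ k]) (metis less_trans)
    next
      case 3 then show ?thesis unfolding lex_less_def
        using i k by (intro exI[of _ i]) (metis less_trans)
    qed
  qed
  from Finite_Set.bex_max_element[OF assms(2) asym trans assms(3)] asym
  show ?thesis unfolding asymp_on_def by metis
qed

lemma lex_less_add:
  assumes inj: "inj f" and eq: "n + m = n0 + m0" and ne: "n \<noteq> n0"
  shows "lex_less f n0 n \<or> lex_less f m0 m"
proof (cases "lex_less f n0 n")
  case False
  then have "lex_less f n n0" using lex_less_total[OF inj ne] by blast
  then obtain i where i: "n $ i < n0 $ i" "\<And>j. f j < f i \<Longrightarrow> n $ j = n0 $ j" unfolding lex_less_def by blast
  have eqj: "n $ j + m $ j = n0 $ j + m0 $ j" for j
    using arg_cong[OF eq, of "\<lambda>v. v $ j"] by simp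
  have "m0 $ i < m $ i" using eqj[of i] i(1) by linarith
  moreover have "m0 $ j = m $ j" if "f j < f i" for j using eqj[of j] i(2)[OF that] by linarith
  ultimately show ?thesis unfolding lex_less_def by blast
qed simp

lemma finsum_regular_module: "finsum (regular_module S) f X = finsum S f X"
  by (simp add: finsum_def finprod_def regular_module_def)

lemma hcomp_regular_module: "hcomp (regular_module S) gr = hcomp S gr"
  by (simp add: hcomp_def finsum_regular_module fun_eq_iff)

context fg_graded
begin

text \<open>The algebra itself is a finitely generated graded module, so all that was shown for \<open>M\<close> applies to
  homogeneous ideals.\<close>

sublocale self: fg_graded A \<mm> S grS "regular_module S" grS
proof (rule fg_graded.intro)
  interpret reg: module S "regular_module S" by (rule R.regular_module_is_module)
  show "artinian_local_ring A \<mm>" "fg_standard_graded_algebra A S grS"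
    using artinian standard .
  show "graded_module S grS (regular_module S) grS"
    unfolding graded_module_def
  proof (intro conjI allI ballI)
    show "Module.module S (regular_module S)" by (rule R.regular_module_is_module)
    have "subgroup (grS n) (add_monoid (regular_module S))" for n
    proof (rule subgroup.intro)
      show "inv\<^bsub>add_monoid (regular_module S)\<^esub> x \<in> grS n" if "x \<in> grS n" for x
        using Sgr.gr_inv[OF that] a_inv_regular_module[of S x]
        unfolding a_inv_def[of "regular_module S"] by (simp only:)
    qed (use Sgr.gr_closed Sgr.gr_add in auto)
    then show "internal_direct_sum (regular_module S) grS"
      using Sgr.direct_sum unfolding internal_direct_sum_def finsum_regular_module by simp
    show "x \<odot>\<^bsub>regular_module S\<^esub> y \<in> grS (m + n)" if "x \<in> grS m" "y \<in> grS n" for x y m n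
      using mult_gr[OF that] by simp
  qed
  have gen: "N = carrier S" if "submodule N S (regular_module S)" "\<one>\<^bsub>S\<^esub> \<in> N" for N
  proof
    note N = reg.submoduleE[OF that(1)]
    show "N \<subseteq> carrier S" using N(1) by simp
    show "carrier S \<subseteq> N" using N(4)[OF _ that(2)] by auto
  qed
  have "{N. submodule N S (regular_module S) \<and> {\<one>\<^bsub>S\<^esub>} \<subseteq> N} = {carrier S}"
  proof (intro equalityI subsetI)
    show "N \<in> {carrier S}" if "N \<in> {N. submodule N S (regular_module S) \<and> {\<one>\<^bsub>S\<^esub>} \<subseteq> N}" for N
      using that gen[of N] by simp
    show "N \<in> {N. submodule N S (regular_module S) \<and> {\<one>\<^bsub>S\<^esub>} \<subseteq> N}" if "N \<in> {carrier S}" for N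
      using that reg.carrier_is_submodule by simp
  qed
  then have "module_span S (regular_module S) {\<one>\<^bsub>S\<^esub>} = carrier S"
    by (simp add: module_span_def)
  then show "fin_gen_module S (regular_module S)"
    unfolding fin_gen_module_def using R.regular_module_is_module
    by (intro conjI exI[of _ "{\<one>\<^bsub>S\<^esub>}"]) auto
qed

lemma self_graded_sub_iff:
  "self.graded_sub P \<longleftrightarrow> ideal P S \<and> (\<forall>x\<in>P. \<forall>n. hcomp S grS n x \<in> P)"
  by (simp add: self.graded_sub_def hcomp_regular_module R.ideal_iff_stable)

text \<open>For elements outside of \<open>P\<close> compare the lexicographically largest degrees whose components
  lie outside of \<open>P\<close>: the component of the product in the sum of these degrees is, modulo \<open>P\<close>, the
  product of the two components.\<close>

lemma primeideal_if_homogeneous: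
  assumes P: "self.graded_sub P" and one: "\<one>\<^bsub>S\<^esub> \<notin> P"
    and hom: "\<And>a b m n. a \<in> grS m \<Longrightarrow> b \<in> grS n \<Longrightarrow> a \<otimes>\<^bsub>S\<^esub> b \<in> P \<Longrightarrow> a \<in> P \<or> b \<in> P"
  shows "primeideal P S"
proof -
  have idP: "ideal P S" and comps: "\<And>x n. x \<in> P \<Longrightarrow> hcomp S grS n x \<in> P"
    using P by (auto simp: self_graded_sub_iff)
  interpret P: ideal P S by (rule idP)
  have mem: "x \<in> P" if x: "x \<in> carrier S" and h: "\<And>n. hcomp S grS n x \<in> P" for x
  proof (rule Sgr.mem_if_hcomps[OF x _ _ _ h])
    show "\<zero>\<^bsub>S\<^esub> \<in> P" by (rule P.zero_closed)
    show "u \<oplus>\<^bsub>S\<^esub> v \<in> P" if "u \<in> P" "v \<in> P" for u v using that by (rule P.a_closed)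
    show "P \<subseteq> carrier S" using P.Icarr by blast
  qed
  have mult1: "hcomp S grS N (a \<otimes>\<^bsub>S\<^esub> b) \<in> P"
    if "a \<in> grS n" "b \<in> carrier S" "\<And>m. N = n + m \<Longrightarrow> a \<in> P \<or> hcomp S grS m b \<in> P" for a b n N
  proof (cases "\<exists>m. N = n + m")
    case True
    then obtain m where m: "N = n + m" ..
    have "hcomp S grS N (a \<otimes>\<^bsub>S\<^esub> b) = a \<otimes>\<^bsub>S\<^esub> hcomp S grS m b"
      using self.hcomp_smult(1)[OF that(1), of b m] that(2) m by (simp add: hcomp_regular_module)
    moreover have "a \<otimes>\<^bsub>S\<^esub> hcomp S grS m b \<in> P"
      using that(3)[OF m] P.I_l_closed P.I_r_closed Sgr.gr_closed[OF that(1)] Sgr.hcomp_closed[OF that(2)]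
      by blast
    ultimately show ?thesis by simp
  next
    case False
    then show ?thesis
      using self.hcomp_smult(2)[OF that(1), of b N] that(2) by (simp add: hcomp_regular_module)
  qed
  have mult: "hcomp S grS N (a \<otimes>\<^bsub>S\<^esub> b) \<in> P"
    if "a \<in> carrier S" "b \<in> carrier S" "\<And>n m. N = n + m \<Longrightarrow> hcomp S grS n a \<in> P \<or> hcomp S grS m b \<in> P"
    for a b N
  proof -
    have "a \<in> {a \<in> carrier S. hcomp S grS N (a \<otimes>\<^bsub>S\<^esub> b) \<in> P}"
    proof (rule Sgr.mem_if_hcomps[OF that(1)])
      show "hcomp S grS n a \<in> {a \<in> carrier S. hcomp S grS N (a \<otimes>\<^bsub>S\<^esub> b) \<in> P}" for n
        using mult1[OF Sgr.hcomp_properties(1)[OF that(1)] that(2)] that(3) Sgr.hcomp_closed[OF that(1)] by simp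
      show "x \<oplus>\<^bsub>S\<^esub> y \<in> {a \<in> carrier S. hcomp S grS N (a \<otimes>\<^bsub>S\<^esub> b) \<in> P}"
        if "x \<in> {a \<in> carrier S. hcomp S grS N (a \<otimes>\<^bsub>S\<^esub> b) \<in> P}"
          "y \<in> {a \<in> carrier S. hcomp S grS N (a \<otimes>\<^bsub>S\<^esub> b) \<in> P}" for x y
        using that \<open>b \<in> carrier S\<close> by (simp add: R.l_distr Sgr.hcomp_add P.a_closed)
    qed (use that(2) in auto)
    then show ?thesis by simp
  qed
  obtain f :: "'d \<Rightarrow> nat" where f: "inj f"
    using finite_imp_inj_to_nat_seg[of "UNIV :: 'd set"] by auto
  show ?thesis
  proof (rule primeidealI[OF idP])
    show "cring S" by (rule R.is_cring)
    show "carrier S \<noteq> P" using one by auto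
    fix a b assume a: "a \<in> carrier S" and b: "b \<in> carrier S" and ab: "a \<otimes>\<^bsub>S\<^esub> b \<in> P"
    show "a \<in> P \<or> b \<in> P"
    proof (rule ccontr)
      assume "\<not> (a \<in> P \<or> b \<in> P)"
      then have na: "a \<notin> P" and nb: "b \<notin> P" by auto
      let ?X = "\<lambda>x. {n. hcomp S grS n x \<notin> P}"
      have ex: "\<exists>m. hcomp S grS m x \<notin> P \<and> (\<forall>n. lex_less f m n \<longrightarrow> hcomp S grS n x \<in> P)"
        if x: "x \<in> carrier S" "x \<notin> P" for x
      proof -
        have "?X x \<subseteq> {n. hcomp S grS n x \<noteq> \<zero>\<^bsub>S\<^esub>}" by auto
        then have "finite (?X x)" using Sgr.hcomp_properties(2)[OF x(1)] by (rule finite_subset)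
        moreover have "?X x \<noteq> {}" using mem[OF x(1)] x(2) by blast
        ultimately show ?thesis using lex_less_max[OF f, of "?X x"] by blast
      qed
      obtain n0 where n0: "hcomp S grS n0 a \<notin> P" "\<And>n. lex_less f n0 n \<Longrightarrow> hcomp S grS n a \<in> P"
        using ex[OF a na] by blast
      obtain m0 where m0: "hcomp S grS m0 b \<notin> P" "\<And>n. lex_less f m0 n \<Longrightarrow> hcomp S grS n b \<in> P"
        using ex[OF b nb] by blast
      let ?a0 = "hcomp S grS n0 a" and ?b0 = "hcomp S grS m0 b"
      have c: "?a0 \<in> carrier S" "?b0 \<in> carrier S" using a b Sgr.hcomp_closed by auto
      have hom_a0: "?a0 \<in> grS n0" and hom_b0: "?b0 \<in> grS m0"
        using a b Sgr.hcomp_properties(1) by auto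
      \<comment> \<open>Without its leading component, \<open>a\<close> contributes only elements of \<open>P\<close> to the component of degree \<open>n0 + m0\<close>.\<close>
      define a' where "a' = a \<ominus>\<^bsub>S\<^esub> ?a0"
      have a': "a' \<in> carrier S" using a c by (simp add: a'_def)
      have hc': "hcomp S grS n a' = (if n = n0 then \<zero>\<^bsub>S\<^esub> else hcomp S grS n a)" for n
        using a c Sgr.hcomp_closed[OF a] Sgr.hcomp_homogeneous[OF hom_a0, of n]
        by (simp add: a'_def R.minus_eq Sgr.hcomp_add Sgr.hcomp_inv R.r_neg)
      have "hcomp S grS (n0 + m0) (a' \<otimes>\<^bsub>S\<^esub> b) \<in> P"
      proof (rule mult[OF a' b])
        fix n m assume eq: "n0 + m0 = n + m"
        show "hcomp S grS n a' \<in> P \<or> hcomp S grS m b \<in> P"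
        proof (cases "n = n0")
          case False
          then show ?thesis
            using lex_less_add[OF f eq[symmetric]] n0(2) m0(2) by (auto simp: hc')
        qed (simp add: hc')
      qed
      moreover have "a \<otimes>\<^bsub>S\<^esub> b = ?a0 \<otimes>\<^bsub>S\<^esub> b \<oplus>\<^bsub>S\<^esub> a' \<otimes>\<^bsub>S\<^esub> b"
        using a b c by (simp add: a'_def R.minus_eq R.l_distr R.l_minus R.a_ac R.r_neg R.r_neg1 R.r_neg2)
      then have "hcomp S grS (n0 + m0) (a \<otimes>\<^bsub>S\<^esub> b) = ?a0 \<otimes>\<^bsub>S\<^esub> ?b0 \<oplus>\<^bsub>S\<^esub> hcomp S grS (n0 + m0) (a' \<otimes>\<^bsub>S\<^esub> b)"
        using self.hcomp_smult(1)[OF hom_a0, of b m0] a' b c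
        by (simp add: hcomp_regular_module Sgr.hcomp_add)
      moreover have "hcomp S grS (n0 + m0) (a \<otimes>\<^bsub>S\<^esub> b) \<in> P" using comps[OF ab] .
      ultimately have "?a0 \<otimes>\<^bsub>S\<^esub> ?b0 \<in> P"
        using self.stable_cancel_right[OF idP[unfolded R.ideal_iff_stable], of "?a0 \<otimes>\<^bsub>S\<^esub> ?b0"] c by simp
      then show False using hom[OF hom_a0 hom_b0] n0(1) m0(1) by blast
    qed
  qed
qed

text \<open>The annihilator of the class of \<open>m\<close> in \<open>M/L\<close>.\<close>

definition ann_mod :: "'m set \<Rightarrow> 'm \<Rightarrow> 's set" where
  "ann_mod L m = {s \<in> carrier S. s \<odot>\<^bsub>M\<^esub> m \<in> L}"

lemma hcomp_smult_right:
  assumes m: "m \<in> grM k" and s: "s \<in> carrier S"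
  shows "hcomp M grM (n + k) (s \<odot>\<^bsub>M\<^esub> m) = hcomp S grS n s \<odot>\<^bsub>M\<^esub> m"
proof -
  have mc: "m \<in> carrier M" using m by (rule Mgr.gr_closed)
  have hom: "hcomp M grM (n + k) (u \<odot>\<^bsub>M\<^esub> m) = hcomp S grS n u \<odot>\<^bsub>M\<^esub> m" if "u \<in> grS l" for u l
    using Mgr.hcomp_homogeneous[OF smult_gr[OF that m], of "n + k"] mc
      Sgr.hcomp_homogeneous[OF that, of n] by simp
  have "s \<in> {s \<in> carrier S. hcomp M grM (n + k) (s \<odot>\<^bsub>M\<^esub> m) = hcomp S grS n s \<odot>\<^bsub>M\<^esub> m}"
  proof (rule Sgr.mem_if_hcomps[OF s])
    show "hcomp S grS l s \<in> {s \<in> carrier S. hcomp M grM (n + k) (s \<odot>\<^bsub>M\<^esub> m) = hcomp S grS n s \<odot>\<^bsub>M\<^esub> m}" for l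
      using hom[OF Sgr.hcomp_properties(1)[OF s, of l]] Sgr.hcomp_closed[OF s] by simp
  qed (use mc in \<open>auto simp: smult_l_distr Mgr.hcomp_add Sgr.hcomp_add Sgr.hcomp_closed\<close>)
  then show ?thesis by simp
qed

lemma ann_mod_graded:
  assumes L: "graded_sub L" and m: "m \<in> grM k" shows "self.graded_sub (ann_mod L m)"
  unfolding self_graded_sub_iff
proof (intro conjI ballI allI)
  have mc: "m \<in> carrier M" using m by (rule Mgr.gr_closed)
  note LD = stable_subgroupD[OF graded_subD(1)[OF L]]
  show "ideal (ann_mod L m) S"
    unfolding R.ideal_iff_stable stable_subgroup_def ann_mod_def
    using mc LD(2-5) by (simp add: smult_l_distr smult_l_minus smult_assoc1 subset_iff)
  fix s n assume s: "s \<in> ann_mod L m"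
  then have sc: "s \<in> carrier S" by (simp add: ann_mod_def)
  then show "hcomp S grS n s \<in> ann_mod L m"
    using graded_subD(3)[OF L, of "s \<odot>\<^bsub>M\<^esub> m" "n + k"] s hcomp_smult_right[OF m sc, of n]
    by (simp add: ann_mod_def Sgr.hcomp_closed)
qed

text \<open>If \<open>ab\<close> kills the class of \<open>m\<close> but \<open>b\<close> does not, then \<open>a\<close> lies in the annihilator of the class of \<open>bm\<close>, which contains that of
  \<open>m\<close>.  So an annihilator that is maximal among those of nonzero homogeneous elements is prime.\<close>

lemma exists_prime_annihilator:
  assumes L: "graded_sub L" "graded_sub L'" "L \<subset> L'"
  obtains k m where "m \<in> grM k" "m \<in> L'" "m \<notin> L" "primeideal (ann_mod L m) S"
    "homogeneous_ideal S grS (ann_mod L m)"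
proof -
  let ?F = "{ann_mod L m | m k. m \<in> grM k \<and> m \<in> L' \<and> m \<notin> L}"
  have "\<not> (\<forall>n. L' \<inter> grM n \<subseteq> L)" using graded_sub_le[OF L(2,1)] L(3) by blast
  then obtain n0 m0 where "m0 \<in> grM n0" "m0 \<in> L'" "m0 \<notin> L" by blast
  then have F0: "ann_mod L m0 \<in> ?F" by blast
  have Fg: "self.graded_sub P \<and> P \<subseteq> carrier (regular_module S)" if P: "P \<in> ?F" for P
  proof -
    obtain m k where "m \<in> grM k" "P = ann_mod L m" using P by blast
    then show ?thesis using ann_mod_graded[OF L(1)] by (auto simp: ann_mod_def)
  qed
  obtain P where P: "P \<in> ?F" "\<forall>Q\<in>?F. \<not> P \<subset> Q"
    using noetherian_maximal[of self.graded_sub _ _ ?F, OF self.noetherian F0 Fg] by blast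
  obtain m k where m: "m \<in> grM k" "m \<in> L'" "m \<notin> L" "P = ann_mod L m" using P(1) by blast
  have mc: "m \<in> carrier M" using m(1) by (rule Mgr.gr_closed)
  have Pg: "self.graded_sub P" using Fg[OF P(1)] ..
  note LD' = stable_subgroupD[OF graded_subD(1)[OF L(2)]]
  note LD = stable_subgroupD[OF graded_subD(1)[OF L(1)]]
  have prime: "primeideal P S"
  proof (rule primeideal_if_homogeneous[OF Pg])
    show "\<one>\<^bsub>S\<^esub> \<notin> P" using m(3) mc by (simp add: m(4) ann_mod_def)
    fix a b p q assume a: "a \<in> grS p" and b: "b \<in> grS q" and ab: "a \<otimes>\<^bsub>S\<^esub> b \<in> P"
    have ac: "a \<in> carrier S" and bc: "b \<in> carrier S" using a b Sgr.gr_closed by auto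
    show "a \<in> P \<or> b \<in> P"
    proof (cases "b \<in> P")
      case False
      then have bm: "b \<odot>\<^bsub>M\<^esub> m \<notin> L" using bc by (simp add: m(4) ann_mod_def)
      then have Q: "ann_mod L (b \<odot>\<^bsub>M\<^esub> m) \<in> ?F" using smult_gr[OF b m(1)] LD'(5)[OF bc m(2)] by blast
      have "P \<subseteq> ann_mod L (b \<odot>\<^bsub>M\<^esub> m)"
      proof
        fix s assume "s \<in> P"
        then have s: "s \<in> carrier S" "s \<odot>\<^bsub>M\<^esub> m \<in> L" by (simp_all add: m(4) ann_mod_def)
        have "s \<odot>\<^bsub>M\<^esub> (b \<odot>\<^bsub>M\<^esub> m) = b \<odot>\<^bsub>M\<^esub> (s \<odot>\<^bsub>M\<^esub> m)"
          using s(1) bc mc by (simp add: R.m_comm flip: smult_assoc1)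
        then show "s \<in> ann_mod L (b \<odot>\<^bsub>M\<^esub> m)" using s LD(5)[OF bc] by (simp add: ann_mod_def)
      qed
      then have "ann_mod L (b \<odot>\<^bsub>M\<^esub> m) = P" using P(2) Q by blast
      moreover have "a \<in> ann_mod L (b \<odot>\<^bsub>M\<^esub> m)"
        using ab ac bc mc by (simp add: m(4) ann_mod_def smult_assoc1)
      ultimately show ?thesis by simp
    qed simp
  qed
  have idP: "ideal P S" and comps: "\<And>x n. x \<in> P \<Longrightarrow> hcomp S grS n x \<in> P"
    using Pg by (auto simp: self_graded_sub_iff)
  have "homogeneous_ideal S grS P"
    unfolding homogeneous_ideal_def
  proof (intro conjI idP equalityI)
    let ?X = "\<Union>n. P \<inter> grS n"
    interpret P: ideal P S by (rule idP)
    have X: "?X \<subseteq> carrier S" using P.Icarr by blast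
    interpret I: ideal "Idl\<^bsub>S\<^esub> ?X" S by (rule R.genideal_ideal[OF X])
    show "Idl\<^bsub>S\<^esub> ?X \<subseteq> P" by (rule R.genideal_minimal[OF idP]) blast
    show "P \<subseteq> Idl\<^bsub>S\<^esub> ?X"
    proof
      fix x assume x: "x \<in> P"
      show "x \<in> Idl\<^bsub>S\<^esub> ?X"
      proof (rule Sgr.mem_if_hcomps[OF P.Icarr[OF x]])
        show "hcomp S grS n x \<in> Idl\<^bsub>S\<^esub> ?X" for n
          using R.genideal_self[OF X] comps[OF x] Sgr.hcomp_properties(1)[OF P.Icarr[OF x]] by blast
        show "Idl\<^bsub>S\<^esub> ?X \<subseteq> carrier S" using I.Icarr by blast
        show "\<zero>\<^bsub>S\<^esub> \<in> Idl\<^bsub>S\<^esub> ?X" by (rule I.zero_closed)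
        show "u \<oplus>\<^bsub>S\<^esub> v \<in> Idl\<^bsub>S\<^esub> ?X" if "u \<in> Idl\<^bsub>S\<^esub> ?X" "v \<in> Idl\<^bsub>S\<^esub> ?X" for u v
          using that by (rule I.a_closed)
      qed
    qed
  qed
  then show ?thesis using that[OF m(1-3)] prime m(4) by simp
qed

end

section \<open>Hilbert functions and the dimension of the support\<close>

context fg_graded
begin

definition kills :: "'s set \<Rightarrow> 'm set \<Rightarrow> 'm set \<Rightarrow> bool" where
  "kills I L L' \<longleftrightarrow> (\<forall>a\<in>I. \<forall>v\<in>L'. a \<odot>\<^bsub>M\<^esub> v \<in> L)"

lemma irrelevant_ideal_mem:
  "(\<And>i. 1 \<le> n $ i) \<Longrightarrow> s \<in> grS n \<Longrightarrow> s \<in> irrelevant_ideal S grS"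
  unfolding irrelevant_ideal_def by (rule generate.incl) auto

text \<open>If \<open>S\<^sub>j \<subseteq> P\<close>, direction \<open>j\<close> is killed on \<open>S/P\<close>, so high powers of the homogeneous elements of \<open>S\<^sub>+\<^sub>+\<close> lie in \<open>P\<close>.\<close>

lemma direction_not_contained:
  assumes P: "P \<in> Proj S grS" "self.graded_sub P"
  shows "\<exists>z\<in>grS (axis j 1). z \<notin> P"
proof (rule ccontr)
  assume "\<not> (\<exists>z\<in>grS (axis j 1). z \<notin> P)"
  then have sub: "grS (axis j 1) \<subseteq> P" by blast
  have "primeideal P S" using P(1) by (simp add: Proj_def)
  then interpret P: primeideal P S .
  have PS: "P \<subseteq> carrier S" using P.Icarr by blast
  have "\<exists>N. \<forall>n. N < n $ j \<longrightarrow> carrier (regular_module S) \<inter> grS n \<subseteq> P"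
  proof (rule self.direction_killed[OF P(2) self.graded_sub_carrier])
    show "y \<odot>\<^bsub>regular_module S\<^esub> v \<in> P" if "y \<in> grS (axis j 1)" "v \<in> carrier (regular_module S)" for y v
      using P.I_r_closed[of y v] sub that by auto
  qed (use PS in simp)
  then obtain N where N: "\<forall>n. N < n $ j \<longrightarrow> carrier (regular_module S) \<inter> grS n \<subseteq> P" ..
  have "s \<in> P" if n: "\<forall>i. 1 \<le> n $ i" and s: "s \<in> grS n" for n s
  proof -
    have sc: "s \<in> carrier S" using s by (rule Sgr.gr_closed)
    have "\<exists>n'. s [^]\<^bsub>S\<^esub> t \<in> grS n' \<and> t \<le> n' $ j" for t :: nat
    proof (induction t)
      case 0 show ?case using one_gr by (intro exI[of _ 0]) simp
    next
      case (Suc t)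
      then obtain n' where n': "s [^]\<^bsub>S\<^esub> t \<in> grS n'" "t \<le> n' $ j" by blast
      have "Suc t \<le> (n' + n) $ j" using n'(2) n[rule_format, of j] by simp
      then show ?case using mult_gr[OF n'(1) s] by (intro exI[of _ "n' + n"]) simp
    qed
    then obtain n' where n': "s [^]\<^bsub>S\<^esub> Suc N \<in> grS n'" "Suc N \<le> n' $ j" by blast
    have power: "s [^]\<^bsub>S\<^esub> Suc N \<in> P" using N[rule_format, of n'] n' Sgr.gr_closed[OF n'(1)] by auto
    have "s \<in> P" if "s [^]\<^bsub>S\<^esub> Suc t \<in> P" for t
      using that
    proof (induction t)
      case 0 then show ?case using sc by simp
    next
      case (Suc t) then show ?case using P.I_prime[of "s [^]\<^bsub>S\<^esub> Suc t" s] sc by auto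
    qed
    then show ?thesis using power by blast
  qed
  then have "(\<Union>n\<in>{n. \<forall>i. 1 \<le> n $ i}. grS n) \<subseteq> P" by blast
  moreover have "group (add_monoid S)" by (rule R.add.is_group)
  ultimately have "irrelevant_ideal S grS \<subseteq> P"
    unfolding irrelevant_ideal_def
    by (intro group.generate_subgroup_incl P.a_subgroup)
  then show False using P(1) by (simp add: Proj_def)
qed

lemma stable_multiples:
  assumes "ideal I S" "g \<in> carrier M"
  shows "stable_subgroup M (carrier S) ((\<lambda>a. a \<odot>\<^bsub>M\<^esub> g) ` I)"
  unfolding stable_subgroup_def
proof (intro conjI ballI subsetI; (elim imageE)?)
  interpret I: ideal I S by (rule assms(1))
  let ?C = "(\<lambda>a. a \<odot>\<^bsub>M\<^esub> g) ` I"
  show "x \<in> carrier M" if "x = s \<odot>\<^bsub>M\<^esub> g" "s \<in> I" for x s using that assms(2) I.Icarr by simp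
  show "\<zero>\<^bsub>M\<^esub> \<in> ?C" using assms(2) I.zero_closed by (intro image_eqI[of _ _ "\<zero>\<^bsub>S\<^esub>"]) simp_all
  show "x \<oplus>\<^bsub>M\<^esub> y \<in> ?C" if "x = s \<odot>\<^bsub>M\<^esub> g" "s \<in> I" "y = t \<odot>\<^bsub>M\<^esub> g" "t \<in> I" for x y s t
    using that assms(2) I.Icarr I.a_closed
    by (intro image_eqI[of _ _ "s \<oplus>\<^bsub>S\<^esub> t"]) (simp_all add: smult_l_distr)
  show "\<ominus>\<^bsub>M\<^esub> x \<in> ?C" if "x = s \<odot>\<^bsub>M\<^esub> g" "s \<in> I" for x s
    using that assms(2) I.Icarr I.a_inv_closed
    by (intro image_eqI[of _ _ "\<ominus>\<^bsub>S\<^esub> s"]) (simp_all add: smult_l_minus)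
  show "a \<odot>\<^bsub>M\<^esub> x \<in> ?C" if "a \<in> carrier S" "x = s \<odot>\<^bsub>M\<^esub> g" "s \<in> I" for a x s
    using that assms(2) I.Icarr I.I_l_closed
    by (intro image_eqI[of _ _ "a \<otimes>\<^bsub>S\<^esub> s"]) (simp_all add: smult_assoc1)
qed

lemma graded_sub_cyclic:
  assumes m: "m \<in> grM k" shows "graded_sub ((\<lambda>s. s \<odot>\<^bsub>M\<^esub> m) ` carrier S)"
  unfolding graded_sub_def
proof (intro conjI ballI allI)
  have mc: "m \<in> carrier M" using m by (rule Mgr.gr_closed)
  let ?C = "(\<lambda>s. s \<odot>\<^bsub>M\<^esub> m) ` carrier S"
  show "stable_subgroup M (carrier S) ?C"
    by (rule stable_multiples[OF R.oneideal mc])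
  fix x n assume "x \<in> ?C"
  then obtain s where s: "s \<in> carrier S" "x = s \<odot>\<^bsub>M\<^esub> m" by blast
  show "hcomp M grM n x \<in> ?C"
  proof (cases "\<exists>n'. n = n' + k")
    case True
    then obtain n' where "n = n' + k" ..
    then show ?thesis using hcomp_smult_right[OF m s(1), of n'] s Sgr.hcomp_closed[OF s(1)] by simp
  next
    case False
    have "x \<in> {x \<in> ?C. hcomp M grM n x = \<zero>\<^bsub>M\<^esub>}"
    proof -
      have "s \<in> {s \<in> carrier S. hcomp M grM n (s \<odot>\<^bsub>M\<^esub> m) = \<zero>\<^bsub>M\<^esub>}"
      proof (rule Sgr.mem_if_hcomps[OF s(1)])
        show "hcomp S grS l s \<in> {s \<in> carrier S. hcomp M grM n (s \<odot>\<^bsub>M\<^esub> m) = \<zero>\<^bsub>M\<^esub>}" for l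
          using Mgr.hcomp_homogeneous[OF smult_gr[OF Sgr.hcomp_properties(1)[OF s(1), of l] m], of n]
            Sgr.hcomp_closed[OF s(1)] False by auto
      qed (use mc in \<open>auto simp: smult_l_distr Mgr.hcomp_add\<close>)
      then show ?thesis using s by simp
    qed
    moreover have "\<zero>\<^bsub>M\<^esub> \<in> ?C" using mc by (intro image_eqI[of _ _ "\<zero>\<^bsub>S\<^esub>"]) simp_all
    ultimately show ?thesis by simp
  qed
qed

text \<open>One step of a prime filtration: \<open>N/L \<cong> S/P\<close> up to a shift.  The conclusions list what is used of this isomorphism.\<close>

lemma prime_filtration_step:
  assumes L: "graded_sub L" "graded_sub L'" "L \<subset> L'"
  obtains P N where "graded_sub N" "L \<subset> N" "N \<subseteq> L'" "primeideal P S" "homogeneous_ideal S grS P"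
    "self.graded_sub P" "kills P L N" "\<And>I. I \<subseteq> carrier S \<Longrightarrow> kills I L L' \<Longrightarrow> I \<subseteq> P"
    "\<And>z v. z \<in> carrier S \<Longrightarrow> z \<notin> P \<Longrightarrow> v \<in> N \<Longrightarrow> z \<odot>\<^bsub>M\<^esub> v \<in> L \<Longrightarrow> v \<in> L"
    "irrelevant_ideal S grS \<subseteq> P \<Longrightarrow> for_all_large (\<lambda>n. hilb L N n = 0)"
proof -
  obtain k m where m: "m \<in> grM k" "m \<in> L'" "m \<notin> L" and P: "primeideal (ann_mod L m) S"
    "homogeneous_ideal S grS (ann_mod L m)" by (rule exists_prime_annihilator[OF L])
  have mc: "m \<in> carrier M" using m(1) by (rule Mgr.gr_closed)
  let ?P = "ann_mod L m" and ?C = "(\<lambda>s. s \<odot>\<^bsub>M\<^esub> m) ` carrier S"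
  let ?N = "L <+>\<^bsub>M\<^esub> ?C"
  note C = graded_sub_cyclic[OF m(1)]
  note LD = stable_subgroupD[OF graded_subD(1)[OF L(1)]]
  note LD' = stable_subgroupD[OF graded_subD(1)[OF L(2)]]
  have N: "graded_sub ?N" by (intro graded_sub_set_add L C)
  have LN: "L \<subseteq> ?N" "?C \<subseteq> ?N" by (rule set_add_upper[OF graded_subD(1)[OF L(1)] graded_subD(1)[OF C]])+
  have "m \<in> ?C" using mc by (intro image_eqI[of _ _ "\<one>\<^bsub>S\<^esub>"]) simp_all
  then have "L \<subset> ?N" using LN m(3) by blast
  moreover have "?N \<subseteq> L'"
    by (rule set_add_least[OF graded_subD(1)[OF L(2)]]) (use L(3) LD'(5)[OF _ m(2)] in auto)
  moreover have "kills ?P L ?N"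
    unfolding kills_def
  proof (intro ballI)
    fix a v assume a: "a \<in> ?P" and v: "v \<in> ?N"
    have ac: "a \<in> carrier S" "a \<odot>\<^bsub>M\<^esub> m \<in> L" using a by (simp_all add: ann_mod_def)
    obtain l s where ls: "l \<in> L" "s \<in> carrier S" "v = l \<oplus>\<^bsub>M\<^esub> s \<odot>\<^bsub>M\<^esub> m" using v by (auto elim!: set_addE)
    have "a \<odot>\<^bsub>M\<^esub> (s \<odot>\<^bsub>M\<^esub> m) = s \<odot>\<^bsub>M\<^esub> (a \<odot>\<^bsub>M\<^esub> m)"
      using ac(1) ls(2) mc by (simp add: R.m_comm flip: smult_assoc1)
    then show "a \<odot>\<^bsub>M\<^esub> v \<in> L"
      using LD(3)[OF LD(5)[OF ac(1) ls(1)] LD(5)[OF ls(2) ac(2)]] ac(1) ls LD(1) mc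
      by (simp add: smult_r_distr)
  qed
  moreover have "I \<subseteq> ?P" if "I \<subseteq> carrier S" "kills I L L'" for I
    using that m(2) by (auto simp: kills_def ann_mod_def)
  moreover have "v \<in> L" if z: "z \<in> carrier S" "z \<notin> ?P" and v: "v \<in> ?N" "z \<odot>\<^bsub>M\<^esub> v \<in> L" for z v
  proof -
    obtain l s where ls: "l \<in> L" "s \<in> carrier S" "v = l \<oplus>\<^bsub>M\<^esub> s \<odot>\<^bsub>M\<^esub> m" using v(1) by (auto elim!: set_addE)
    have "z \<odot>\<^bsub>M\<^esub> l \<oplus>\<^bsub>M\<^esub> (z \<otimes>\<^bsub>S\<^esub> s) \<odot>\<^bsub>M\<^esub> m \<in> L"
      using v(2) z(1) ls LD(1) mc by (simp add: smult_r_distr smult_assoc1)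
    then have "(z \<otimes>\<^bsub>S\<^esub> s) \<odot>\<^bsub>M\<^esub> m \<in> L"
      using stable_cancel[OF graded_subD(1)[OF L(1)], of "z \<odot>\<^bsub>M\<^esub> l"] LD(5)[OF z(1) ls(1)] z(1) ls(2) mc by simp
    then have "z \<otimes>\<^bsub>S\<^esub> s \<in> ?P" using z(1) ls(2) by (simp add: ann_mod_def)
    then have "s \<in> ?P" using primeideal.I_prime[OF P(1) z(1) ls(2)] z(2) by blast
    then show ?thesis using ls LD(3) by (simp add: ann_mod_def)
  qed
  moreover have "for_all_large (\<lambda>n. hilb L ?N n = 0)" if irr: "irrelevant_ideal S grS \<subseteq> ?P"
  proof -
    have "hilb L ?N (n + k) = 0" if n: "\<forall>i. 1 \<le> n $ i" for n
    proof (rule hilb_zero[OF LN(1)], rule subsetI)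
      fix x assume x: "x \<in> ?N \<inter> grM (n + k)"
      then obtain l s where ls: "l \<in> L" "s \<in> carrier S" "x = l \<oplus>\<^bsub>M\<^esub> s \<odot>\<^bsub>M\<^esub> m" by (auto elim!: set_addE)
      have "hcomp S grS n s \<in> ?P"
        using irrelevant_ideal_mem[of n] n Sgr.hcomp_properties(1)[OF ls(2)] irr by blast
      then have "hcomp S grS n s \<odot>\<^bsub>M\<^esub> m \<in> L" by (simp add: ann_mod_def)
      then have "hcomp M grM (n + k) x \<in> L"
        using ls LD(1,3) mc graded_subD(3)[OF L(1) ls(1)] hcomp_smult_right[OF m(1) ls(2), of n]
        by (simp add: Mgr.hcomp_add)
      then show "x \<in> L" using x Mgr.hcomp_homogeneous[of x "n + k" "n + k"] by simp
    qed
    then have "for_all_large (\<lambda>n. hilb L ?N (n + k) = 0)" unfolding for_all_large_def by blast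
    then show ?thesis by (rule for_all_large_unshift)
  qed
  ultimately show ?thesis using that[of ?N ?P] N P ann_mod_graded[OF L(1) m(1)] by blast
qed

lemma kills_mono: "kills I L L' \<Longrightarrow> L \<subseteq> N \<Longrightarrow> N' \<subseteq> L' \<Longrightarrow> kills I N N'"
  unfolding kills_def by blast

text \<open>Here all primes \<open>P\<close> of a prime filtration contain \<open>S\<^sub>+\<^sub>+\<close>, and \<open>S/P\<close> vanishes in large degrees.\<close>

lemma hilb_eventually_zero:
  assumes L: "graded_sub L" "graded_sub L'" "L \<subseteq> L'" and I: "I \<subseteq> carrier S" "kills I L L'"
    and none: "\<And>P. P \<in> Proj S grS \<Longrightarrow> \<not> I \<subseteq> P"
  shows "for_all_large (\<lambda>n. hilb L L' n = 0)"
proof -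
  have "L \<subseteq> L' \<and> kills I L L' \<longrightarrow> for_all_large (\<lambda>n. hilb L L' n = 0)"
  proof (rule noetherian_induct[OF noetherian, where L = L])
    show "graded_sub L" "L \<subseteq> carrier M" using L(1) graded_subD(4) by auto
    fix K assume K: "graded_sub K"
      and IH: "\<And>K'. graded_sub K' \<Longrightarrow> K \<subset> K' \<Longrightarrow> K' \<subseteq> carrier M \<Longrightarrow>
        K' \<subseteq> L' \<and> kills I K' L' \<longrightarrow> for_all_large (\<lambda>n. hilb K' L' n = 0)"
    show "K \<subseteq> L' \<and> kills I K L' \<longrightarrow> for_all_large (\<lambda>n. hilb K L' n = 0)"
    proof (intro impI, elim conjE)
      assume KL: "K \<subseteq> L'" and IK: "kills I K L'"
      show "for_all_large (\<lambda>n. hilb K L' n = 0)"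
      proof (cases "K = L'")
        case True then show ?thesis by (simp add: hilb_self for_all_large_def)
      next
        case False
        then have "K \<subset> L'" using KL by blast
        then obtain P N where N: "graded_sub N" "K \<subset> N" "N \<subseteq> L'" and P: "primeideal P S"
          "homogeneous_ideal S grS P" "\<And>I. I \<subseteq> carrier S \<Longrightarrow> kills I K L' \<Longrightarrow> I \<subseteq> P"
          "irrelevant_ideal S grS \<subseteq> P \<Longrightarrow> for_all_large (\<lambda>n. hilb K N n = 0)"
          by (rule prime_filtration_step[OF K L(2)]) (rule that)
        have "P \<notin> Proj S grS" using none P(3)[OF I(1) IK] by blast
        then have "irrelevant_ideal S grS \<subseteq> P" using P(1,2) by (simp add: Proj_def)
        then have z1: "for_all_large (\<lambda>n. hilb K N n = 0)" by (rule P(4))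
        have "N \<subseteq> carrier M" using N(1) graded_subD(4) by blast
        then have z2: "for_all_large (\<lambda>n. hilb N L' n = 0)"
          using IH[OF N(1,2)] N(3) kills_mono[OF IK psubset_imp_subset[OF N(2)] order_refl] by simp
        show ?thesis
          using hilb_add[OF K N(1) L(2) psubset_imp_subset[OF N(2)] N(3)]
          by (intro for_all_large_mono[OF for_all_large_conj[OF z1 z2]]) simp
      qed
    qed
  qed
  then show ?thesis using L(3) I(2) by simp
qed

text \<open>If there are no chains of length \<open>1\<close> above the annihilator, each prime \<open>P\<close> of \<open>Proj S\<close> in a prime filtration is maximal in
  \<open>Proj S\<close>.  For homogeneous \<open>z \<notin> P\<close> the Hilbert function of \<open>S/(P + zS)\<close> is therefore eventually zero, and since
  \<open>z\<close> is a nonzerodivisor on \<open>S/P\<close>, the Hilbert function of \<open>S/P\<close> is eventually invariant under the shift by the degree of \<open>z\<close>.\<close>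

lemma hilb_eventually_constant:
  assumes L: "graded_sub L" "graded_sub L'" "L \<subseteq> L'" and I: "I \<subseteq> carrier S" "kills I L L'"
    and none: "\<And>P P'. P \<in> Proj S grS \<Longrightarrow> P' \<in> Proj S grS \<Longrightarrow> I \<subseteq> P \<Longrightarrow> \<not> P \<subset> P'"
  shows "\<exists>a. for_all_large (\<lambda>n. hilb L L' n = a)"
proof -
  have "L \<subseteq> L' \<and> kills I L L' \<longrightarrow> (\<exists>a. for_all_large (\<lambda>n. hilb L L' n = a))"
  proof (rule noetherian_induct[OF noetherian, where L = L])
    show "graded_sub L" "L \<subseteq> carrier M" using L(1) graded_subD(4) by auto
    fix K assume K: "graded_sub K"
      and IH: "\<And>K'. graded_sub K' \<Longrightarrow> K \<subset> K' \<Longrightarrow> K' \<subseteq> carrier M \<Longrightarrow>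
        K' \<subseteq> L' \<and> kills I K' L' \<longrightarrow> (\<exists>a. for_all_large (\<lambda>n. hilb K' L' n = a))"
    show "K \<subseteq> L' \<and> kills I K L' \<longrightarrow> (\<exists>a. for_all_large (\<lambda>n. hilb K L' n = a))"
    proof (intro impI, elim conjE)
      assume KL: "K \<subseteq> L'" and IK: "kills I K L'"
      show "\<exists>a. for_all_large (\<lambda>n. hilb K L' n = a)"
      proof (cases "K = L'")
        case True then show ?thesis by (auto simp add: hilb_self for_all_large_def)
      next
        case False
        then have "K \<subset> L'" using KL by blast
        then obtain P N where N: "graded_sub N" "K \<subset> N" "N \<subseteq> L'" and P: "primeideal P S"
          "homogeneous_ideal S grS P" "self.graded_sub P" "kills P K N"
          "\<And>I. I \<subseteq> carrier S \<Longrightarrow> kills I K L' \<Longrightarrow> I \<subseteq> P"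
          "\<And>z v. z \<in> carrier S \<Longrightarrow> z \<notin> P \<Longrightarrow> v \<in> N \<Longrightarrow> z \<odot>\<^bsub>M\<^esub> v \<in> K \<Longrightarrow> v \<in> K"
          "irrelevant_ideal S grS \<subseteq> P \<Longrightarrow> for_all_large (\<lambda>n. hilb K N n = 0)"
          by (rule prime_filtration_step[OF K L(2)]) (rule that)
        have KN: "K \<subseteq> N" using N(2) by blast
        have IP: "I \<subseteq> P" using P(5)[OF I(1) IK] .
        have "\<exists>a. for_all_large (\<lambda>n. hilb K N n = a)"
        proof (cases "P \<in> Proj S grS")
          case False
          then have "irrelevant_ideal S grS \<subseteq> P" using P(1,2) by (simp add: Proj_def)
          then show ?thesis using P(7) by blast
        next
          case True
          have "for_all_large (\<lambda>n. hilb K N (n + axis j 1) = hilb K N n)" for j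
          proof -
            obtain z where z: "z \<in> grS (axis j 1)" "z \<notin> P"
              using direction_not_contained[OF True P(3)] by blast
            have zc: "z \<in> carrier S" using z(1) by (rule Sgr.gr_closed)
            let ?C = "K <+>\<^bsub>M\<^esub> ((\<lambda>v. z \<odot>\<^bsub>M\<^esub> v) ` N)"
            note D = hilb_difference[OF K N(1) KN z(1)]
            \<comment> \<open>The kernel of \<open>z\<close> on \<open>N/K \<cong> S/P\<close> is zero.\<close>
            have Kz: "{v \<in> N. z \<odot>\<^bsub>M\<^esub> v \<in> K} = K" using P(6)[OF zc z(2)] D(3) by auto
            have zN: "(\<lambda>v. z \<odot>\<^bsub>M\<^esub> v) ` N \<subseteq> ?C"
              by (rule set_add_upper(2)[OF graded_subD(1)[OF K] graded_subD(1)[OF graded_sub_scaled[OF N(1) z(1)]]])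
            have "for_all_large (\<lambda>n. hilb ?C N n = 0)"
            proof (rule hilb_eventually_zero[OF D(2) N(1) D(6), of "insert z P"])
              show "insert z P \<subseteq> carrier S" using zc P(3) self.graded_subD(4)[OF P(3)] by auto
              show "kills (insert z P) ?C N" using P(4) zN D(5) unfolding kills_def by blast
              show "\<not> insert z P \<subseteq> P'" if "P' \<in> Proj S grS" for P'
                using none[OF True that IP] z(2) by blast
            qed
            then have "for_all_large (\<lambda>n. hilb ?C N (n + axis j 1) = 0)" by (rule for_all_large_shift)
            then show ?thesis
            proof (rule for_all_large_mono)
              show "hilb K N (n + axis j 1) = hilb K N n" if "hilb ?C N (n + axis j 1) = 0" for n
                using D(7)[of n] that by (simp add: Kz hilb_self)
            qed
          qed
          then show ?thesis by (intro eventually_constantI for_all_large_all)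
        qed
        then obtain a where a: "for_all_large (\<lambda>n. hilb K N n = a)" ..
        have "N \<subseteq> carrier M" using N(1) graded_subD(4) by blast
        then obtain b where b: "for_all_large (\<lambda>n. hilb N L' n = b)"
          using IH[OF N(1,2)] N(3) kills_mono[OF IK KN order_refl] by auto
        have "for_all_large (\<lambda>n. hilb K L' n = a + b)"
          using hilb_add[OF K N(1) L(2) KN N(3)]
          by (intro for_all_large_mono[OF for_all_large_conj[OF a b]]) simp
        then show ?thesis ..
      qed
    qed
  qed
  then show ?thesis using L(3) I(2) by simp
qed

text \<open>The induction behind the vanishing of the higher coefficients.  The hypothesis on primes passes to
  the kernel and to the cokernel of multiplication by the first element of the sequence, since both are
  killed by the annihilator of \<open>L'/L\<close> and by this element.\<close>

lemma hilbert_coeffs_vanish: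
  assumes "list_all2 (\<lambda>j x. x \<in> grS (axis j 1)) js zs" "graded_sub L" "graded_sub L'" "L \<subseteq> L'"
    and "I \<subseteq> carrier S" "kills I L L'"
    and "\<And>P P'. P \<in> Proj S grS \<Longrightarrow> P' \<in> Proj S grS \<Longrightarrow> I \<union> set zs \<subseteq> P \<Longrightarrow> \<not> P \<subset> P'"
    and "seq_type js < h"
  shows "hilbert_coeffs L L' h = 0"
  using assms
proof (induction js zs arbitrary: L L' I h rule: list_all2_induct)
  case Nil
  obtain a where "for_all_large (\<lambda>n. hilb L L' n = a)"
    using hilb_eventually_constant[OF Nil.prems(1-5)] Nil.prems(6) by auto
  moreover have "h \<noteq> 0"
    using Nil.prems(7) by (auto simp: seq_type_def less_vec_def less_eq_vec_def)
  ultimately show ?case using hilbert_coeffs_constant[OF Nil.prems(1-3)] by simp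
next
  case (Cons j js z zs)
  note L = Cons.prems(1-3)
  have z: "z \<in> grS (axis j 1)" by (rule Cons.hyps)
  have zc: "z \<in> carrier S" using z by (rule Sgr.gr_closed)
  let ?K = "{v \<in> L'. z \<odot>\<^bsub>M\<^esub> v \<in> L}" and ?C = "L <+>\<^bsub>M\<^esub> ((\<lambda>v. z \<odot>\<^bsub>M\<^esub> v) ` L')"
  note D = hilb_difference[OF L z]
  have type: "seq_type (j # js) = seq_type js + axis j 1"
    by (simp add: vec_eq_iff seq_type_def axis_def)
  have "h $ j \<noteq> 0"
    using Cons.prems(7) unfolding type less_vec_def less_eq_vec_def
    by (auto simp: axis_def dest!: spec[of _ j])
  then obtain g where g: "h = g + axis j 1" by (rule pos_component_split)
  have g1: "seq_type js < g"
    using Cons.prems(7) unfolding type g less_vec_def less_eq_vec_def by simp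
  have g2: "seq_type js < g + axis j 1"
    using g1 unfolding less_vec_def less_eq_vec_def
    by (auto simp: trans_le_add1) (meson add_leD1)
  have zC: "(\<lambda>v. z \<odot>\<^bsub>M\<^esub> v) ` L' \<subseteq> ?C"
    by (rule set_add_upper(2)[OF graded_subD(1)[OF L(1)] graded_subD(1)[OF graded_sub_scaled[OF L(2) z]]])
  have Iz: "insert z I \<subseteq> carrier S" using zc Cons.prems(4) by simp
  have P: "\<not> P \<subset> P'" if "P \<in> Proj S grS" "P' \<in> Proj S grS" "insert z I \<union> set zs \<subseteq> P" for P P'
    using Cons.prems(6)[of P P'] that by auto
  have kC: "kills (insert z I) ?C L'" using Cons.prems(5) zC D(5) unfolding kills_def by blast
  have kK: "kills (insert z I) L ?K" using Cons.prems(5) unfolding kills_def by blast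
  have "hilbert_coeffs ?C L' g = 0" by (rule Cons.IH[OF D(2) L(2) D(6) Iz kC P g1])
  moreover have "hilbert_coeffs L ?K g = 0" by (rule Cons.IH[OF L(1) D(1) D(3) Iz kK P g1])
  moreover have "hilbert_coeffs L ?K (g + axis j 1) = 0" by (rule Cons.IH[OF L(1) D(1) D(3) Iz kK P g2])
  ultimately show ?case unfolding g using hilbert_coeffs_recursion[OF L z] by simp
qed

end

section \<open>Quotient modules and their lengths\<close>

lemma a_r_coset_carrier_update [simp]: "a_r_coset (M\<lparr>carrier := C\<rparr>) = a_r_coset M"
  by (simp add: a_r_coset_def r_coset_def fun_eq_iff)

lemma set_add_carrier_update [simp]: "set_add (M\<lparr>carrier := C\<rparr>) = set_add M"
  by (simp add: set_add_def set_mult_def fun_eq_iff)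

context module
begin

lemma coset_eq_iff:
  assumes L: "stable_subgroup M (carrier R) L" and x: "x \<in> carrier M" and y: "y \<in> carrier M"
  shows "L +>\<^bsub>M\<^esub> x = L +>\<^bsub>M\<^esub> y \<longleftrightarrow> x \<ominus>\<^bsub>M\<^esub> y \<in> L"
proof
  note LD = stable_subgroupD[OF L]
  have mem: "z \<in> L +>\<^bsub>M\<^esub> w \<longleftrightarrow> (\<exists>l\<in>L. z = l \<oplus>\<^bsub>M\<^esub> w)" for z w by (simp add: a_r_coset_def')
  have sub: "L +>\<^bsub>M\<^esub> u \<subseteq> L +>\<^bsub>M\<^esub> v" if "u \<ominus>\<^bsub>M\<^esub> v \<in> L" "u \<in> carrier M" "v \<in> carrier M" for u v
  proof
    fix z assume "z \<in> L +>\<^bsub>M\<^esub> u"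
    then obtain l where l: "l \<in> L" "z = l \<oplus>\<^bsub>M\<^esub> u" by (auto simp: mem)
    have "z = (l \<oplus>\<^bsub>M\<^esub> (u \<ominus>\<^bsub>M\<^esub> v)) \<oplus>\<^bsub>M\<^esub> v"
      using l LD(1) that by (simp add: M.minus_eq M.a_assoc M.l_neg)
    then show "z \<in> L +>\<^bsub>M\<^esub> v" using LD(3)[OF l(1) that(1)] unfolding mem by blast
  qed
  show "x \<ominus>\<^bsub>M\<^esub> y \<in> L" if eq: "L +>\<^bsub>M\<^esub> x = L +>\<^bsub>M\<^esub> y"
  proof -
    have "\<zero>\<^bsub>M\<^esub> \<oplus>\<^bsub>M\<^esub> x \<in> L +>\<^bsub>M\<^esub> x" using LD(2) by (auto simp: mem)
    then obtain l where l: "l \<in> L" "x = l \<oplus>\<^bsub>M\<^esub> y" using eq x by (auto simp: mem)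
    then have "x \<ominus>\<^bsub>M\<^esub> y = l" using LD(1)[OF l(1)] y by (simp add: M.minus_eq M.a_assoc M.r_neg)
    then show ?thesis using l(1) by simp
  qed
  show "L +>\<^bsub>M\<^esub> x = L +>\<^bsub>M\<^esub> y" if xy: "x \<ominus>\<^bsub>M\<^esub> y \<in> L"
  proof
    have "y \<ominus>\<^bsub>M\<^esub> x = \<ominus>\<^bsub>M\<^esub> (x \<ominus>\<^bsub>M\<^esub> y)" using x y by (simp add: M.minus_eq M.minus_add M.a_comm)
    then have "y \<ominus>\<^bsub>M\<^esub> x \<in> L" using LD(4)[OF xy] by simp
    then show "L +>\<^bsub>M\<^esub> y \<subseteq> L +>\<^bsub>M\<^esub> x" using x y by (intro sub)
  qed (rule sub[OF xy x y])
qed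

lemma coset_zero:
  assumes "stable_subgroup M (carrier R) L" shows "L +>\<^bsub>M\<^esub> \<zero>\<^bsub>M\<^esub> = L"
  using stable_subgroupD(1)[OF assms] by (force simp: a_r_coset_def')

lemma coset_add:
  assumes L: "stable_subgroup M (carrier R) L" and x: "x \<in> carrier M" and y: "y \<in> carrier M"
  shows "(L +>\<^bsub>M\<^esub> x) <+>\<^bsub>M\<^esub> (L +>\<^bsub>M\<^esub> y) = L +>\<^bsub>M\<^esub> (x \<oplus>\<^bsub>M\<^esub> y)"
proof (intro equalityI subsetI)
  note LD = stable_subgroupD[OF L]
  fix z assume "z \<in> (L +>\<^bsub>M\<^esub> x) <+>\<^bsub>M\<^esub> (L +>\<^bsub>M\<^esub> y)"
  then obtain l l' where l: "l \<in> L" "l' \<in> L" "z = (l \<oplus>\<^bsub>M\<^esub> x) \<oplus>\<^bsub>M\<^esub> (l' \<oplus>\<^bsub>M\<^esub> y)"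
    by (auto simp: a_r_coset_def' elim!: set_addE)
  then have "z = (l \<oplus>\<^bsub>M\<^esub> l') \<oplus>\<^bsub>M\<^esub> (x \<oplus>\<^bsub>M\<^esub> y)" using LD(1) x y by (simp add: M.a_ac)
  then show "z \<in> L +>\<^bsub>M\<^esub> (x \<oplus>\<^bsub>M\<^esub> y)" using LD(3)[OF l(1,2)] unfolding a_r_coset_def' by blast
next
  note LD = stable_subgroupD[OF L]
  fix z assume "z \<in> L +>\<^bsub>M\<^esub> (x \<oplus>\<^bsub>M\<^esub> y)"
  then obtain l where l: "l \<in> L" "z = l \<oplus>\<^bsub>M\<^esub> (x \<oplus>\<^bsub>M\<^esub> y)" by (auto simp: a_r_coset_def')
  then have "z = (l \<oplus>\<^bsub>M\<^esub> x) \<oplus>\<^bsub>M\<^esub> (\<zero>\<^bsub>M\<^esub> \<oplus>\<^bsub>M\<^esub> y)" using LD(1) x y by (simp add: M.a_assoc)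
  moreover have "l \<oplus>\<^bsub>M\<^esub> x \<in> L +>\<^bsub>M\<^esub> x" "\<zero>\<^bsub>M\<^esub> \<oplus>\<^bsub>M\<^esub> y \<in> L +>\<^bsub>M\<^esub> y"
    using l(1) LD(2) unfolding a_r_coset_def' by blast+
  ultimately show "z \<in> (L +>\<^bsub>M\<^esub> x) <+>\<^bsub>M\<^esub> (L +>\<^bsub>M\<^esub> y)" by (simp only: set_addI)
qed

lemma coset_smult:
  assumes L: "stable_subgroup M (carrier R) L" and x: "x \<in> carrier M" and a: "a \<in> carrier R"
  shows "(\<Union>v\<in>L +>\<^bsub>M\<^esub> x. L +>\<^bsub>M\<^esub> (a \<odot>\<^bsub>M\<^esub> v)) = L +>\<^bsub>M\<^esub> (a \<odot>\<^bsub>M\<^esub> x)"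
proof -
  note LD = stable_subgroupD[OF L]
  have "L +>\<^bsub>M\<^esub> (a \<odot>\<^bsub>M\<^esub> v) = L +>\<^bsub>M\<^esub> (a \<odot>\<^bsub>M\<^esub> x)" if v: "v \<in> L +>\<^bsub>M\<^esub> x" for v
  proof -
    obtain l where l: "l \<in> L" "v = l \<oplus>\<^bsub>M\<^esub> x" using v by (auto simp: a_r_coset_def')
    have c: "l \<in> carrier M" "v \<in> carrier M" using LD(1)[OF l(1)] x l(2) by auto
    have "a \<odot>\<^bsub>M\<^esub> v \<ominus>\<^bsub>M\<^esub> a \<odot>\<^bsub>M\<^esub> x = a \<odot>\<^bsub>M\<^esub> l"
      using c x a by (simp add: l(2) smult_r_distr M.minus_eq M.a_assoc M.r_neg)
    then show ?thesis using LD(5)[OF a l(1)] coset_eq_iff[OF L] c x a by simp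
  qed
  moreover have "\<zero>\<^bsub>M\<^esub> \<oplus>\<^bsub>M\<^esub> x \<in> L +>\<^bsub>M\<^esub> x" using LD(2) unfolding a_r_coset_def' by blast
  ultimately show ?thesis by blast
qed

end

lemma submoduleD:
  assumes "submodule N A Q"
  shows "X \<in> N \<Longrightarrow> X \<in> carrier Q" "\<zero>\<^bsub>Q\<^esub> \<in> N" "X \<in> N \<Longrightarrow> Y \<in> N \<Longrightarrow> X \<oplus>\<^bsub>Q\<^esub> Y \<in> N"
    "a \<in> carrier A \<Longrightarrow> X \<in> N \<Longrightarrow> a \<odot>\<^bsub>Q\<^esub> X \<in> N"
  using subgroup.mem_carrier[OF submodule.axioms(1)[OF assms]]
    subgroup.one_closed[OF submodule.axioms(1)[OF assms]]
    subgroup.m_closed[OF submodule.axioms(1)[OF assms]] submodule.smult_closed[OF assms]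
  by simp_all

context fg_graded
begin

text \<open>The correspondence theorem for lengths.  The record \<open>Q\<close> is only required to behave like the image of \<open>V\<close>
  under an \<open>A\<close>-linear surjection \<open>\<pi>\<close> with kernel \<open>U\<close>.\<close>

lemma module_length_image:
  assumes V: "stable_subgroup M \<Omega> V" and U: "stable_subgroup M \<Omega> U" "U \<subseteq> V"
    and carr: "carrier Q = \<pi> ` V" and zero: "\<zero>\<^bsub>Q\<^esub> = \<pi> \<zero>\<^bsub>M\<^esub>"
    and add: "\<And>x y. x \<in> V \<Longrightarrow> y \<in> V \<Longrightarrow> \<pi> x \<oplus>\<^bsub>Q\<^esub> \<pi> y = \<pi> (x \<oplus>\<^bsub>M\<^esub> y)"
    and smult: "\<And>a x. a \<in> carrier A \<Longrightarrow> x \<in> V \<Longrightarrow> a \<odot>\<^bsub>Q\<^esub> \<pi> x = \<pi> ((a \<odot>\<^bsub>S\<^esub> \<one>\<^bsub>S\<^esub>) \<odot>\<^bsub>M\<^esub> x)"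
    and ker: "\<And>x y. x \<in> V \<Longrightarrow> y \<in> V \<Longrightarrow> \<pi> x = \<pi> y \<longleftrightarrow> x \<ominus>\<^bsub>M\<^esub> y \<in> U"
  shows "module_length A Q = alen U V"
proof -
  let ?P = "stable_subgroup M \<Omega>" and ?P' = "\<lambda>N. submodule N A Q"
  note VD = stable_subgroupD[OF V] and UD = stable_subgroupD[OF U(1)]
  have \<omega>: "\<omega> \<in> \<Omega> \<longleftrightarrow> (\<exists>a\<in>carrier A. \<omega> = a \<odot>\<^bsub>S\<^esub> \<one>\<^bsub>S\<^esub>)" for \<omega> by (auto simp: scalars_def)
  \<comment> \<open>Subgroups are closed under the inverse of the record \<open>Q\<close>, which therefore has to be computed.\<close>
  have inv: "inv\<^bsub>add_monoid Q\<^esub> (\<pi> x) = \<pi> (\<ominus>\<^bsub>M\<^esub> x)" if x: "x \<in> V" for x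
  proof -
    have xc: "x \<in> carrier M" using VD(1)[OF x] .
    have "(THE Y. Y \<in> carrier Q \<and> \<pi> x \<oplus>\<^bsub>Q\<^esub> Y = \<zero>\<^bsub>Q\<^esub> \<and> Y \<oplus>\<^bsub>Q\<^esub> \<pi> x = \<zero>\<^bsub>Q\<^esub>) = \<pi> (\<ominus>\<^bsub>M\<^esub> x)"
    proof (rule the_equality)
      show "\<pi> (\<ominus>\<^bsub>M\<^esub> x) \<in> carrier Q \<and> \<pi> x \<oplus>\<^bsub>Q\<^esub> \<pi> (\<ominus>\<^bsub>M\<^esub> x) = \<zero>\<^bsub>Q\<^esub> \<and> \<pi> (\<ominus>\<^bsub>M\<^esub> x) \<oplus>\<^bsub>Q\<^esub> \<pi> x = \<zero>\<^bsub>Q\<^esub>"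
        using x VD(4)[OF x] xc by (simp add: carr zero add M.r_neg M.l_neg)
      fix Y assume Y: "Y \<in> carrier Q \<and> \<pi> x \<oplus>\<^bsub>Q\<^esub> Y = \<zero>\<^bsub>Q\<^esub> \<and> Y \<oplus>\<^bsub>Q\<^esub> \<pi> x = \<zero>\<^bsub>Q\<^esub>"
      then obtain y where y: "y \<in> V" "Y = \<pi> y" by (auto simp: carr)
      have yc: "y \<in> carrier M" using VD(1)[OF y(1)] .
      have "\<pi> (y \<oplus>\<^bsub>M\<^esub> x) = \<pi> \<zero>\<^bsub>M\<^esub>" using Y y x by (simp add: add zero)
      then have "y \<oplus>\<^bsub>M\<^esub> x \<ominus>\<^bsub>M\<^esub> \<zero>\<^bsub>M\<^esub> \<in> U" using ker VD(2) VD(3)[OF y(1) x] by blast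
      moreover have "y \<oplus>\<^bsub>M\<^esub> x \<ominus>\<^bsub>M\<^esub> \<zero>\<^bsub>M\<^esub> = y \<ominus>\<^bsub>M\<^esub> (\<ominus>\<^bsub>M\<^esub> x)"
        using xc yc by (simp add: M.minus_eq)
      ultimately show "Y = \<pi> (\<ominus>\<^bsub>M\<^esub> x)" using ker[OF y(1) VD(4)[OF x]] y(2) by simp
    qed
    then show ?thesis by (simp add: m_inv_def)
  qed
  have sub: "?P' (\<pi> ` X)" if X: "?P X" "X \<subseteq> V" for X
  proof -
    note XD = stable_subgroupD[OF X(1)]
    show ?thesis
    proof (intro submodule.intro subgroup.intro submodule_axioms.intro; (elim imageE)?)
      show "\<pi> ` X \<subseteq> carrier (add_monoid Q)" using X(2) by (auto simp: carr)
      show "Z \<otimes>\<^bsub>add_monoid Q\<^esub> W \<in> \<pi> ` X" if "Z = \<pi> z" "z \<in> X" "W = \<pi> w" "w \<in> X" for Z W z w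
      proof -
        have "z \<in> V" "w \<in> V" using that X(2) by auto
        then show ?thesis using that XD(3) by (simp add: add)
      qed
      show "\<one>\<^bsub>add_monoid Q\<^esub> \<in> \<pi> ` X" using XD(2) by (simp add: zero)
      show "inv\<^bsub>add_monoid Q\<^esub> Z \<in> \<pi> ` X" if "Z = \<pi> z" "z \<in> X" for Z z
        unfolding that(1) using inv[of z] that(2) X(2) XD(4) by (simp add: subsetD)
      show "a \<odot>\<^bsub>Q\<^esub> Z \<in> \<pi> ` X" if "a \<in> carrier A" "Z = \<pi> z" "z \<in> X" for a Z z
      proof -
        have "a \<odot>\<^bsub>S\<^esub> \<one>\<^bsub>S\<^esub> \<in> \<Omega>" using that(1) \<omega> by blast
        then have "(a \<odot>\<^bsub>S\<^esub> \<one>\<^bsub>S\<^esub>) \<odot>\<^bsub>M\<^esub> z \<in> X" using XD(5) that(3) by blast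
        moreover have "z \<in> V" using that(3) X(2) by blast
        ultimately show ?thesis using that smult by simp
      qed
    qed
  qed
  have pre: "?P {v \<in> V. \<pi> v \<in> N}" if N: "?P' N" for N
    unfolding stable_subgroup_def
  proof (intro conjI ballI subsetI)
    note ND = submoduleD[OF N]
    show "x \<in> carrier M" if "x \<in> {v \<in> V. \<pi> v \<in> N}" for x using that VD(1) by blast
    show "\<zero>\<^bsub>M\<^esub> \<in> {v \<in> V. \<pi> v \<in> N}" using ND(2) VD(2) by (simp add: zero)
    show "x \<oplus>\<^bsub>M\<^esub> y \<in> {v \<in> V. \<pi> v \<in> N}" if "x \<in> {v \<in> V. \<pi> v \<in> N}" "y \<in> {v \<in> V. \<pi> v \<in> N}" for x y
      using that ND(3)[of "\<pi> x" "\<pi> y"] VD(3) by (simp add: add)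
    show om: "w \<odot>\<^bsub>M\<^esub> x \<in> {v \<in> V. \<pi> v \<in> N}" if w: "w \<in> \<Omega>" and x: "x \<in> {v \<in> V. \<pi> v \<in> N}" for w x
    proof -
      obtain a where a: "a \<in> carrier A" "w = a \<odot>\<^bsub>S\<^esub> \<one>\<^bsub>S\<^esub>" using w \<omega> by blast
      then show ?thesis using x ND(4)[OF a(1), of "\<pi> x"] VD(5)[OF w, of x] smult[OF a(1), of x] by simp
    qed
    show "\<ominus>\<^bsub>M\<^esub> x \<in> {v \<in> V. \<pi> v \<in> N}" if x: "x \<in> {v \<in> V. \<pi> v \<in> N}" for x
    proof -
      have "(\<ominus>\<^bsub>A\<^esub> \<one>\<^bsub>A\<^esub>) \<odot>\<^bsub>S\<^esub> \<one>\<^bsub>S\<^esub> \<in> \<Omega>" using \<omega> by blast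
      moreover have "((\<ominus>\<^bsub>A\<^esub> \<one>\<^bsub>A\<^esub>) \<odot>\<^bsub>S\<^esub> \<one>\<^bsub>S\<^esub>) \<odot>\<^bsub>M\<^esub> x = \<ominus>\<^bsub>M\<^esub> x"
        using x VD(1) by (simp add: alg.smult_l_minus smult_l_minus)
      ultimately show ?thesis using om[OF _ x] by metis
    qed
  qed
  have ml: "module_length A Q = chain_length ?P' (\<pi> ` U) (\<pi> ` V)"
  proof -
    have "\<pi> ` U = {\<pi> \<zero>\<^bsub>M\<^esub>}"
    proof (intro equalityI subsetI)
      fix X assume "X \<in> \<pi> ` U"
      then obtain u where u: "u \<in> U" "X = \<pi> u" by blast
      have "u \<ominus>\<^bsub>M\<^esub> \<zero>\<^bsub>M\<^esub> = u" using UD(1)[OF u(1)] by (simp add: M.minus_eq)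
      then show "X \<in> {\<pi> \<zero>\<^bsub>M\<^esub>}" using u ker[of u "\<zero>\<^bsub>M\<^esub>"] U(2) VD(2) by auto
    qed (use UD(2) in simp)
    then show ?thesis unfolding module_length_def chain_length_eq_sup_sequences by (simp add: zero carr)
  qed
  have image_strict: "\<pi> ` X \<subset> \<pi> ` Y" if X: "?P X" "?P Y" "U \<subseteq> X" "X \<subset> Y" "Y \<subseteq> V" for X Y
  proof -
    obtain y where y: "y \<in> Y" "y \<notin> X" using X(4) by blast
    have "\<pi> y \<notin> \<pi> ` X"
    proof
      assume "\<pi> y \<in> \<pi> ` X"
      then obtain x where x: "x \<in> X" "\<pi> y = \<pi> x" by blast
      have V': "x \<in> V" "y \<in> V" using x y X by auto
      then have "y \<ominus>\<^bsub>M\<^esub> x \<in> X" using ker[of y x] x(2) X(3) by blast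
      then have "(y \<ominus>\<^bsub>M\<^esub> x) \<oplus>\<^bsub>M\<^esub> x \<in> X" using x(1) by (rule stable_subgroupD(3)[OF X(1)])
      moreover have "(y \<ominus>\<^bsub>M\<^esub> x) \<oplus>\<^bsub>M\<^esub> x = y"
        using VD(1) V' by (simp add: M.minus_eq M.a_assoc M.l_neg)
      ultimately show False using y(2) by simp
    qed
    then show ?thesis using X(4) y(1) by blast
  qed
  have pre_U: "{v \<in> V. \<pi> v \<in> \<pi> ` U} = U"
  proof (intro equalityI subsetI)
    fix v assume v: "v \<in> {v \<in> V. \<pi> v \<in> \<pi> ` U}"
    then obtain u where u: "u \<in> U" "\<pi> v = \<pi> u" by blast
    have V': "v \<in> V" "u \<in> V" using u v U(2) by auto
    have "(v \<ominus>\<^bsub>M\<^esub> u) \<oplus>\<^bsub>M\<^esub> u \<in> U" using UD(3) ker[OF V'] u by blast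
    moreover have "(v \<ominus>\<^bsub>M\<^esub> u) \<oplus>\<^bsub>M\<^esub> u = v" using VD(1) V' by (simp add: M.minus_eq M.a_assoc M.l_neg)
    ultimately show "v \<in> U" by simp
  qed (use U(2) in auto)
  have "alen U V \<le> chain_length ?P' (\<pi> ` U) (\<pi> ` V)"
    by (rule chain_length_transport[of ?P U V ?P' "\<lambda>X. \<pi> ` X"]) (use sub image_strict in auto)
  moreover have "chain_length ?P' (\<pi> ` U) (\<pi> ` V) \<le> alen U V"
  proof (rule chain_length_transport[of ?P' "\<pi> ` U" "\<pi> ` V" ?P "\<lambda>N. {v \<in> V. \<pi> v \<in> N}"])
    show "{v \<in> V. \<pi> v \<in> X} \<subset> {v \<in> V. \<pi> v \<in> Y}" if "X \<subset> Y" "Y \<subseteq> \<pi> ` V" for X Y using that by blast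
  qed (use pre pre_U in auto)
  ultimately show ?thesis unfolding ml by (rule antisym[rotated])
qed

abbreviation quot_mod :: "'m set \<Rightarrow> 'm set \<Rightarrow> ('s, 'm set) module" where
  "quot_mod L L' \<equiv> quotient_module (M\<lparr>carrier := L'\<rparr>) L"

lemma component_length_quotient:
  assumes L: "graded_sub L" "graded_sub L'" "L \<subseteq> L'"
  shows "component_length A S (quot_mod L L') (quotient_grading (M\<lparr>carrier := L'\<rparr>) L (\<lambda>n. grM n \<inter> L')) n =
    alen (L \<inter> grM n) (L' \<inter> grM n)"
proof -
  have stL: "stable_subgroup M (carrier S) L" by (rule graded_subD(1)[OF L(1)])
  have c: "x \<in> carrier M" if "x \<in> L' \<inter> grM n" for x using that Mgr.gr_closed by blast
  have V: "stable_subgroup M \<Omega> (L' \<inter> grM n)" by (rule stable_section[OF L(2)])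
  show ?thesis
    unfolding component_length_def
  proof (rule module_length_image[OF V stable_section[OF L(1)], where \<pi> = "\<lambda>x. L +>\<^bsub>M\<^esub> x"])
    let ?Q = "restrict_scalars S (quot_mod L L')\<lparr>carrier :=
      quotient_grading (M\<lparr>carrier := L'\<rparr>) L (\<lambda>n. grM n \<inter> L') n\<rparr>"
    show "L \<inter> grM n \<subseteq> L' \<inter> grM n" using L(3) by blast
    show "carrier ?Q = (\<lambda>x. L +>\<^bsub>M\<^esub> x) ` (L' \<inter> grM n)"
      by (auto simp: quotient_grading_def)
    show "\<zero>\<^bsub>?Q\<^esub> = L +>\<^bsub>M\<^esub> \<zero>\<^bsub>M\<^esub>" by (simp add: restrict_scalars_def quotient_module_def coset_zero[OF stL])
    show "(L +>\<^bsub>M\<^esub> x) \<oplus>\<^bsub>?Q\<^esub> (L +>\<^bsub>M\<^esub> y) = L +>\<^bsub>M\<^esub> (x \<oplus>\<^bsub>M\<^esub> y)" if "x \<in> L' \<inter> grM n" "y \<in> L' \<inter> grM n" for x y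
      using coset_add[OF stL c[OF that(1)] c[OF that(2)]]
      by (simp add: restrict_scalars_def quotient_module_def)
    show "a \<odot>\<^bsub>?Q\<^esub> (L +>\<^bsub>M\<^esub> x) = L +>\<^bsub>M\<^esub> ((a \<odot>\<^bsub>S\<^esub> \<one>\<^bsub>S\<^esub>) \<odot>\<^bsub>M\<^esub> x)" if "a \<in> carrier A" "x \<in> L' \<inter> grM n" for a x
      using coset_smult[OF stL c[OF that(2)], of "a \<odot>\<^bsub>S\<^esub> \<one>\<^bsub>S\<^esub>"] that(1)
      by (simp add: restrict_scalars_def quotient_module_def)
    show "L +>\<^bsub>M\<^esub> x = L +>\<^bsub>M\<^esub> y \<longleftrightarrow> x \<ominus>\<^bsub>M\<^esub> y \<in> L \<inter> grM n" if "x \<in> L' \<inter> grM n" "y \<in> L' \<inter> grM n" for x y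
      using coset_eq_iff[OF stL c[OF that(1)] c[OF that(2)]] that Mgr.gr_add Mgr.gr_inv
      by (simp add: M.minus_eq)
  qed
qed

lemma component_length_self:
  "component_length A S M grM n = alen ({\<zero>\<^bsub>M\<^esub>} \<inter> grM n) (carrier M \<inter> grM n)"
proof -
  have c: "x \<in> carrier M" if "x \<in> grM n" for x using that by (rule Mgr.gr_closed)
  have eq: "{\<zero>\<^bsub>M\<^esub>} \<inter> grM n = {\<zero>\<^bsub>M\<^esub>}" "carrier M \<inter> grM n = grM n" using c by auto
  show ?thesis
    unfolding component_length_def eq
  proof (rule module_length_image[OF stable_gr stable_zero[OF scalars_carrier], where \<pi> = "\<lambda>x. x"])
    show "x = y \<longleftrightarrow> x \<ominus>\<^bsub>M\<^esub> y \<in> {\<zero>\<^bsub>M\<^esub>}" if "x \<in> grM n" "y \<in> grM n" for x y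
    proof -
      have "x = (x \<ominus>\<^bsub>M\<^esub> y) \<oplus>\<^bsub>M\<^esub> y" "y \<ominus>\<^bsub>M\<^esub> y = \<zero>\<^bsub>M\<^esub>"
        using c[OF that(1)] c[OF that(2)] by (simp_all add: M.minus_eq M.a_assoc M.l_neg M.r_neg)
      then show ?thesis using c[OF that(2)] by (metis M.l_zero singleton_iff)
    qed
  qed (auto simp: restrict_scalars_def)
qed

lemma mixed_mult_eq_hilbert_coeffs:
  assumes L: "graded_sub L" "graded_sub L'" "L \<subseteq> L'"
    and len: "\<And>n. component_length A S Q grQ n = alen (L \<inter> grM n) (L' \<inter> grM n)"
  shows "mixed_mult A S Q grQ = hilbert_coeffs L L'"
proof -
  have "is_hilbert_coeffs A S Q grQ c \<longleftrightarrow> eventually_poly (hilb L L') c" for c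
    using section_finite_length[OF L(1,2)]
    unfolding is_hilbert_coeffs_def eventually_poly_def finite_coeffs_def len hilb_def
      numerical_poly_def binomial_basis_def by simp
  then show ?thesis unfolding mixed_mult_def hilbert_coeffs_def by presburger
qed

section \<open>Supports and annihilators\<close>

lemma stable_module_span: "X \<subseteq> carrier M \<Longrightarrow> stable_subgroup M (carrier S) (module_span S M X)"
  and module_span_incl: "X \<subseteq> module_span S M X"
  and module_span_least: "stable_subgroup M (carrier S) N \<Longrightarrow> X \<subseteq> N \<Longrightarrow> module_span S M X \<subseteq> N"
proof -
  show "X \<subseteq> module_span S M X" by (auto simp: module_span_def)
  show "stable_subgroup M (carrier S) N \<Longrightarrow> X \<subseteq> N \<Longrightarrow> module_span S M X \<subseteq> N"
    unfolding module_span_def submodule_iff_stable by (rule Inter_lower) simp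
  assume X: "X \<subseteq> carrier M"
  let ?F = "{N. stable_subgroup M (carrier S) N \<and> X \<subseteq> N}"
  have ne: "carrier M \<in> ?F" using X stable_carrier[OF order_refl] by simp
  have D: "stable_subgroup M (carrier S) N" if "N \<in> ?F" for N using that by simp
  show "stable_subgroup M (carrier S) (module_span S M X)"
    unfolding module_span_def submodule_iff_stable stable_subgroup_def[of M "carrier S" "\<Inter> ?F"]
  proof (intro conjI ballI subsetI InterI)
    show "x \<in> carrier M" if "x \<in> \<Inter> ?F" for x using that ne by blast
    show "\<zero>\<^bsub>M\<^esub> \<in> N" if "N \<in> ?F" for N using stable_subgroupD(2)[OF D[OF that]] .
    show "x \<oplus>\<^bsub>M\<^esub> y \<in> N" if "x \<in> \<Inter> ?F" "y \<in> \<Inter> ?F" "N \<in> ?F" for x y N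
      using stable_subgroupD(3)[OF D[OF that(3)], of x y] that by blast
    show "\<ominus>\<^bsub>M\<^esub> x \<in> N" if "x \<in> \<Inter> ?F" "N \<in> ?F" for x N
      using stable_subgroupD(4)[OF D[OF that(2)], of x] that by blast
    show "a \<odot>\<^bsub>M\<^esub> x \<in> N" if "a \<in> carrier S" "x \<in> \<Inter> ?F" "N \<in> ?F" for a x N
      using stable_subgroupD(5)[OF D[OF that(3)] that(1), of x] that by blast
  qed
qed

text \<open>Nakayama's lemma over the local ring at \<open>P\<close>, with denominators cleared.  The generators are removed one
  at a time: if \<open>tM\<close> lies in the span of \<open>g\<close> and \<open>F\<close>, then \<open>t t\<^sub>0 g = a g + w\<close> with
  \<open>a \<in> P\<close> and \<open>w\<close> in the span of \<open>F\<close>, and \<open>u = t t\<^sub>0 - a\<close> is a denominator that moves \<open>g\<close> into the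
  span of \<open>F\<close>.\<close>

lemma nakayama_prime:
  assumes P: "primeideal P S" and J: "J \<subseteq> P" and F: "finite F" "F \<subseteq> carrier M"
    and t0: "t0 \<in> carrier S - P"
    and sub: "\<And>v. v \<in> carrier M \<Longrightarrow> t0 \<odot>\<^bsub>M\<^esub> v \<in> module_span S M {a \<odot>\<^bsub>M\<^esub> v | a v. a \<in> J \<and> v \<in> carrier M}"
    and t: "t \<in> carrier S - P" "\<And>v. v \<in> carrier M \<Longrightarrow> t \<odot>\<^bsub>M\<^esub> v \<in> module_span S M F"
  shows "\<exists>s\<in>carrier S - P. \<forall>v\<in>carrier M. s \<odot>\<^bsub>M\<^esub> v = \<zero>\<^bsub>M\<^esub>"
  using F t
proof (induction F arbitrary: t rule: finite_induct)
  case empty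
  have "module_span S M {} \<subseteq> {\<zero>\<^bsub>M\<^esub>}" by (rule module_span_least) (simp_all add: stable_zero)
  then show ?case using empty by blast
next
  case (insert g F)
  interpret P: primeideal P S by (rule P)
  let ?sp = "module_span S M F" and ?JM = "module_span S M {a \<odot>\<^bsub>M\<^esub> v | a v. a \<in> J \<and> v \<in> carrier M}"
  have g: "g \<in> carrier M" and F: "F \<subseteq> carrier M" using insert.prems by auto
  have tc: "t \<in> carrier S" "t \<notin> P" "t0 \<in> carrier S" "t0 \<notin> P" using insert.prems t0 by auto
  have sp: "stable_subgroup M (carrier S) ?sp" by (rule stable_module_span[OF F])
  note spD = stable_subgroupD[OF sp]
  have mult: "stable_subgroup M (carrier S) ((\<lambda>a. a \<odot>\<^bsub>M\<^esub> g) ` I)" if "ideal I S" for I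
    by (rule stable_multiples[OF that g])
  have split: "\<exists>b\<in>carrier S. \<exists>w\<in>?sp. t \<odot>\<^bsub>M\<^esub> v = b \<odot>\<^bsub>M\<^esub> g \<oplus>\<^bsub>M\<^esub> w" if v: "v \<in> carrier M" for v
  proof -
    let ?W = "((\<lambda>a. a \<odot>\<^bsub>M\<^esub> g) ` carrier S) <+>\<^bsub>M\<^esub> ?sp"
    note m = mult[OF R.oneideal]
    have "g \<in> (\<lambda>a. a \<odot>\<^bsub>M\<^esub> g) ` carrier S" using g by (intro image_eqI[of _ _ "\<one>\<^bsub>S\<^esub>"]) simp_all
    then have "insert g F \<subseteq> ?W"
      using set_add_upper[OF m sp] module_span_incl[of F] by blast
    then have "module_span S M (insert g F) \<subseteq> ?W"
      by (rule module_span_least[OF stable_set_add[OF order_refl m sp]])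
    then have "t \<odot>\<^bsub>M\<^esub> v \<in> ?W" using insert.prems(3)[OF v] by blast
    then show ?thesis by (auto elim!: set_addE)
  qed
  let ?W = "((\<lambda>a. a \<odot>\<^bsub>M\<^esub> g) ` P) <+>\<^bsub>M\<^esub> ?sp"
  have W: "stable_subgroup M (carrier S) ?W"
    by (rule stable_set_add[OF order_refl mult[OF P.is_ideal] sp])
  have "?JM \<subseteq> {x \<in> carrier M. t \<odot>\<^bsub>M\<^esub> x \<in> ?W}"
  proof (rule module_span_least)
    show "stable_subgroup M (carrier S) {x \<in> carrier M. t \<odot>\<^bsub>M\<^esub> x \<in> ?W}"
      by (intro stable_preimage order_refl stable_carrier W tc)
    show "{a \<odot>\<^bsub>M\<^esub> v | a v. a \<in> J \<and> v \<in> carrier M} \<subseteq> {x \<in> carrier M. t \<odot>\<^bsub>M\<^esub> x \<in> ?W}"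
    proof
      fix x assume "x \<in> {a \<odot>\<^bsub>M\<^esub> v | a v. a \<in> J \<and> v \<in> carrier M}"
      then obtain a v where av: "a \<in> J" "v \<in> carrier M" "x = a \<odot>\<^bsub>M\<^esub> v" by blast
      have a: "a \<in> P" "a \<in> carrier S" using av(1) J P.Icarr by auto
      obtain b w where bw: "b \<in> carrier S" "w \<in> ?sp" "t \<odot>\<^bsub>M\<^esub> v = b \<odot>\<^bsub>M\<^esub> g \<oplus>\<^bsub>M\<^esub> w"
        using split[OF av(2)] by blast
      have "t \<odot>\<^bsub>M\<^esub> x = a \<odot>\<^bsub>M\<^esub> (t \<odot>\<^bsub>M\<^esub> v)"
        using tc a av by (simp add: R.m_comm flip: smult_assoc1)
      also have "\<dots> = (a \<otimes>\<^bsub>S\<^esub> b) \<odot>\<^bsub>M\<^esub> g \<oplus>\<^bsub>M\<^esub> a \<odot>\<^bsub>M\<^esub> w"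
        using a bw spD(1)[OF bw(2)] g by (simp add: smult_r_distr smult_assoc1)
      also have "\<dots> \<in> ?W"
        using P.I_r_closed[OF a(1) bw(1)] spD(5)[OF a(2) bw(2)] by (intro set_addI) auto
      finally show "x \<in> {x \<in> carrier M. t \<odot>\<^bsub>M\<^esub> x \<in> ?W}" using a av by simp
    qed
  qed
  then have "t \<odot>\<^bsub>M\<^esub> (t0 \<odot>\<^bsub>M\<^esub> g) \<in> ?W" using sub[OF g] by blast
  then obtain a w where aw: "a \<in> P" "w \<in> ?sp" "t \<odot>\<^bsub>M\<^esub> (t0 \<odot>\<^bsub>M\<^esub> g) = a \<odot>\<^bsub>M\<^esub> g \<oplus>\<^bsub>M\<^esub> w"
    by (auto elim!: set_addE)
  have ac: "a \<in> carrier S" and wc: "w \<in> carrier M" using P.Icarr[OF aw(1)] spD(1)[OF aw(2)] .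
  define u where "u = t \<otimes>\<^bsub>S\<^esub> t0 \<ominus>\<^bsub>S\<^esub> a"
  have uc: "u \<in> carrier S" using tc ac by (simp add: u_def)
  have tt0: "t \<otimes>\<^bsub>S\<^esub> t0 \<notin> P" using P.I_prime tc by blast
  have "u \<notin> P"
  proof
    assume "u \<in> P"
    then have "u \<oplus>\<^bsub>S\<^esub> a \<in> P" using aw(1) by (rule P.a_closed)
    moreover have "u \<oplus>\<^bsub>S\<^esub> a = t \<otimes>\<^bsub>S\<^esub> t0" using tc ac by (simp add: u_def R.minus_eq R.a_assoc R.l_neg)
    ultimately show False using tt0 by simp
  qed
  have "u \<odot>\<^bsub>M\<^esub> g = t \<odot>\<^bsub>M\<^esub> (t0 \<odot>\<^bsub>M\<^esub> g) \<ominus>\<^bsub>M\<^esub> a \<odot>\<^bsub>M\<^esub> g"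
    using tc ac g by (simp add: u_def R.minus_eq M.minus_eq smult_l_distr smult_l_minus smult_assoc1)
  also have "\<dots> = w" using aw(3) ac g wc by (simp add: M.minus_eq M.a_ac M.r_neg2 M.r_neg1 M.r_neg)
  finally have ug: "u \<odot>\<^bsub>M\<^esub> g = w" .
  show ?case
  proof (rule insert.IH[OF F])
    show "u \<otimes>\<^bsub>S\<^esub> t \<in> carrier S - P" using P.I_prime uc tc \<open>u \<notin> P\<close> by blast
    fix v assume v: "v \<in> carrier M"
    obtain b w' where bw: "b \<in> carrier S" "w' \<in> ?sp" "t \<odot>\<^bsub>M\<^esub> v = b \<odot>\<^bsub>M\<^esub> g \<oplus>\<^bsub>M\<^esub> w'"
      using split[OF v] by blast
    have "(u \<otimes>\<^bsub>S\<^esub> t) \<odot>\<^bsub>M\<^esub> v = u \<odot>\<^bsub>M\<^esub> (b \<odot>\<^bsub>M\<^esub> g) \<oplus>\<^bsub>M\<^esub> u \<odot>\<^bsub>M\<^esub> w'"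
      using uc tc v bw g spD(1)[OF bw(2)] by (simp add: smult_assoc1 smult_r_distr)
    also have "u \<odot>\<^bsub>M\<^esub> (b \<odot>\<^bsub>M\<^esub> g) = b \<odot>\<^bsub>M\<^esub> w"
      using uc bw(1) g by (simp add: R.m_comm flip: smult_assoc1 ug)
    finally show "(u \<otimes>\<^bsub>S\<^esub> t) \<odot>\<^bsub>M\<^esub> v \<in> ?sp"
      using spD(3)[OF spD(5)[OF bw(1) aw(2)] spD(5)[OF uc bw(2)]] by simp
  qed
qed

definition annihilator :: "'s set" where
  "annihilator = {a \<in> carrier S. \<forall>v\<in>carrier M. a \<odot>\<^bsub>M\<^esub> v = \<zero>\<^bsub>M\<^esub>}"

text \<open>The fraction with numerator the class of \<open>m\<close> and denominator \<open>1\<close> is nonzero if no denominator kills this class.\<close>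

lemma localization_nonzero:
  assumes P: "primeideal P S" and L: "stable_subgroup M (carrier S) L"
    and m: "m \<in> carrier M" "\<And>u. u \<in> carrier S - P \<Longrightarrow> u \<odot>\<^bsub>M\<^esub> m \<notin> L"
  shows "carrier (localization S (quotient_module M L) P) \<noteq> {\<zero>\<^bsub>localization S (quotient_module M L) P\<^esub>}"
proof
  let ?Q = "quotient_module M L"
  let ?rel = "fraction_rel S ?Q P"
  interpret P: primeideal P S by (rule P)
  have one: "\<one>\<^bsub>S\<^esub> \<in> carrier S - P" using P.one_imp_carrier P.I_notcarr by auto
  have zeroQ: "\<zero>\<^bsub>?Q\<^esub> = L +>\<^bsub>M\<^esub> \<zero>\<^bsub>M\<^esub>" by (simp add: quotient_module_def coset_zero[OF L])
  have smultQ: "a \<odot>\<^bsub>?Q\<^esub> (L +>\<^bsub>M\<^esub> x) = L +>\<^bsub>M\<^esub> (a \<odot>\<^bsub>M\<^esub> x)" if "a \<in> carrier S" "x \<in> carrier M" for a x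
    using coset_smult[OF L that(2,1)] by (simp add: quotient_module_def)
  have carrQ: "L +>\<^bsub>M\<^esub> x \<in> carrier ?Q" if "x \<in> carrier M" for x
    using that by (auto simp: quotient_module_def A_RCOSETS_def')
  assume eq: "carrier (localization S ?Q P) = {\<zero>\<^bsub>localization S ?Q P\<^esub>}"
  have "?rel `` {(L +>\<^bsub>M\<^esub> m, \<one>\<^bsub>S\<^esub>)} \<in> carrier (localization S ?Q P)"
    using carrQ[OF m(1)] one by (auto simp: localization_def Let_def intro!: quotientI)
  then have "?rel `` {(L +>\<^bsub>M\<^esub> m, \<one>\<^bsub>S\<^esub>)} = ?rel `` {(L +>\<^bsub>M\<^esub> \<zero>\<^bsub>M\<^esub>, \<one>\<^bsub>S\<^esub>)}"
    unfolding eq by (simp add: localization_def Let_def zeroQ)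
  moreover have "((L +>\<^bsub>M\<^esub> m, \<one>\<^bsub>S\<^esub>), (L +>\<^bsub>M\<^esub> m, \<one>\<^bsub>S\<^esub>)) \<in> ?rel"
    using carrQ[OF m(1)] one by (auto simp: fraction_rel_def)
  ultimately have "((L +>\<^bsub>M\<^esub> \<zero>\<^bsub>M\<^esub>, \<one>\<^bsub>S\<^esub>), (L +>\<^bsub>M\<^esub> m, \<one>\<^bsub>S\<^esub>)) \<in> ?rel" by blast
  then obtain u where u: "u \<in> carrier S - P"
    "u \<odot>\<^bsub>?Q\<^esub> (\<one>\<^bsub>S\<^esub> \<odot>\<^bsub>?Q\<^esub> (L +>\<^bsub>M\<^esub> \<zero>\<^bsub>M\<^esub>)) = u \<odot>\<^bsub>?Q\<^esub> (\<one>\<^bsub>S\<^esub> \<odot>\<^bsub>?Q\<^esub> (L +>\<^bsub>M\<^esub> m))"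
    by (auto simp: fraction_rel_def)
  then have "L +>\<^bsub>M\<^esub> (u \<odot>\<^bsub>M\<^esub> m) = L +>\<^bsub>M\<^esub> \<zero>\<^bsub>M\<^esub>" using m(1) by (simp add: smultQ)
  then have "u \<odot>\<^bsub>M\<^esub> m \<ominus>\<^bsub>M\<^esub> \<zero>\<^bsub>M\<^esub> \<in> L" using coset_eq_iff[OF L] u(1) m(1) by simp
  moreover have "u \<odot>\<^bsub>M\<^esub> m \<ominus>\<^bsub>M\<^esub> \<zero>\<^bsub>M\<^esub> = u \<odot>\<^bsub>M\<^esub> m" using u(1) m(1) by (simp add: M.minus_eq)
  ultimately show False using m(2)[OF u(1)] by simp
qed

lemma seq_submodule_stable:
  "set xs \<subseteq> carrier S \<Longrightarrow> stable_subgroup M (carrier S) (seq_submodule S M xs)"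
  unfolding seq_submodule_def by (rule stable_module_span) auto

text \<open>If \<open>P\<close> were not in the support, a single denominator would map the finitely many generators of \<open>M\<close>, hence all of \<open>M\<close>, into
  \<open>\<bold>xM\<close>; by Nakayama's lemma some denominator would annihilate \<open>M\<close>.\<close>

lemma support_of_quotient:
  assumes xs: "set xs \<subseteq> carrier S" and P: "P \<in> Proj S grS" "annihilator \<union> set xs \<subseteq> P"
  shows "P \<in> Supp_pp S grS (quotient_module M (seq_submodule S M xs))"
proof -
  let ?L = "seq_submodule S M xs"
  have prime: "primeideal P S" using P(1) by (simp add: Proj_def)
  interpret P: primeideal P S by (rule prime)
  have L: "stable_subgroup M (carrier S) ?L" by (rule seq_submodule_stable[OF xs])
  note LD = stable_subgroupD[OF L]
  have one: "\<one>\<^bsub>S\<^esub> \<in> carrier S - P" using P.one_imp_carrier P.I_notcarr by auto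
  obtain F where F: "F \<subseteq> carrier M" "finite F" "carrier M = module_span S M F"
    using fin_gen unfolding fin_gen_module_def by blast
  have "\<exists>m\<in>carrier M. \<forall>u\<in>carrier S - P. u \<odot>\<^bsub>M\<^esub> m \<notin> ?L"
  proof (rule ccontr)
    assume "\<not> (\<exists>m\<in>carrier M. \<forall>u\<in>carrier S - P. u \<odot>\<^bsub>M\<^esub> m \<notin> ?L)"
    then have ex: "\<exists>u\<in>carrier S - P. u \<odot>\<^bsub>M\<^esub> m \<in> ?L" if "m \<in> carrier M" for m using that by blast
    have "\<exists>u\<in>carrier S - P. \<forall>f\<in>F. u \<odot>\<^bsub>M\<^esub> f \<in> ?L"
      using F(2,1)
    proof (induction F rule: finite_induct)
      case empty then show ?case using one by blast
    next
      case (insert g F)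
      then obtain u where u: "u \<in> carrier S - P" "\<forall>f\<in>F. u \<odot>\<^bsub>M\<^esub> f \<in> ?L" by auto
      obtain w where w: "w \<in> carrier S - P" "w \<odot>\<^bsub>M\<^esub> g \<in> ?L" using ex insert.prems by blast
      have "u \<otimes>\<^bsub>S\<^esub> w \<in> carrier S - P" using P.I_prime u(1) w(1) by blast
      moreover have "(u \<otimes>\<^bsub>S\<^esub> w) \<odot>\<^bsub>M\<^esub> g \<in> ?L"
        using LD(5)[of u "w \<odot>\<^bsub>M\<^esub> g"] u(1) w insert.prems by (simp add: smult_assoc1)
      moreover have "(u \<otimes>\<^bsub>S\<^esub> w) \<odot>\<^bsub>M\<^esub> f \<in> ?L" if "f \<in> F" for f
      proof -
        have "(u \<otimes>\<^bsub>S\<^esub> w) \<odot>\<^bsub>M\<^esub> f = w \<odot>\<^bsub>M\<^esub> (u \<odot>\<^bsub>M\<^esub> f)"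
          using u(1) w(1) that insert.prems R.m_comm[of u w] smult_assoc1[of w u f] by auto
        then show ?thesis using LD(5)[of w "u \<odot>\<^bsub>M\<^esub> f"] u(2) w(1) that by simp
      qed
      ultimately show ?case by blast
    qed
    then obtain u where u: "u \<in> carrier S - P" "\<forall>f\<in>F. u \<odot>\<^bsub>M\<^esub> f \<in> ?L" by blast
    have "module_span S M F \<subseteq> {v \<in> carrier M. u \<odot>\<^bsub>M\<^esub> v \<in> ?L}"
      using u F(1) by (intro module_span_least stable_preimage stable_carrier L order_refl) auto
    then have uL: "u \<odot>\<^bsub>M\<^esub> v \<in> ?L" if "v \<in> carrier M" for v using that unfolding F(3)[symmetric] by blast
    have "\<exists>s\<in>carrier S - P. \<forall>v\<in>carrier M. s \<odot>\<^bsub>M\<^esub> v = \<zero>\<^bsub>M\<^esub>"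
    proof (rule nakayama_prime[OF prime _ F(2,1) u(1) _ one])
      show "set xs \<subseteq> P" using P(2) by blast
      show "u \<odot>\<^bsub>M\<^esub> v \<in> module_span S M {a \<odot>\<^bsub>M\<^esub> v | a v. a \<in> set xs \<and> v \<in> carrier M}" if "v \<in> carrier M" for v
        using uL[OF that] by (simp add: seq_submodule_def)
      show "\<one>\<^bsub>S\<^esub> \<odot>\<^bsub>M\<^esub> v \<in> module_span S M F" if "v \<in> carrier M" for v
        using that F(3) by simp
    qed
    then show False using P(2) by (auto simp: annihilator_def)
  qed
  then obtain m where "m \<in> carrier M" "\<And>u. u \<in> carrier S - P \<Longrightarrow> u \<odot>\<^bsub>M\<^esub> m \<notin> ?L" by blast
  from localization_nonzero[OF prime L this] show ?thesis using P(1) by (simp add: Supp_pp_def)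
qed

end

section \<open>The additivity formula\<close>

lemma chain_dim_le_zero:
  assumes "chain_dim X \<le> 0" "P \<in> X" "P' \<in> X" shows "\<not> P \<subset> P'"
proof
  assume "P \<subset> P'"
  let ?C = "\<lambda>i :: nat. if i = 0 then P else P'"
  have "\<exists>C :: nat \<Rightarrow> 'a set. (\<forall>i\<le>1. C i \<in> X) \<and> (\<forall>i<1. C i \<subset> C (Suc i))"
    using assms(2,3) \<open>P \<subset> P'\<close> by (intro exI[of _ ?C]) auto
  then have "ereal (real 1) \<in> {ereal (real n) | n. \<exists>C :: nat \<Rightarrow> 'a set.
      (\<forall>i\<le>n. C i \<in> X) \<and> (\<forall>i<n. C i \<subset> C (Suc i))}" by blast
  then have "ereal (real 1) \<le> chain_dim X" unfolding chain_dim_def by (rule Sup_upper)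
  then have "ereal (real 1) \<le> 0" using assms(1) by (rule order_trans)
  then show False by simp
qed

lemma seq_type_take_Suc:
  "i < length js \<Longrightarrow> seq_type (take (Suc i) js) = seq_type (take i js) + axis (js ! i) 1"
  by (simp add: vec_eq_iff seq_type_def axis_def take_Suc_conv_app_nth)

lemma seq_type_drop: "seq_type js = seq_type (take i js) + seq_type (drop i js)"
proof -
  have "seq_type (xs @ ys) = seq_type xs + seq_type ys" for xs ys :: "'a list"
    by (simp add: vec_eq_iff seq_type_def)
  from this[of "take i js" "drop i js"] show ?thesis by simp
qed

context fg_graded
begin

lemma seq_submodule_Suc:
  assumes xs: "set xs \<subseteq> carrier S" and i: "i < length xs"
  shows "seq_submodule S M (take (Suc i) xs) =
    seq_submodule S M (take i xs) <+>\<^bsub>M\<^esub> ((\<lambda>v. (xs ! i) \<odot>\<^bsub>M\<^esub> v) ` carrier M)"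
proof
  let ?L = "seq_submodule S M (take i xs)" and ?z = "xs ! i"
  let ?L' = "seq_submodule S M (take (Suc i) xs)"
  have z: "?z \<in> carrier S" using xs i by auto
  have sub: "set (take i xs) \<subseteq> carrier S" "set (take (Suc i) xs) \<subseteq> carrier S"
    using xs set_take_subset by fastforce+
  have set: "set (take (Suc i) xs) = insert ?z (set (take i xs))"
    using i by (simp add: take_Suc_conv_app_nth)
  have L: "stable_subgroup M (carrier S) ?L" by (rule seq_submodule_stable[OF sub(1)])
  have L': "stable_subgroup M (carrier S) ?L'" by (rule seq_submodule_stable[OF sub(2)])
  have zM: "stable_subgroup M (carrier S) ((\<lambda>v. ?z \<odot>\<^bsub>M\<^esub> v) ` carrier M)"
    by (intro stable_scaled order_refl stable_carrier z)
  let ?G = "\<lambda>zs. {x \<odot>\<^bsub>M\<^esub> m | x m. x \<in> set zs \<and> m \<in> carrier M}"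
  have incl: "?G zs \<subseteq> seq_submodule S M zs" for zs
    unfolding seq_submodule_def by (rule module_span_incl)
  show "?L' \<subseteq> ?L <+>\<^bsub>M\<^esub> ((\<lambda>v. ?z \<odot>\<^bsub>M\<^esub> v) ` carrier M)"
    unfolding seq_submodule_def[of S M "take (Suc i) xs"]
  proof (rule module_span_least[OF stable_set_add[OF order_refl L zM]])
    show "?G (take (Suc i) xs) \<subseteq> ?L <+>\<^bsub>M\<^esub> ((\<lambda>v. ?z \<odot>\<^bsub>M\<^esub> v) ` carrier M)"
      using incl[of "take i xs"] set_add_upper[OF L zM] unfolding set by blast
  qed
  show "?L <+>\<^bsub>M\<^esub> ((\<lambda>v. ?z \<odot>\<^bsub>M\<^esub> v) ` carrier M) \<subseteq> ?L'"
  proof (rule set_add_least[OF L'])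
    show "?L \<subseteq> ?L'" unfolding seq_submodule_def[of S M "take i xs"]
      by (rule module_span_least[OF L']) (use incl[of "take (Suc i) xs"] set in blast)
    show "(\<lambda>v. ?z \<odot>\<^bsub>M\<^esub> v) ` carrier M \<subseteq> ?L'" using incl[of "take (Suc i) xs"] set by blast
  qed
qed

lemma seq_submodule_graded:
  assumes "list_all2 (\<lambda>j x. x \<in> grS (axis j 1)) js xs"
  shows "i \<le> length xs \<Longrightarrow> graded_sub (seq_submodule S M (take i xs))"
proof (induction i)
  case 0
  have "module_span S M {} = {\<zero>\<^bsub>M\<^esub>}"
    using module_span_least[OF stable_zero[OF order_refl], of "{}"]
      stable_subgroupD(2)[OF stable_module_span[of "{}"]] by auto
  then show ?case by (simp add: seq_submodule_def graded_sub_zero)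
next
  case (Suc i)
  have xs: "set xs \<subseteq> carrier S"
    using assms Sgr.gr_closed by (fastforce simp: list_all2_conv_all_nth in_set_conv_nth)
  have "xs ! i \<in> grS (axis (js ! i) 1)" using assms Suc.prems by (auto simp: list_all2_conv_all_nth)
  then show ?case
    using Suc seq_submodule_Suc[OF xs, of i]
    by (simp add: graded_sub_set_add graded_sub_scaled[OF graded_sub_carrier])
qed

end

theorem corollary1p3:
  fixes A :: "'a ring" and \<mm> :: "'a set"
    and S :: "('a, 's) module" and grS :: "nat ^ 'd \<Rightarrow> 's set"
    and M :: "('s, 'm) module" and grM :: "nat ^ 'd \<Rightarrow> 'm set"
    and js :: "'d list" and xs :: "'s list" and k :: "nat ^ 'd"
  assumes "artinian_local_ring A \<mm>" and "infinite (carrier (A Quot \<mm>))"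
    and "fg_standard_graded_algebra A S grS"
    and "graded_module S grS M grM" and "fin_gen_module S M"
    and "mixed_mult_system S grS M js xs k"
  shows "let s = length xs;
      h = (\<lambda>i. seq_type (take i js));
      L = (\<lambda>i. seq_submodule S M (take i xs));
      Q = (\<lambda>i. colon_quotient M (L (i - 1)) (xs ! (i - 1)));
      grQ = (\<lambda>i. colon_quotient_grading M (L (i - 1)) (xs ! (i - 1)) grM);
      len = component_length A S (quotient_module M (L s)) (quotient_grading M (L s) grM)
    in mixed_mult_defined A S M grM k \<and>
      (\<forall>i\<in>{1..s}. mixed_mult_defined A S (Q i) (grQ i) (k - h i)) \<and>
      for_all_large (\<lambda>n. len n \<noteq> \<infinity> \<and>
        mixed_mult A S M grM k =
          int (the_enat (len n)) - (\<Sum>i = 1..s. mixed_mult A S (Q i) (grQ i) (k - h i)))"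
proof -
  interpret fg_graded A \<mm> S grS M grM using assms by (intro fg_graded.intro)
  define L where "L i = seq_submodule S M (take i xs)" for i
  define h where "h i = seq_type (take i js)" for i
  define s where "s = length xs"
  let ?M = "carrier M"
  have deg: "list_all2 (\<lambda>j x. x \<in> grS (axis j 1)) js xs" and k: "seq_type js = k"
    and dim: "chain_dim (Supp_pp S grS (quotient_module M (L s))) \<le> 0"
    using assms(6) by (simp_all add: mixed_mult_system_def is_degree_one_seq_def L_def s_def)
  have len: "length js = s" using list_all2_lengthD[OF deg] by (simp add: s_def)
  have xs: "set xs \<subseteq> carrier S"
    using deg Sgr.gr_closed by (fastforce simp: list_all2_conv_all_nth in_set_conv_nth)
  have xi: "xs ! i \<in> grS (axis (js ! i) 1)" if "i < s" for i
    using deg that by (auto simp: list_all2_conv_all_nth s_def)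
  have Lg: "graded_sub (L i)" if "i \<le> s" for i
    using seq_submodule_graded[OF deg] that by (simp add: L_def s_def)
  have LM: "L i \<subseteq> ?M" if "i \<le> s" for i using graded_subD(4)[OF Lg[OF that]] by blast
  have L0: "L 0 = {\<zero>\<^bsub>M\<^esub>}"
    using module_span_least[OF stable_zero[OF order_refl], of "{}"]
      stable_subgroupD(2)[OF stable_module_span[of "{}"]] by (auto simp: L_def seq_submodule_def)
  have LSuc: "L (Suc i) = L i <+>\<^bsub>M\<^esub> ((\<lambda>v. (xs ! i) \<odot>\<^bsub>M\<^esub> v) ` ?M)" if "i < s" for i
    using seq_submodule_Suc[OF xs, of i] that by (simp add: L_def s_def)
  define K where "K i = {v \<in> ?M. (xs ! i) \<odot>\<^bsub>M\<^esub> v \<in> L i}" for i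
  have Kg: "graded_sub (K i)" and LK: "L i \<subseteq> K i" if i: "i < s" for i
  proof -
    have "i \<le> s" using i by simp
    note D = hilb_difference(1,3)[OF Lg[OF this] graded_sub_carrier LM[OF this] xi[OF i]]
    show "graded_sub (K i)" "L i \<subseteq> K i" using D by (simp_all add: K_def)
  qed
  have none: "\<not> P \<subset> P'"
    if "P \<in> Proj S grS" "P' \<in> Proj S grS" "annihilator \<union> set xs \<subseteq> P" for P P'
  proof
    assume PP': "P \<subset> P'"
    have "P \<in> Supp_pp S grS (quotient_module M (L s))" "P' \<in> Supp_pp S grS (quotient_module M (L s))"
      using support_of_quotient[OF xs that(1,3)] support_of_quotient[OF xs that(2)] that(3) PP'
      by (auto simp: L_def s_def)
    then show False using chain_dim_le_zero[OF dim] PP' by blast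
  qed
  have annS: "annihilator \<subseteq> carrier S" by (auto simp: annihilator_def)
  have ann0: "a \<odot>\<^bsub>M\<^esub> v \<in> L i" if "a \<in> annihilator" "v \<in> ?M" "i \<le> s" for a v i
    using that stable_subgroupD(2)[OF graded_subD(1)[OF Lg[OF that(3)]]] by (simp add: annihilator_def)
  have xsL: "x \<odot>\<^bsub>M\<^esub> v \<in> L i" if "x \<in> set (take i xs)" "v \<in> ?M" for x v i
    using that module_span_incl[of "{x \<odot>\<^bsub>M\<^esub> m | x m. x \<in> set (take i xs) \<and> m \<in> ?M}"]
    unfolding L_def seq_submodule_def by blast
  have h: "k = h i + seq_type (drop i js)" for i using seq_type_drop[of js i] by (simp add: h_def k)
  have hk: "k - h i = seq_type (drop i js)" for i using h[of i] by (simp add: vec_eq_iff)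
  have hSuc: "k - h i = (k - h (Suc i)) + axis (js ! i) 1" if "i < s" for i
  proof -
    have "k = h i + axis (js ! i) 1 + seq_type (drop (Suc i) js)"
      using h[of "Suc i"] seq_type_take_Suc[of i js] that len by (simp add: h_def)
    then show ?thesis using hk[of "Suc i"] by (simp add: vec_eq_iff)
  qed
  define e where "e i = hilbert_coeffs (L i) ?M" for i
  define q where "q i = hilbert_coeffs (L i) (K i)" for i
  have e_vanish: "e 0 g = 0" if "k < g" for g
    unfolding e_def
  proof (rule hilbert_coeffs_vanish[OF deg Lg graded_sub_carrier LM annS])
    show "kills annihilator (L 0) ?M" using ann0[of _ _ 0] by (simp add: kills_def)
    show "seq_type js < g" using that k by simp
  qed (use none in auto)
  \<comment> \<open>The remaining elements \<open>x\<^sub>i\<^sub>+\<^sub>2, \<dots>\<close> form a system for \<open>K\<^sub>i/L\<^sub>i\<close> (indices of the list start at \<open>0\<close>), since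
    \<open>K\<^sub>i/L\<^sub>i\<close> is killed by all earlier ones.\<close>
  have q_vanish: "q i g = 0" if i: "i < s" and g: "k - h (Suc i) < g" for i g
    unfolding q_def
  proof (rule hilbert_coeffs_vanish[of "drop (Suc i) js" "drop (Suc i) xs"])
    show "list_all2 (\<lambda>j x. x \<in> grS (axis j 1)) (drop (Suc i) js) (drop (Suc i) xs)"
      using deg by (rule list_all2_dropI)
    let ?I = "annihilator \<union> set (take (Suc i) xs)"
    show "?I \<subseteq> carrier S" using annS xs set_take_subset[of "Suc i" xs] by blast
    have set: "set (take (Suc i) xs) = insert (xs ! i) (set (take i xs))"
      using i by (simp add: take_Suc_conv_app_nth s_def)
    show "kills ?I (L i) (K i)"
      unfolding kills_def set using ann0[of _ _ i] xsL[of _ i] i by (auto simp: K_def)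
    have "set (take (Suc i) xs) \<union> set (drop (Suc i) xs) = set xs"
      by (metis append_take_drop_id set_append)
    then have I: "?I \<union> set (drop (Suc i) xs) = annihilator \<union> set xs" by blast
    show "\<not> P \<subset> P'" if "P \<in> Proj S grS" "P' \<in> Proj S grS" "?I \<union> set (drop (Suc i) xs) \<subseteq> P" for P P'
      using none[OF that(1,2)] that(3) unfolding I by blast
    show "seq_type (drop (Suc i) js) < g" using g hk by simp
    show "graded_sub (L i)" "graded_sub (K i)" "L i \<subseteq> K i" using Lg Kg LK i by auto
  qed
  \<comment> \<open>The recursion; its last term vanishes, so the right-hand side can be telescoped.\<close>
  have step: "e i (k - h i) = e (Suc i) (k - h (Suc i)) - q i (k - h (Suc i))" if i: "i < s" for i
  proof -
    let ?g = "k - h (Suc i)"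
    have "?g < ?g + axis (js ! i) 1"
      by (auto simp: less_vec_def less_eq_vec_def axis_def intro!: exI[of _ "js ! i"])
    then have "q i (?g + axis (js ! i) 1) = 0" by (rule q_vanish[OF i])
    moreover have "L i \<subseteq> ?M" "graded_sub (L i)" using LM Lg i by auto
    ultimately show ?thesis
      using hilbert_coeffs_recursion[OF _ graded_sub_carrier _ xi[OF i], of "L i" ?g]
      unfolding hSuc[OF i] by (simp add: e_def q_def K_def LSuc[OF i])
  qed
  have sum: "t \<le> s \<Longrightarrow> e 0 k = e t (k - h t) - (\<Sum>i = 1..t. q (i - 1) (k - h i))" for t
  proof (induction t)
    case 0
    have "k - h 0 = k" by (simp add: vec_eq_iff h_def seq_type_def)
    then show ?case by simp
  next
    case (Suc t) then show ?case using step[of t] by simp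
  qed
  have "\<exists>a. for_all_large (\<lambda>n. hilb (L s) ?M n = a)"
  proof (rule hilb_eventually_constant[OF Lg graded_sub_carrier LM, where I = "annihilator \<union> set xs"])
    show "kills (annihilator \<union> set xs) (L s) ?M"
      using ann0[of _ _ s] xsL[of _ s] by (auto simp: kills_def s_def)
  qed (use annS xs none in auto)
  then obtain a where a: "for_all_large (\<lambda>n. hilb (L s) ?M n = a)" ..
  have "k - h s = 0" using hk[of s] len by (simp add: seq_type_def vec_eq_iff)
  then have es: "e s (k - h s) = a"
    using hilbert_coeffs_constant[OF Lg graded_sub_carrier LM a] by (simp add: e_def)
  have mmM: "mixed_mult A S M grM = e 0"
    unfolding e_def L0
    by (rule mixed_mult_eq_hilbert_coeffs[OF graded_sub_zero graded_sub_carrier])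
       (use stable_subgroupD(2)[OF stable_carrier[OF order_refl]] component_length_self in auto)
  have mmQ: "mixed_mult A S (colon_quotient M (L i) (xs ! i)) (colon_quotient_grading M (L i) (xs ! i) grM) = q i"
    if i: "i < s" for i
  proof -
    have "colon M (L i) (xs ! i) = K i" by (simp add: colon_def K_def)
    then show ?thesis
      unfolding colon_quotient_def colon_quotient_grading_def q_def
      using mixed_mult_eq_hilbert_coeffs[OF _ _ _ component_length_quotient, of "L i" "K i"]
        Lg[of i] Kg[OF i] LK[OF i] i by simp
  qed
  have lens: "component_length A S (quotient_module M (L s)) (quotient_grading M (L s) grM) n
      = alen (L s \<inter> grM n) (?M \<inter> grM n)" for n
  proof -
    have "grM n \<inter> ?M = grM n" for n using Mgr.gr_closed by blast
    then show ?thesis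
      using component_length_quotient[OF Lg graded_sub_carrier LM, of s n] by simp
  qed
  have "for_all_large (\<lambda>n. component_length A S (quotient_module M (L s)) (quotient_grading M (L s) grM) n \<noteq> \<infinity> \<and>
      e 0 k = int (the_enat (component_length A S (quotient_module M (L s)) (quotient_grading M (L s) grM) n))
        - (\<Sum>i = 1..s. q (i - 1) (k - h i)))"
    using sum[of s] es section_finite_length[OF Lg graded_sub_carrier, of s]
    by (intro for_all_large_mono[OF a]) (simp add: lens hilb_def)
  moreover have "mixed_mult_defined A S M grM k"
    unfolding mixed_mult_defined_def mmM using e_vanish by blast
  moreover have "mixed_mult_defined A S (colon_quotient M (L (i - 1)) (xs ! (i - 1)))
      (colon_quotient_grading M (L (i - 1)) (xs ! (i - 1)) grM) (k - h i)" if "i \<in> {1..s}" for i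
    unfolding mixed_mult_defined_def
    using that mmQ[of "i - 1"] q_vanish[of "i - 1"] by (cases i) auto
  moreover have "(\<Sum>i = 1..s. mixed_mult A S (colon_quotient M (L (i - 1)) (xs ! (i - 1)))
      (colon_quotient_grading M (L (i - 1)) (xs ! (i - 1)) grM) (k - h i)) =
      (\<Sum>i = 1..s. q (i - 1) (k - h i))"
    by (rule sum.cong) (auto simp: mmQ)
  ultimately show ?thesis
    by (simp add: mmM Let_def flip: L_def h_def s_def)
qed

end
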